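(* Let the transmitters form a Neyman-Scott cluster process $\phi$ on $\mathbb{R}^2$ with parent intensity $\lambda_p$, a Poisson number of points per cluster with mean $\bar c$, and isotropic scattering density $f$. Assume Rayleigh fading (exponentially distributed power fading coefficients) and no noise ($W\equiv0$), and let $T>0$. Then the probability of successful transmission between the transmitter at the origin and a receiver located at $z\in\mathbb{R}^2$, $z\neq o$, is $$\mathbb{P}(\text{success})=\exp\Big\{-\lambda_p\int_{\mathbb{R}^2}\big[1-\exp(-\bar c\,\beta(z,y))\big]\,dy\Big\}\times\int_{\mathbb{R}^2}\exp(-\bar c\,\beta(z,y))f(y)\,dy,$$ where $$\beta(z,y)=\int_{\mathbb{R}^2}\frac{g(x-y-z)}{\frac{g(z)}{T}+g(x-y-z)}f(x)\,dx .$$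
   Context: Neyman-Scott cluster process: the parents form a stationary Poisson point process on $\mathbb{R}^2$ of intensity $\lambda_p>0$; to each parent $x$ is attached an independent cluster with a Poisson number (mean $\bar c>0$) of points located at $x$ plus i.i.d. displacements with isotropic probability density $f$; $\phi$ is the union of all clusters (parents not included). With $W\equiv0$, $\mathbb{P}(\text{success})=\mathbb{P}^{!0}\big(h\,g(z)/I_\phi(z)\ge T\big)$, where $I_\phi(z)=\sum_{x\in\phi}h_xg(x-z)$, the coefficients $h$ and $h_x$ are i.i.d. exponential with a common rate $\mu>0$ (Laplace transform $\mathcal{L}_h(s)=\mu/(\mu+s)$) and independent of $\phi$, and $\mathbb{P}^{!0}$ is the probability under the reduced Palm distribution of $\phi$ at the origin (conditioning on a point of $\phi$ at the origin and removing it). The path-loss function $g:\mathbb{R}^2\setminus\{o\}\to\mathbb{R}^+$ is a continuous, positive, non-increasing function of $\|x\|$, with $\int_{\mathbb{R}^2\setminus B(o,\epsilon)}g(x)\,dx<\infty$ for all $\epsilon>0$, and $\lim_{\|x\|\to\infty}g(x)/g(x-y)=1$ for all $y\in\mathbb{R}^2$. *)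

theory Defs
  imports "HOL-Probability.Probability"
begin

type_synonym plane = "real ^ 2"

section \<open>Point processes\<close>

definition locally_finite_set :: "plane set \<Rightarrow> bool" where
  "locally_finite_set A \<longleftrightarrow> (\<forall>B. bounded B \<longrightarrow> finite (A \<inter> B))"

text \<open>Simple locally finite point configurations, with the \<open>\<sigma>\<close>-algebra generated by the counts in
  bounded Borel sets.\<close>

definition configs :: "plane set measure" where
  "configs = sigma (Collect locally_finite_set)
     {{A. locally_finite_set A \<and> card (A \<inter> B) = n} | B n. B \<in> sets borel \<and> bounded B}"

definition point_process :: "'w measure \<Rightarrow> ('w \<Rightarrow> plane set) \<Rightarrow> bool" where
  "point_process M \<phi> \<longleftrightarrow> prob_space M \<and> \<phi> \<in> M \<rightarrow>\<^sub>M configs"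

text \<open>Independence is stated for countable disjoint families; finite ones are the case where almost
  all sets are empty.\<close>

definition poisson_process :: "'w measure \<Rightarrow> real \<Rightarrow> ('w \<Rightarrow> plane set) \<Rightarrow> bool" where
  "poisson_process M r \<Psi> \<longleftrightarrow>
     point_process M \<Psi> \<and>
     (\<forall>B n. B \<in> sets borel \<and> bounded B \<longrightarrow>
        measure M {\<omega> \<in> space M. card (\<Psi> \<omega> \<inter> B) = n}
          = (r * measure lborel B) ^ n / fact n * exp (- (r * measure lborel B))) \<and>
     (\<forall>B :: nat \<Rightarrow> plane set. disjoint_family B \<and> (\<forall>i. B i \<in> sets borel \<and> bounded (B i)) \<longrightarrow>
        prob_space.indep_vars M (\<lambda>_. count_space UNIV) (\<lambda>i \<omega>. card (\<Psi> \<omega> \<inter> B i)) UNIV)"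

section \<open>Neyman-Scott processes\<close>

definition isotropic_density :: "(plane \<Rightarrow> real) \<Rightarrow> bool" where
  "isotropic_density f \<longleftrightarrow>
     f \<in> borel_measurable borel \<and> (\<forall>x. 0 \<le> f x) \<and> (\<integral>\<^sup>+x. ennreal (f x) \<partial>lborel) = 1 \<and>
     (\<forall>x y. norm x = norm y \<longrightarrow> f x = f y)"

text \<open>Law of a cluster \<open>(N, D)\<close>: a Poisson number \<open>N\<close> of points and an independent i.i.d. sequence \<open>D\<close>
  of displacements, of which the first \<open>N\<close> are used.\<close>

definition cluster_law :: "real \<Rightarrow> (plane \<Rightarrow> real) \<Rightarrow> (nat \<times> (nat \<Rightarrow> plane)) measure" where
  "cluster_law c f = measure_pmf (poisson_pmf c) \<Otimes>\<^sub>M (\<Pi>\<^sub>M k\<in>UNIV. density lborel (\<lambda>x. ennreal (f x)))"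

definition cluster_points :: "plane \<Rightarrow> nat \<times> (nat \<Rightarrow> plane) \<Rightarrow> plane set" where
  "cluster_points x = (\<lambda>(N, D). (\<lambda>k. x + D k) ` {..<N})"

text \<open>The parents \<open>\<Psi>\<close> are enumerated without repetition by random points \<open>X n\<close> (\<open>\<Psi>\<close> is almost surely
  infinite for positive intensity), and \<open>C n\<close> is the cluster attached to \<open>X n\<close>.  The equation between
  laws says that the \<open>C n\<close> are i.i.d. with law \<^term>\<open>cluster_law c f\<close> and independent of the whole
  enumeration \<open>X\<close>.  Since displacements have a density, points of \<open>\<phi>\<close> almost surely do not coincide,
  so that the set-theoretic union loses no multiplicities.\<close>

definition neyman_scott_process ::
    "'w measure \<Rightarrow> real \<Rightarrow> real \<Rightarrow> (plane \<Rightarrow> real) \<Rightarrow> ('w \<Rightarrow> plane set) \<Rightarrow> bool" where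
  "neyman_scott_process M lp c f \<phi> \<longleftrightarrow>
     point_process M \<phi> \<and>
     (\<exists>\<Psi> (X :: nat \<Rightarrow> 'w \<Rightarrow> plane) (C :: nat \<Rightarrow> 'w \<Rightarrow> nat \<times> (nat \<Rightarrow> plane)).
        poisson_process M lp \<Psi> \<and>
        (\<forall>n. X n \<in> M \<rightarrow>\<^sub>M borel) \<and>
        (\<forall>n. C n \<in> M \<rightarrow>\<^sub>M cluster_law c f) \<and>
        (AE \<omega> in M. bij_betw (\<lambda>n. X n \<omega>) UNIV (\<Psi> \<omega>)) \<and>
        distr M ((\<Pi>\<^sub>M n\<in>UNIV. borel) \<Otimes>\<^sub>M (\<Pi>\<^sub>M n\<in>UNIV. cluster_law c f))
            (\<lambda>\<omega>. (\<lambda>n. X n \<omega>, \<lambda>n. C n \<omega>))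
          = distr M (\<Pi>\<^sub>M n\<in>UNIV. borel) (\<lambda>\<omega> n. X n \<omega>) \<Otimes>\<^sub>M (\<Pi>\<^sub>M n\<in>UNIV. cluster_law c f) \<and>
        (AE \<omega> in M. \<phi> \<omega> = (\<Union>n. cluster_points (X n \<omega>) (C n \<omega>))))"

section \<open>Reduced Palm distribution\<close>

text \<open>For a stationary process \<open>\<phi>\<close> of finite positive intensity \<open>\<lambda>\<close>, the reduced Palm distribution at
  the origin is
  \<open>P(Y) = (1 / (\<lambda> |W|)) E #{x \<in> \<phi> \<inter> W. (\<phi> - x) - {0} \<in> Y}\<close>, where \<open>\<lambda> |W| = E #(\<phi> \<inter> W)\<close> and the choice
  of the bounded window \<open>W\<close> of positive area is immaterial by stationarity; here \<open>W\<close> is the unit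
  square.\<close>

definition unit_square :: "plane set" where
  "unit_square = {x. \<forall>i. 0 \<le> x $ i \<and> x $ i \<le> 1}"

definition reduced_palm :: "'w measure \<Rightarrow> ('w \<Rightarrow> plane set) \<Rightarrow> plane set measure" where
  "reduced_palm M \<phi> = measure_of (space configs) (sets configs)
     (\<lambda>Y. (\<integral>\<^sup>+\<omega>. of_nat (card {x \<in> \<phi> \<omega> \<inter> unit_square. (\<lambda>y. y - x) ` \<phi> \<omega> - {0} \<in> Y}) \<partial>M)
            / (\<integral>\<^sup>+\<omega>. of_nat (card (\<phi> \<omega> \<inter> unit_square)) \<partial>M))"

section \<open>Path loss, fading and success probability\<close>

text \<open>The path loss is undefined at the origin; the value of \<open>g\<close> there is left arbitrary.\<close>

definition path_loss :: "(plane \<Rightarrow> real) \<Rightarrow> bool" where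
  "path_loss g \<longleftrightarrow>
     continuous_on (- {0}) g \<and>
     (\<forall>x. x \<noteq> 0 \<longrightarrow> 0 < g x) \<and>
     (\<forall>x y. x \<noteq> 0 \<and> norm x \<le> norm y \<longrightarrow> g y \<le> g x) \<and>
     (\<forall>\<epsilon>>0. set_integrable lborel (- ball 0 \<epsilon>) g) \<and>
     (\<forall>y. ((\<lambda>x. g x / g (x - y)) \<longlongrightarrow> 1) at_infinity)"

text \<open>Joint law of \<open>h\<close> and \<open>(h\<^sub>x)\<close> for \<open>x \<in> A\<close>.\<close>

definition fading_law :: "real \<Rightarrow> plane set \<Rightarrow> (real \<times> (plane \<Rightarrow> real)) measure" where
  "fading_law \<mu> A = density lborel (\<lambda>t. ennreal (exponential_density \<mu> t)) \<Otimes>\<^sub>M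
     (\<Pi>\<^sub>M x\<in>A. density lborel (\<lambda>t. ennreal (exponential_density \<mu> t)))"

definition interference ::
    "(plane \<Rightarrow> real) \<Rightarrow> plane \<Rightarrow> plane set \<Rightarrow> (plane \<Rightarrow> real) \<Rightarrow> ennreal" where
  "interference g z A H = (\<Sum>\<^sub>\<infinity>x\<in>A. ennreal (H x * g (x - z)))"

text \<open>Division in \<^typ>\<open>ennreal\<close> makes the ratio \<open>\<infinity>\<close> without interference and \<open>0\<close> if the interference is
  infinite.\<close>

definition success_event ::
    "real \<Rightarrow> (plane \<Rightarrow> real) \<Rightarrow> real \<Rightarrow> plane \<Rightarrow> plane set \<Rightarrow> (real \<times> (plane \<Rightarrow> real)) set" where
  "success_event \<mu> g T z A =
     {(h, H) \<in> space (fading_law \<mu> A). ennreal T \<le> ennreal (h * g z) / interference g z A H}"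

text \<open>As the fading is independent of the points, given the configuration \<open>A\<close> the coefficients have law
  \<^term>\<open>fading_law \<mu> A\<close>.  The point configuration follows the distribution \<open>P\<close>.\<close>

definition success_probability ::
    "real \<Rightarrow> (plane \<Rightarrow> real) \<Rightarrow> real \<Rightarrow> plane \<Rightarrow> plane set measure \<Rightarrow> real" where
  "success_probability \<mu> g T z P =
     (\<integral>A. measure (fading_law \<mu> A) (success_event \<mu> g T z A) \<partial>P)"

definition beta ::
    "(plane \<Rightarrow> real) \<Rightarrow> (plane \<Rightarrow> real) \<Rightarrow> real \<Rightarrow> plane \<Rightarrow> plane \<Rightarrow> real" where
  "beta g f T z y = (\<integral>x. g (x - y - z) / (g z / T + g (x - y - z)) * f x \<partial>lborel)"

end

theory Submission
  imports Defs
begin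

text \<open>Integrating out the exponential fading turns the success probability into the mean of
  \<open>exp (- \<Sum>\<^bsub>y \<in> A\<^esub> \<nu> y)\<close> over \<open>A\<close> with the reduced Palm distribution, where
  \<open>\<nu> y = ln (1 + T g(y - z) / g(z))\<close>, hence \<open>1 - exp (- \<nu> (d - y))\<close> is the integrand of \<open>\<beta>(z, y)\<close>.
  For the Palm mean, sum over all points \<open>x\<close> in a window and condition on the parents: the clusters
  of the other parents factorise into the generating function of a Poisson cluster, and within the
  cluster of \<open>x\<close> the Poisson identity \<open>E (N q\<^sup>N\<^sup>-\<^sup>1) = c exp (- c (1 - q))\<close> again produces a full
  independent cluster. Mecke's formula does the same for the parent process and leaves its Laplace
  functional. Mecke's formula follows from its case of void events, because the law of
  a simple process is determined by its void probabilities.\<close>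

section \<open>Laplace kernel and infinite product measures\<close>

text \<open>The obstacle is that \<phi> is a union of sets: as long as coincidences are possible, a
  sum over \<phi> is not a sum over clusters and their points. Expectations are therefore computed
  for the family of points indexed by parent number and point number, which makes sense before
  distinctness is known; one such expectation then shows that coincidences have probability zero,
  and only after that are the results carried over to \<phi>. Up to the final step all quantities
  live in \<open>ennreal\<close>, where sums and integrals can be exchanged freely. The kernel
  \<open>exp_neg\<close> is e^(-t) continued by 0 at infinity, so that infinite interference, and
  the infinite weight at the origin that detects coincidences, are ordinary values. The price is
  paid at the end: a Bochner integral that does not converge is 0 by convention, so the formula with
  real integrals requires the parent integral to be finite. This is where the integrability of the
  path loss away from the origin enters.\<close>

definition exp_neg :: "ennreal \<Rightarrow> ennreal" where
  "exp_neg t = (if t = \<top> then 0 else ennreal (exp (- enn2real t)))"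

lemma exp_neg_ennreal: "0 \<le> r \<Longrightarrow> exp_neg (ennreal r) = ennreal (exp (- r))"
  by (simp add: exp_neg_def)

lemma exp_neg_top [simp]: "exp_neg \<top> = 0"
  and exp_neg_0 [simp]: "exp_neg 0 = 1"
  by (simp_all add: exp_neg_def)

lemma exp_neg_le_1: "exp_neg t \<le> 1"
  by (simp add: exp_neg_def)

lemma measurable_exp_neg [measurable]: "exp_neg \<in> borel_measurable borel"
  unfolding exp_neg_def by measurable

lemma exp_neg_add: "exp_neg (s + t) = exp_neg s * exp_neg t"
  by (cases s; cases t)
    (simp_all add: exp_neg_ennreal exp_diff exp_minus divide_inverse ennreal_mult[symmetric] flip: ennreal_plus)

lemma exp_neg_sum: "finite I \<Longrightarrow> exp_neg (\<Sum>i\<in>I. f i) = (\<Prod>i\<in>I. exp_neg (f i))"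
  by (induction I rule: finite_induct) (simp_all add: exp_neg_add)

lemma exp_neg_antimono: "s \<le> t \<Longrightarrow> exp_neg t \<le> exp_neg s"
  by (cases s; cases t) (auto simp: exp_neg_ennreal top_unique)

lemma exp_neg_of_nat_mult: "exp_neg (of_nat n * t) = exp_neg t ^ n"
  by (induction n) (simp_all add: distrib_right exp_neg_add)

lemma tendsto_exp_neg_at_top:
  assumes "(X \<longlongrightarrow> (\<top>::ennreal)) F"
  shows "((\<lambda>n. exp_neg (X n)) \<longlongrightarrow> 0) F"
proof (rule order_tendstoI)
  fix a :: ennreal assume "0 < a"
  then obtain r where r: "0 < ennreal r" "ennreal r < a" "0 \<le> r"
    by (metis dense ennreal_cases less_irrefl less_top order_less_trans)
  then have "0 < r" by simp
  \<comment> \<open>\<open>exp (- t) \<le> r\<close> as soon as t reaches \<open>- ln r\<close>; the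
    maximum with 0 keeps the threshold non-negative when \<open>r > 1\<close>.\<close>
  have "eventually (\<lambda>n. ennreal (max 0 (- ln r)) < X n) F"
    using assms by (rule order_tendstoD) simp
  then show "eventually (\<lambda>n. exp_neg (X n) < a) F"
  proof eventually_elim
    case (elim n)
    have "exp_neg (X n) \<le> exp_neg (ennreal (max 0 (- ln r)))"
      using elim by (intro exp_neg_antimono) simp
    also have "\<dots> \<le> ennreal r"
      using \<open>0 < r\<close> by (auto simp: exp_neg_ennreal max_def ln_ge_zero_iff)
    finally show ?case using r by simp
  qed
qed auto

text \<open>Antitone and continuous up to infinity, so increasing limits of exponents become
  decreasing limits. Since \<open>enn2real\<close> jumps at \<open>\<top>\<close>, an infinite
  supremum is a separate case.\<close>

lemma exp_neg_SUP:
  assumes "incseq (f :: nat \<Rightarrow> ennreal)"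
  shows "exp_neg (SUP i. f i) = (INF i. exp_neg (f i))"
proof -
  have f: "f \<longlonglongrightarrow> (SUP i. f i)"
    using assms by (rule LIMSEQ_SUP)
  have "(\<lambda>i. exp_neg (f i)) \<longlonglongrightarrow> exp_neg (SUP i. f i)"
  proof (cases "(SUP i. f i) = \<top>")
    case True
    then show ?thesis using tendsto_exp_neg_at_top[of f sequentially] f by (metis exp_neg_top)
  next
    case False
    then have fin: "f i \<noteq> \<top>" for i
      by (metis SUP_upper UNIV_I top_unique)
    have "f \<longlonglongrightarrow> ennreal (enn2real (SUP i. f i))"
      using f False by (metis ennreal_enn2real less_top)
    then have "(\<lambda>i. enn2real (f i)) \<longlonglongrightarrow> enn2real (SUP i. f i)"
      by (rule tendsto_enn2real) simp
    then have "(\<lambda>i. ennreal (exp (- enn2real (f i)))) \<longlonglongrightarrow> ennreal (exp (- enn2real (SUP i. f i)))"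
      by (intro tendsto_ennrealI tendsto_exp tendsto_minus)
    then show ?thesis unfolding exp_neg_def by (simp only: False fin if_False)
  qed
  moreover have "(\<lambda>i. exp_neg (f i)) \<longlonglongrightarrow> (INF i. exp_neg (f i))"
    using assms by (intro LIMSEQ_INF decseq_SucI exp_neg_antimono incseq_SucD)
  ultimately show ?thesis by (rule LIMSEQ_unique)
qed

section \<open>Countable sums as integrals over the counting measure\<close>

lemma finite_to_nat_on_less:
  assumes "countable I"
  shows "finite {i \<in> I. to_nat_on I i < n}"
  by (rule finite_imageD[of "to_nat_on I"])
    (auto intro: finite_subset[of _ "{..<n}"] inj_on_subset[OF inj_on_to_nat_on[OF assms]])

text \<open>\<open>to_nat_on\<close> exhausts a countable index set, finite or infinite, by an
  increasing sequence of finite pieces, so that limits over \<open>I\<close> become limits of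
  sequences and monotone convergence applies.\<close>

lemma nn_integral_count_space_SUP:
  fixes f :: "'i \<Rightarrow> ennreal"
  assumes I: "countable I"
  shows "(\<integral>\<^sup>+i. f i \<partial>count_space I) = (SUP n. \<Sum>i | i \<in> I \<and> to_nat_on I i < n. f i)"
proof -
  let ?I = "\<lambda>n. {i \<in> I. to_nat_on I i < n}"
  have "(SUP n. f i * indicator (?I n) i) = f i" if "i \<in> I" for i
  proof (rule antisym)
    show "(SUP n. f i * indicator (?I n) i) \<le> f i"
      by (rule SUP_least) (auto split: split_indicator)
    have "f i * indicator (?I (Suc (to_nat_on I i))) i \<le> (SUP n. f i * indicator (?I n) i)"
      by (rule SUP_upper) simp
    then show "f i \<le> (SUP n. f i * indicator (?I n) i)" using that by simp
  qed
  then have "(\<integral>\<^sup>+i. f i \<partial>count_space I) = (\<integral>\<^sup>+i. (SUP n. f i * indicator (?I n) i) \<partial>count_space I)"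
    by (intro nn_integral_cong) simp
  also have "\<dots> = (SUP n. \<integral>\<^sup>+i. f i * indicator (?I n) i \<partial>count_space I)"
    by (intro nn_integral_monotone_convergence_SUP)
      (auto simp: incseq_def le_fun_def split: split_indicator)
  also have "\<dots> = (SUP n. \<Sum>i\<in>?I n. f i)"
  proof (rule SUP_cong[OF refl])
    fix n
    have "(\<integral>\<^sup>+i. f i * indicator (?I n) i \<partial>count_space I) = (\<Sum>i\<in>?I n. f i * indicator (?I n) i)"
      using I by (intro nn_integral_count_space' finite_to_nat_on_less) auto
    then show "(\<integral>\<^sup>+i. f i * indicator (?I n) i \<partial>count_space I) = (\<Sum>i\<in>?I n. f i)"
      by simp
  qed
  finally show ?thesis .
qed

text \<open>Both sides are suprema of finite partial sums. It translates the infinite sum that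
  defines the interference into the counting measure used everywhere else.\<close>

lemma infsum_eq_nn_integral_count_space:
  fixes f :: "'i \<Rightarrow> ennreal"
  assumes I: "countable I"
  shows "(\<Sum>\<^sub>\<infinity>i\<in>I. f i) = (\<integral>\<^sup>+i. f i \<partial>count_space I)"
proof -
  have "(\<Sum>\<^sub>\<infinity>i\<in>I. f i) = (SUP F\<in>{F. finite F \<and> F \<subseteq> I}. sum f F)"
    by (rule nonneg_infsum_complete) simp
  also have "\<dots> = (\<integral>\<^sup>+i. f i \<partial>count_space I)"
  proof (rule antisym)
    show "(SUP F\<in>{F. finite F \<and> F \<subseteq> I}. sum f F) \<le> (\<integral>\<^sup>+i. f i \<partial>count_space I)"
    proof (rule SUP_least)
      fix F assume F: "F \<in> {F. finite F \<and> F \<subseteq> I}"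
      then have "sum f F = (\<integral>\<^sup>+i. f i * indicator F i \<partial>count_space I)"
        by (subst nn_integral_count_space'[of F]) auto
      also have "\<dots> \<le> (\<integral>\<^sup>+i. f i \<partial>count_space I)"
        by (intro nn_integral_mono) (auto split: split_indicator)
      finally show "sum f F \<le> (\<integral>\<^sup>+i. f i \<partial>count_space I)" .
    qed
    show "(\<integral>\<^sup>+i. f i \<partial>count_space I) \<le> (SUP F\<in>{F. finite F \<and> F \<subseteq> I}. sum f F)"
      unfolding nn_integral_count_space_SUP[OF I]
      by (rule SUP_least) (auto intro!: SUP_upper finite_to_nat_on_less[OF I])
  qed
  finally show ?thesis .
qed

text \<open>Replacing coordinate \<open>k\<close> by an independent copy does not change the product
  law. The inner integral still runs over the full product, whose own coordinate \<open>k\<close> is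
  overwritten; this avoids splitting the index set into \<open>k\<close> and the rest.\<close>

lemma nn_integral_PiM_update:
  assumes "\<And>i. i \<in> I \<Longrightarrow> prob_space (M i)" and i: "k \<in> I"
    and [measurable]: "F \<in> borel_measurable (\<Pi>\<^sub>M i\<in>I. M i)"
  shows "(\<integral>\<^sup>+\<omega>. F \<omega> \<partial>(\<Pi>\<^sub>M i\<in>I. M i)) = (\<integral>\<^sup>+x. \<integral>\<^sup>+\<omega>. F (fun_upd \<omega> k x) \<partial>(\<Pi>\<^sub>M i\<in>I. M i) \<partial>M k)"
proof -
  interpret P: prob_space "\<Pi>\<^sub>M i\<in>I. M i"
    using assms by (intro prob_space_PiM)
  have I: "insert k I = I" using i by auto
  have [measurable]: "(\<lambda>(x, X). X(k := x)) \<in> (M k \<Otimes>\<^sub>M (\<Pi>\<^sub>M i\<in>I. M i)) \<rightarrow>\<^sub>M (\<Pi>\<^sub>M i\<in>I. M i)"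
    unfolding split_beta' using i by (intro measurable_fun_upd[where J=I]) auto
  have "(\<integral>\<^sup>+\<omega>. F \<omega> \<partial>(\<Pi>\<^sub>M i\<in>I. M i)) =
      (\<integral>\<^sup>+\<omega>. F \<omega> \<partial>distr (M k \<Otimes>\<^sub>M (\<Pi>\<^sub>M i\<in>I. M i)) (\<Pi>\<^sub>M i\<in>I. M i) (\<lambda>(x, X). X(k := x)))"
    using distr_pair_PiM_eq_PiM[of I M k] assms(1,2) by (simp add: I)
  also have "\<dots> = (\<integral>\<^sup>+x. \<integral>\<^sup>+\<omega>. F (fun_upd \<omega> k x) \<partial>(\<Pi>\<^sub>M i\<in>I. M i) \<partial>M k)"
    by (simp add: nn_integral_distr split_beta', subst P.nn_integral_fst[symmetric]) simp_all
  finally show ?thesis .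
qed

text \<open>Each inductive step resamples one coordinate, which the remaining factors do not
  read.\<close>

lemma nn_integral_PiM_prod:
  assumes prob: "\<And>i. i \<in> I \<Longrightarrow> prob_space (M i)" and J: "finite J" "J \<subseteq> I"
    and [measurable]: "\<And>i. i \<in> J \<Longrightarrow> u i \<in> borel_measurable (M i)"
  shows "(\<integral>\<^sup>+\<omega>. (\<Prod>i\<in>J. u i (\<omega> i)) \<partial>(\<Pi>\<^sub>M i\<in>I. M i)) = (\<Prod>i\<in>J. \<integral>\<^sup>+x. u i x \<partial>M i)"
  using J assms(4)
proof (induction J rule: finite_induct)
  case empty
  interpret P: prob_space "\<Pi>\<^sub>M i\<in>I. M i"
    using prob by (intro prob_space_PiM)
  show ?case by (simp add: P.emeasure_space_1)
next
  case (insert k J)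
  then have [measurable]: "i \<in> insert k J \<Longrightarrow> u i \<in> borel_measurable (M i)" for i by auto
  have [measurable]: "(\<lambda>\<omega>. u i (\<omega> i)) \<in> borel_measurable (\<Pi>\<^sub>M i\<in>I. M i)" if "i \<in> insert k J" for i
    using that insert.prems by (auto intro!: measurable_compose[OF measurable_component_singleton])
  have "(\<integral>\<^sup>+\<omega>. (\<Prod>i\<in>insert k J. u i (\<omega> i)) \<partial>(\<Pi>\<^sub>M i\<in>I. M i)) =
      (\<integral>\<^sup>+x. \<integral>\<^sup>+\<omega>. (\<Prod>i\<in>insert k J. u i ((fun_upd \<omega> k x) i)) \<partial>(\<Pi>\<^sub>M i\<in>I. M i) \<partial>M k)"
    using insert.prems prob by (intro nn_integral_PiM_update) auto
  also have "\<dots> = (\<integral>\<^sup>+x. \<integral>\<^sup>+\<omega>. u k x * (\<Prod>i\<in>J. u i (\<omega> i)) \<partial>(\<Pi>\<^sub>M i\<in>I. M i) \<partial>M k)"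
  proof (intro nn_integral_cong)
    fix x \<omega>
    have "(\<Prod>i\<in>J. u i ((fun_upd \<omega> k x) i)) = (\<Prod>i\<in>J. u i (\<omega> i))"
      using insert.hyps by (intro prod.cong) auto
    then show "(\<Prod>i\<in>insert k J. u i ((fun_upd \<omega> k x) i)) = u k x * (\<Prod>i\<in>J. u i (\<omega> i))"
      using insert.hyps by simp
  qed
  also have "\<dots> = (\<integral>\<^sup>+x. u k x \<partial>M k) * (\<Prod>i\<in>J. \<integral>\<^sup>+x. u i x \<partial>M i)"
    using insert by (subst nn_integral_cmult) (auto simp: nn_integral_multc)
  finally show ?case using insert.hyps by simp
qed

text \<open>Finite products pass to the limit by decreasing monotone convergence, the integrands
  being bounded by 1 under a probability measure. Giving the mean of each factor as
  \<open>exp_neg (w i)\<close> turns the infinite product of means into the exponential of a sum. It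
  serves both the fading coefficients and the clusters.\<close>

lemma nn_integral_PiM_exp_neg:
  assumes prob: "\<And>i. i \<in> I \<Longrightarrow> prob_space (M i)" and I: "countable I"
    and [measurable]: "\<And>i. i \<in> I \<Longrightarrow> u i \<in> borel_measurable (M i)"
    and w: "\<And>i. i \<in> I \<Longrightarrow> (\<integral>\<^sup>+x. exp_neg (u i x) \<partial>M i) = exp_neg (w i)"
  shows "(\<integral>\<^sup>+\<omega>. exp_neg (\<integral>\<^sup>+i. u i (\<omega> i) \<partial>count_space I) \<partial>(\<Pi>\<^sub>M i\<in>I. M i)) =
    exp_neg (\<integral>\<^sup>+i. w i \<partial>count_space I)"
proof -
  interpret P: prob_space "\<Pi>\<^sub>M i\<in>I. M i"
    using prob by (intro prob_space_PiM)
  let ?I = "\<lambda>n. {i \<in> I. to_nat_on I i < n}"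
  have fin [simp]: "finite (?I n)" for n
    using I by (rule finite_to_nat_on_less)
  have inc: "incseq (\<lambda>n. \<Sum>i\<in>?I n. f i)" for f :: "'a \<Rightarrow> ennreal"
    by (intro incseq_SucI sum_mono2) auto
  have [measurable]: "(\<lambda>\<omega>. u i (\<omega> i)) \<in> borel_measurable (\<Pi>\<^sub>M i\<in>I. M i)" if "i \<in> I" for i
    using that by (auto intro!: measurable_compose[OF measurable_component_singleton])
  have [measurable]: "(\<lambda>\<omega>. exp_neg (\<Sum>i\<in>?I n. u i (\<omega> i))) \<in> borel_measurable (\<Pi>\<^sub>M i\<in>I. M i)" for n
    by measurable
  have "(\<integral>\<^sup>+\<omega>. exp_neg (\<integral>\<^sup>+i. u i (\<omega> i) \<partial>count_space I) \<partial>(\<Pi>\<^sub>M i\<in>I. M i)) =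
      (\<integral>\<^sup>+\<omega>. (INF n. exp_neg (\<Sum>i\<in>?I n. u i (\<omega> i))) \<partial>(\<Pi>\<^sub>M i\<in>I. M i))"
    unfolding nn_integral_count_space_SUP[OF I] by (simp add: exp_neg_SUP[OF inc])
  also have "\<dots> = (INF n. \<integral>\<^sup>+\<omega>. exp_neg (\<Sum>i\<in>?I n. u i (\<omega> i)) \<partial>(\<Pi>\<^sub>M i\<in>I. M i))"
  proof (rule nn_integral_monotone_convergence_INF_decseq)
    show "decseq (\<lambda>n \<omega>. exp_neg (\<Sum>i\<in>?I n. u i (\<omega> i)))"
      by (intro decseq_SucI le_funI exp_neg_antimono incseq_SucD[OF inc])
    have "(\<integral>\<^sup>+\<omega>. exp_neg (\<Sum>i\<in>?I 0. u i (\<omega> i)) \<partial>(\<Pi>\<^sub>M i\<in>I. M i)) \<le> (\<integral>\<^sup>+\<omega>. 1 \<partial>(\<Pi>\<^sub>M i\<in>I. M i))"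
      by (intro nn_integral_mono exp_neg_le_1)
    also have "\<dots> < \<infinity>" by (simp add: P.emeasure_space_1)
    finally show "(\<integral>\<^sup>+\<omega>. exp_neg (\<Sum>i\<in>?I 0. u i (\<omega> i)) \<partial>(\<Pi>\<^sub>M i\<in>I. M i)) < \<infinity>" .
  qed simp
  also have "\<dots> = (INF n. exp_neg (\<Sum>i\<in>?I n. w i))"
  proof (rule INF_cong[OF refl])
    fix n
    have "(\<integral>\<^sup>+\<omega>. exp_neg (\<Sum>i\<in>?I n. u i (\<omega> i)) \<partial>(\<Pi>\<^sub>M i\<in>I. M i)) =
        (\<Prod>i\<in>?I n. \<integral>\<^sup>+x. exp_neg (u i x) \<partial>M i)"
      unfolding exp_neg_sum[OF fin] using prob by (intro nn_integral_PiM_prod) auto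
    also have "\<dots> = exp_neg (\<Sum>i\<in>?I n. w i)"
      unfolding exp_neg_sum[OF fin] by (intro prod.cong) (auto simp: w)
    finally show "(\<integral>\<^sup>+\<omega>. exp_neg (\<Sum>i\<in>?I n. u i (\<omega> i)) \<partial>(\<Pi>\<^sub>M i\<in>I. M i)) = exp_neg (\<Sum>i\<in>?I n. w i)" .
  qed
  also have "\<dots> = exp_neg (\<integral>\<^sup>+i. w i \<partial>count_space I)"
    unfolding nn_integral_count_space_SUP[OF I] by (simp add: exp_neg_SUP[OF inc])
  finally show ?thesis .
qed

section \<open>Measurability on the configuration space\<close>

lemma bounded_generators: "{{A. locally_finite_set A \<and> card (A \<inter> B) = n} | B n. B \<in> sets borel \<and> bounded B}
    \<subseteq> Pow (Collect locally_finite_set)"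
  by auto

lemma space_configs: "space configs = Collect locally_finite_set"
  unfolding configs_def by (rule space_measure_of[OF bounded_generators])

lemma sets_configs: "sets configs = sigma_sets (Collect locally_finite_set)
    {{A. locally_finite_set A \<and> card (A \<inter> B) = n} | B n. B \<in> sets borel \<and> bounded B}"
  unfolding configs_def by (rule sets_measure_of[OF bounded_generators])

lemma locally_finite_setD: "locally_finite_set A \<Longrightarrow> bounded B \<Longrightarrow> finite (A \<inter> B)"
  by (simp add: locally_finite_set_def)

lemma locally_finite_set_countable:
  assumes "locally_finite_set A"
  shows "countable A"
proof -
  have "A = (\<Union>n::nat. A \<inter> ball 0 (real n))"
    by (auto simp: reals_Archimedean2)
  moreover have "countable (\<Union>n::nat. A \<inter> ball 0 (real n))"
    by (rule countable_UN) (auto intro!: countable_finite locally_finite_setD[OF assms])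
  ultimately show ?thesis by simp
qed

lemma locally_finite_set_subset: "locally_finite_set A \<Longrightarrow> A' \<subseteq> A \<Longrightarrow> locally_finite_set A'"
  unfolding locally_finite_set_def by (meson Int_mono finite_subset order_refl)

lemma locally_finite_set_translate:
  assumes "locally_finite_set A"
  shows "locally_finite_set ((\<lambda>y. y - x) ` A)"
  unfolding locally_finite_set_def
proof (intro allI impI)
  fix B :: "plane set" assume "bounded B"
  then have "bounded ((\<lambda>y. x + y) ` B)" by (rule bounded_translation)
  then have "finite ((\<lambda>y. y - x) ` (A \<inter> (\<lambda>y. x + y) ` B))"
    using assms by (simp add: locally_finite_set_def)
  moreover have "(\<lambda>y. y - x) ` A \<inter> B \<subseteq> (\<lambda>y. y - x) ` (A \<inter> (\<lambda>y. x + y) ` B)"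
    by (auto simp: image_iff) (metis add.commute diff_add_cancel)
  ultimately show "finite ((\<lambda>y. y - x) ` A \<inter> B)" by (rule finite_subset[rotated])
qed

lemma nn_integral_count_space_card:
  assumes "locally_finite_set A" "bounded B"
  shows "(\<integral>\<^sup>+y. indicator B y \<partial>count_space A) = of_nat (card (A \<inter> B))"
proof -
  have "finite (A \<inter> B)" using assms by (rule locally_finite_setD)
  moreover have "(\<integral>\<^sup>+y. indicator B y \<partial>count_space A) = (\<integral>\<^sup>+y. indicator (A \<inter> B) y \<partial>count_space A)"
    by (intro nn_integral_cong) (auto split: split_indicator)
  ultimately show ?thesis
    by (simp add: emeasure_count_space_finite)
qed

lemma measurable_card_configs:
  assumes "B \<in> sets borel" "bounded B"
  shows "(\<lambda>A. card (A \<inter> B)) \<in> configs \<rightarrow>\<^sub>M count_space UNIV"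
proof (subst measurable_count_space_eq2_countable, safe)
  fix n
  have "{A. locally_finite_set A \<and> card (A \<inter> B) = n} \<in> sets configs"
    unfolding sets_configs using assms by (intro sigma_sets.Basic) blast
  also have "{A. locally_finite_set A \<and> card (A \<inter> B) = n} = (\<lambda>A. card (A \<inter> B)) -` {n} \<inter> space configs"
    by (auto simp: space_configs)
  finally show "(\<lambda>A. card (A \<inter> B)) -` {n} \<inter> space configs \<in> sets configs" .
qed auto

text \<open>Counts enter as integrals over \<open>count_space\<close>, because these obey the
  measurability rules for sums of weights; local finiteness turns them back into
  cardinalities.\<close>

lemma measurable_configsI:
  assumes lf: "\<And>\<omega>. \<omega> \<in> space N \<Longrightarrow> locally_finite_set (f \<omega>)"
    and [measurable]: "\<And>B. B \<in> sets borel \<Longrightarrow> bounded B \<Longrightarrow>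
      (\<lambda>\<omega>. \<integral>\<^sup>+y. indicator B y \<partial>count_space (f \<omega>)) \<in> borel_measurable N"
  shows "f \<in> N \<rightarrow>\<^sub>M configs"
  unfolding configs_def
proof (rule measurable_measure_of[OF bounded_generators])
  fix Y assume "Y \<in> {{A. locally_finite_set A \<and> card (A \<inter> B) = n} | B n. B \<in> sets borel \<and> bounded B}"
  then obtain B n where B[measurable]: "B \<in> sets borel" "bounded B"
    and Y: "Y = {A. locally_finite_set A \<and> card (A \<inter> B) = n}" by blast
  have "f -` Y \<inter> space N = {\<omega> \<in> space N. (\<integral>\<^sup>+y. indicator B y \<partial>count_space (f \<omega>)) = of_nat n}"
    using lf B(2) by (auto simp: Y nn_integral_count_space_card)
  also have "\<dots> \<in> sets N" using B by measurable
  finally show "f -` Y \<inter> space N \<in> sets N" .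
qed (use lf in auto)

text \<open>A monotone class argument: on a rectangle the sum is an indicator times a count, and
  counts generate \<open>configs\<close>.\<close>

lemma measurable_nn_integral_count_space_pair:
  assumes "K \<in> borel_measurable (N \<Otimes>\<^sub>M borel)"
  shows "(\<lambda>(a, A). \<integral>\<^sup>+y. K (a, y) \<partial>count_space A) \<in> borel_measurable (N \<Otimes>\<^sub>M configs)"
  using assms
proof (induction rule: borel_measurable_induct)
  case (cong f g)
  have "(\<lambda>(a, A). \<integral>\<^sup>+y. f (a, y) \<partial>count_space A) \<in> borel_measurable (N \<Otimes>\<^sub>M configs) \<longleftrightarrow>
      (\<lambda>(a, A). \<integral>\<^sup>+y. g (a, y) \<partial>count_space A) \<in> borel_measurable (N \<Otimes>\<^sub>M configs)"
    using cong by (intro measurable_cong) (auto simp: space_pair_measure intro!: nn_integral_cong)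
  then show ?case using cong by simp
next
  case (set S)
  \<comment> \<open>Cutting to a ball makes every sum finite, so that complements can be handled by
    subtraction; a supremum over \<open>n\<close> removes the cut.\<close>
  define R where "R n S = (\<lambda>(a, A). \<integral>\<^sup>+y. indicator S (a, y) * indicator (ball 0 (real n)) (y :: plane) \<partial>count_space A)"
    for n :: nat and S :: "('a \<times> plane) set"
  have R: "R n S \<in> borel_measurable (N \<Otimes>\<^sub>M configs)" for n
    using Int_stable_pair_measure_generator[of N "borel :: plane measure"]
      pair_measure_closed[of N "borel :: plane measure"] set
    unfolding sets_pair_measure
  proof (induction rule: sigma_sets_induct_disjoint)
    case (basic S)
    then obtain X Y where S: "S = X \<times> Y" and XY[measurable]: "X \<in> sets N" "Y \<in> sets borel" by auto
    have [measurable]: "(\<lambda>A. card (A \<inter> (Y \<inter> ball 0 (real n)))) \<in> configs \<rightarrow>\<^sub>M count_space UNIV"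
      using XY by (intro measurable_card_configs) (auto intro: bounded_subset[OF bounded_ball])
    have "R n S \<in> borel_measurable (N \<Otimes>\<^sub>M configs) \<longleftrightarrow>
        (\<lambda>(a, A). indicator X a * of_nat (card (A \<inter> (Y \<inter> ball 0 (real n)))) :: ennreal)
          \<in> borel_measurable (N \<Otimes>\<^sub>M configs)"
    proof (intro measurable_cong)
      fix w assume "w \<in> space (N \<Otimes>\<^sub>M configs)"
      then obtain a A where w: "w = (a, A)" "locally_finite_set A"
        by (auto simp: space_pair_measure space_configs)
      have "R n S w = (\<integral>\<^sup>+y. indicator X a * indicator (Y \<inter> ball 0 (real n)) y \<partial>count_space A)"
        unfolding R_def w S by (auto intro!: nn_integral_cong split: split_indicator)
      also have "\<dots> = indicator X a * of_nat (card (A \<inter> (Y \<inter> ball 0 (real n))))"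
        using w(2) by (subst nn_integral_cmult)
          (simp_all add: nn_integral_count_space_card bounded_Int)
      finally show "R n S w = (case w of (a, A) \<Rightarrow> indicator X a * of_nat (card (A \<inter> (Y \<inter> ball 0 (real n)))))"
        by (simp add: w)
    qed
    then show ?case by simp
  next
    case empty
    show ?case by (simp add: R_def split_beta')
  next
    case (compl S)
    have [measurable]: "(\<lambda>A. card (A \<inter> ball 0 (real n))) \<in> configs \<rightarrow>\<^sub>M count_space UNIV"
      by (intro measurable_card_configs) auto
    note [measurable] = compl.IH
    have "R n (space N \<times> space borel - S) \<in> borel_measurable (N \<Otimes>\<^sub>M configs) \<longleftrightarrow>
        (\<lambda>w. of_nat (card (snd w \<inter> ball 0 (real n))) - R n S w :: ennreal)
          \<in> borel_measurable (N \<Otimes>\<^sub>M configs)"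
    proof (intro measurable_cong)
      fix w assume "w \<in> space (N \<Otimes>\<^sub>M configs)"
      then obtain a A where w: "w = (a, A)" "locally_finite_set A" "a \<in> space N"
        by (auto simp: space_pair_measure space_configs)
      have le: "R n S w \<le> of_nat (card (A \<inter> ball 0 (real n)))"
        unfolding R_def w prod.case nn_integral_count_space_card[OF w(2) bounded_ball, symmetric]
        by (intro nn_integral_mono) (auto split: split_indicator)
      have "of_nat (card (A \<inter> ball 0 (real n))) = R n (space N \<times> space borel - S) w + R n S w"
        unfolding R_def w prod.case nn_integral_count_space_card[OF w(2) bounded_ball, symmetric]
        using w(3) by (subst nn_integral_add[symmetric]) (auto intro!: nn_integral_cong split: split_indicator)
      \<comment> \<open>In \<open>ennreal\<close> only a finite summand can be cancelled.\<close>
      moreover have "R n S w \<noteq> \<top>"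
        using le by (metis ennreal_of_nat_neq_top top_unique)
      ultimately show "R n (space N \<times> space borel - S) w = of_nat (card (snd w \<inter> ball 0 (real n))) - R n S w"
        by (simp add: w(1))
    qed
    then show ?case by simp
  next
    case (union D)
    note [measurable] = union.IH
    have "R n (\<Union>i. D i) = (\<lambda>w. \<Sum>i. R n (D i) w)"
    proof
      fix w :: "'a \<times> plane set" obtain a A where w: "w = (a, A)" by force
      have "R n (\<Union>i. D i) w =
          (\<integral>\<^sup>+y. (\<Sum>i. indicator (D i) (a, y) * indicator (ball 0 (real n)) y) \<partial>count_space A)"
        unfolding R_def w prod.case using suminf_indicator[OF union.hyps(1)]
        by (simp add: ennreal_suminf_multc)
      also have "\<dots> = (\<Sum>i. R n (D i) w)"
        unfolding R_def w prod.case by (rule nn_integral_suminf) simp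
      finally show "R n (\<Union>i. D i) w = (\<Sum>i. R n (D i) w)" .
    qed
    then show ?case by simp
  qed
  have "(\<lambda>(a, A). \<integral>\<^sup>+y. indicator S (a, y) \<partial>count_space A) = (\<lambda>w. SUP n. R n S w)"
  proof
    fix w :: "'a \<times> plane set" obtain a A where w: "w = (a, A)" by force
    have "(SUP n. R n S w) =
        (\<integral>\<^sup>+y. (SUP n. indicator S (a, y) * indicator (ball 0 (real n)) y) \<partial>count_space A)"
      unfolding R_def w prod.case
      by (intro nn_integral_monotone_convergence_SUP[symmetric])
        (auto simp: incseq_def le_fun_def split: split_indicator)
    also have "\<dots> = (\<integral>\<^sup>+y. indicator S (a, y) \<partial>count_space A)"
    proof (intro nn_integral_cong antisym)
      fix y :: plane
      show "(SUP n::nat. indicator S (a, y) * indicator (ball 0 (real n)) y) \<le> (indicator S (a, y) :: ennreal)"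
        by (rule SUP_least) (auto split: split_indicator)
      obtain n :: nat where "norm y < real n" using reals_Archimedean2 by blast
      then have "indicator S (a, y) = (indicator S (a, y) * indicator (ball 0 (real n)) y :: ennreal)"
        by (auto split: split_indicator)
      also have "\<dots> \<le> (SUP n::nat. indicator S (a, y) * indicator (ball 0 (real n)) y)"
        by (rule SUP_upper) simp
      finally show "indicator S (a, y) \<le> (SUP n::nat. indicator S (a, y) * indicator (ball 0 (real n)) y :: ennreal)" .
    qed
    finally show "(case w of (a, A) \<Rightarrow> \<integral>\<^sup>+y. indicator S (a, y) \<partial>count_space A) = (SUP n. R n S w)"
      by (simp add: w)
  qed
  then show ?case using R by simp
next
  case (mult u c)
  note [measurable] = mult.IH
  have "(\<lambda>(a, A). \<integral>\<^sup>+y. c * u (a, y) \<partial>count_space A) =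
      (\<lambda>w. c * (case w of (a, A) \<Rightarrow> \<integral>\<^sup>+y. u (a, y) \<partial>count_space A))"
    by (auto simp: nn_integral_cmult)
  then show ?case by simp
next
  case (add u v)
  note [measurable] = add.IH
  have "(\<lambda>(a, A). \<integral>\<^sup>+y. v (a, y) + u (a, y) \<partial>count_space A) =
      (\<lambda>w. (case w of (a, A) \<Rightarrow> \<integral>\<^sup>+y. v (a, y) \<partial>count_space A) +
        (case w of (a, A) \<Rightarrow> \<integral>\<^sup>+y. u (a, y) \<partial>count_space A))"
    by (auto simp: nn_integral_add)
  then show ?case by simp
next
  case (seq U)
  note [measurable] = seq.IH
  have "(\<lambda>(a, A). \<integral>\<^sup>+y. (SUP i. U i) (a, y) \<partial>count_space A) =
      (\<lambda>w. SUP i. (case w of (a, A) \<Rightarrow> \<integral>\<^sup>+y. U i (a, y) \<partial>count_space A))"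
    unfolding SUP_apply using seq.hyps
    by (auto intro!: nn_integral_monotone_convergence_SUP simp: incseq_def le_fun_def)
  then show ?case by simp
qed

text \<open>Here the summand and the configuration may both depend on the sample point. As a
  measurability rule it covers all later sums over random configurations.\<close>

lemma measurable_nn_integral_count_space [measurable (raw)]:
  fixes K :: "'a \<Rightarrow> plane \<Rightarrow> ennreal"
  assumes K: "(\<lambda>w. K (fst w) (snd w)) \<in> borel_measurable (N \<Otimes>\<^sub>M borel)"
    and h[measurable]: "h \<in> N \<rightarrow>\<^sub>M configs"
  shows "(\<lambda>a. \<integral>\<^sup>+y. K a y \<partial>count_space (h a)) \<in> borel_measurable N"
proof -
  have "(\<lambda>a. (a, h a)) \<in> N \<rightarrow>\<^sub>M N \<Otimes>\<^sub>M configs" by measurable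
  from measurable_compose[OF this measurable_nn_integral_count_space_pair[OF K]]
  show ?thesis by simp
qed

text \<open>Deleting a random point amounts to giving weight 0 to the set where
  \<open>y = x a\<close>, which is measurable jointly in \<open>a\<close> and
  \<open>y\<close>.\<close>

lemma measurable_configs_delete [measurable (raw)]:
  assumes [measurable]: "x \<in> N \<rightarrow>\<^sub>M borel" and h[measurable]: "h \<in> N \<rightarrow>\<^sub>M configs"
  shows "(\<lambda>a. h a - {x a}) \<in> N \<rightarrow>\<^sub>M configs"
proof (rule measurable_configsI)
  fix a assume "a \<in> space N"
  then show "locally_finite_set (h a - {x a})"
    using measurable_space[OF h] by (auto simp: space_configs intro: locally_finite_set_subset)
next
  fix B :: "plane set" assume [measurable]: "B \<in> sets borel"
  have "(\<integral>\<^sup>+y. indicator B y \<partial>count_space (h a - {x a})) =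
      (\<integral>\<^sup>+y. indicator B y * (if y = x a then 0 else 1) \<partial>count_space (h a))" for a
    by (subst (1 2) nn_integral_count_space_indicator)
      (auto intro!: nn_integral_cong split: split_indicator)
  then show "(\<lambda>a. \<integral>\<^sup>+y. indicator B y \<partial>count_space (h a - {x a})) \<in> borel_measurable N"
    by simp
qed

definition reduced_shift :: "plane \<Rightarrow> plane set \<Rightarrow> plane set" where
  "reduced_shift x A = (\<lambda>y. y - x) ` A - {0}"

lemma nn_integral_reduced_shift:
  "(\<integral>\<^sup>+y. u y \<partial>count_space (reduced_shift x A)) =
    (\<integral>\<^sup>+y. u (y - x) * (if y = x then 0 else 1) \<partial>count_space A)"
proof -
  have "reduced_shift x A = (\<lambda>y. y - x) ` (A - {x})"
    by (auto simp: reduced_shift_def)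
  then have "bij_betw (\<lambda>y. y - x) (A - {x}) (reduced_shift x A)"
    by (auto simp: bij_betw_def inj_on_def)
  from nn_integral_bij_count_space[OF this, of u]
  have "(\<integral>\<^sup>+y. u y \<partial>count_space (reduced_shift x A)) = (\<integral>\<^sup>+y. u (y - x) \<partial>count_space (A - {x}))"
    by simp
  also have "\<dots> = (\<integral>\<^sup>+y. u (y - x) * (if y = x then 0 else 1) \<partial>count_space A)"
    by (subst (1 2) nn_integral_count_space_indicator)
      (auto intro!: nn_integral_cong split: split_indicator)
  finally show ?thesis .
qed

lemma measurable_reduced_shift [measurable (raw)]:
  assumes [measurable]: "x \<in> N \<rightarrow>\<^sub>M borel" and h[measurable]: "h \<in> N \<rightarrow>\<^sub>M configs"
  shows "(\<lambda>a. reduced_shift (x a) (h a)) \<in> N \<rightarrow>\<^sub>M configs"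
proof (rule measurable_configsI)
  fix a assume "a \<in> space N"
  then have "locally_finite_set (h a)" using measurable_space[OF h] by (auto simp: space_configs)
  from locally_finite_set_translate[OF this, of "x a"]
  show "locally_finite_set (reduced_shift (x a) (h a))"
    unfolding reduced_shift_def by (rule locally_finite_set_subset) auto
next
  fix B :: "plane set" assume [measurable]: "B \<in> sets borel"
  show "(\<lambda>a. \<integral>\<^sup>+y. indicator B y \<partial>count_space (reduced_shift (x a) (h a))) \<in> borel_measurable N"
    unfolding nn_integral_reduced_shift by measurable
qed

section \<open>Void events\<close>

definition void_event :: "plane set \<Rightarrow> plane set set" where
  "void_event C = {A. locally_finite_set A \<and> A \<inter> C = {}}"

text \<open>This makes boxes with a void event stable under intersection, as the uniqueness of
  measures in \<open>mecke\<close> requires.\<close>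

lemma void_event_Int: "void_event C \<inter> void_event D = void_event (C \<union> D)"
  by (auto simp: void_event_def)

lemma void_event_in_sets_configs:
  assumes "C \<in> sets borel" "bounded C"
  shows "void_event C \<in> sets configs"
proof -
  have "void_event C = {A. locally_finite_set A \<and> card (A \<inter> C) = 0}"
    using locally_finite_setD[OF _ assms(2)] by (auto simp: void_event_def)
  then show ?thesis
    unfolding sets_configs using assms by (auto intro!: sigma_sets.Basic)
qed

text \<open>Members of a countable base tell any two points apart, and the first \<open>l\<close> of
  them cut the plane into finitely many Borel cells.\<close>

lemma separating_sequence:
  obtains U :: "nat \<Rightarrow> plane set"
  where "\<And>i. U i \<in> sets borel" "\<And>x y. x \<noteq> y \<Longrightarrow> \<exists>i. (x \<in> U i) \<noteq> (y \<in> U i)"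
proof -
  obtain \<B> :: "plane set set" where \<B>: "countable \<B>" "topological_basis \<B>"
    using ex_countable_basis by blast
  have "\<exists>S\<in>\<B>. (x \<in> S) \<noteq> (y \<in> S)" if "x \<noteq> y" for x y :: plane
  proof -
    obtain V where V: "open V" "x \<in> V" "y \<notin> V" using \<open>x \<noteq> y\<close> by (meson t1_space)
    obtain S where "S \<in> \<B>" "x \<in> S" "S \<subseteq> V"
      using topological_basisE[OF \<B>(2) V(1,2)] by blast
    with V show ?thesis by blast
  qed
  moreover from this[of 0 1] have "\<B> \<noteq> {}" by auto
  ultimately show ?thesis
    using \<B> by (intro that[of "from_nat_into \<B>"])
      (auto intro!: borel_open topological_basis_open from_nat_into, metis from_nat_into_surj)
qed

text \<open>A configuration is simple, so it meets every bounded set in as many points as it has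
  occupied cells, once the partition into cells is fine enough.\<close>

lemma sets_configs_void:
  "sets configs = sigma_sets (Collect locally_finite_set) {void_event C | C. C \<in> sets borel \<and> bounded C}"
    (is "_ = sigma_sets ?\<Omega> ?V")
proof
  show "sigma_sets ?\<Omega> ?V \<subseteq> sets configs"
    unfolding space_configs[symmetric]
    by (rule sets.sigma_sets_subset) (auto intro: void_event_in_sets_configs)
next
  obtain U :: "nat \<Rightarrow> plane set" where U[measurable]: "\<And>i. U i \<in> sets borel"
    and sep: "\<And>x y. x \<noteq> y \<Longrightarrow> \<exists>i. (x \<in> U i) \<noteq> (y \<in> U i)"
    using separating_sequence by blast
  \<comment> \<open>\<open>code l x\<close> names the cell of \<open>x\<close> in the partition
    generated by \<open>U 0\<close>, ..., \<open>U (l - 1)\<close>.\<close>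
  define code where "code l x = {i. i < l \<and> x \<in> U i}" for l and x
  define V where "V = sigma ?\<Omega> ?V"
  have V_Pow: "?V \<subseteq> Pow ?\<Omega>" by (auto simp: void_event_def)
  have sets_V: "sets V = sigma_sets ?\<Omega> ?V" and space_V: "space V = ?\<Omega>"
    unfolding V_def by (simp_all add: V_Pow)
  have occupied: "{A \<in> space V. s \<in> code l ` (A \<inter> B)} \<in> sets V"
    if B: "B \<in> sets borel" "bounded B" for B l s
  proof -
    have [measurable]: "{x. code l x = s} \<in> sets borel"
    proof (cases "s \<subseteq> {..<l}")
      case True
      then have "{x. code l x = s} = {x \<in> space borel. \<forall>i\<in>{..<l}. x \<in> U i \<longleftrightarrow> i \<in> s}"
        by (auto simp: code_def)
      also have "\<dots> \<in> sets borel" by measurable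
      finally show ?thesis .
    next
      case False
      then have "{x. code l x = s} = {}" by (auto simp: code_def)
      then show ?thesis by simp
    qed
    have "void_event (B \<inter> {x. code l x = s}) \<in> sets V"
      unfolding sets_V using B by (auto intro!: sigma_sets.Basic bounded_Int)
    then have "space V - void_event (B \<inter> {x. code l x = s}) \<in> sets V" by auto
    also have "space V - void_event (B \<inter> {x. code l x = s}) = {A \<in> space V. s \<in> code l ` (A \<inter> B)}"
      by (auto simp: space_V void_event_def)
    finally show ?thesis .
  qed
  have count: "{A. locally_finite_set A \<and> card (A \<inter> B) = n} \<in> sets V"
    if B: "B \<in> sets borel" "bounded B" for B n
  proof -
    \<comment> \<open>Finitely many points have finitely many separating indices; once
      \<open>l\<close> exceeds them all, the points lie in different cells.\<close>
    have inj: "\<exists>L. \<forall>l\<ge>L. inj_on (code l) F" if "finite F" for F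
    proof -
      obtain d where d: "\<And>x y. x \<noteq> y \<Longrightarrow> (x \<in> U (d x y)) \<noteq> (y \<in> U (d x y))"
        using sep by metis
      have "finite ((\<lambda>(x, y). d x y) ` (F \<times> F))" using that by auto
      then obtain L where L: "\<And>k. k \<in> (\<lambda>(x, y). d x y) ` (F \<times> F) \<Longrightarrow> k < L"
        by (meson finite_nat_set_iff_bounded)
      have "inj_on (code l) F" if "l \<ge> L" for l
      proof (rule inj_onI, rule ccontr)
        fix x y assume xy: "x \<in> F" "y \<in> F" "code l x = code l y" "x \<noteq> y"
        then have "d x y < l" using L[of "d x y"] that by force
        then show False using xy(3) d[OF xy(4)] by (auto simp: code_def set_eq_iff)
      qed
      then show ?thesis by blast
    qed
    have card_code: "card (code l ` (A \<inter> B)) = (\<Sum>s\<in>Pow {..<l}. if s \<in> code l ` (A \<inter> B) then 1 else 0)" for l A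
    proof -
      have "code l ` (A \<inter> B) \<subseteq> Pow {..<l}" by (auto simp: code_def)
      then show ?thesis by (simp add: sum.If_cases Int_absorb1)
    qed
    have [measurable]: "(\<lambda>A. card (code l ` (A \<inter> B))) \<in> V \<rightarrow>\<^sub>M count_space UNIV" for l
      unfolding card_code using occupied[OF B, of _ l] by (intro measurable_sum_nat measurable_If) auto
    \<comment> \<open>The limit of the numbers of occupied cells is written as eventual equality,
      which uses only countable unions and intersections.\<close>
    have "{A. locally_finite_set A \<and> card (A \<inter> B) = n} =
        {A \<in> space V. \<exists>L. \<forall>l\<in>{L..}. card (code l ` (A \<inter> B)) = n}"
    proof -
      have "card (A \<inter> B) = n \<longleftrightarrow> (\<exists>L. \<forall>l\<in>{L..}. card (code l ` (A \<inter> B)) = n)"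
        if lf: "locally_finite_set A" for A
      proof -
        obtain L where L: "\<And>l. l \<ge> L \<Longrightarrow> card (code l ` (A \<inter> B)) = card (A \<inter> B)"
          using inj[OF locally_finite_setD[OF lf B(2)]] by (metis card_image)
        show ?thesis
        proof
          show "card (A \<inter> B) = n \<Longrightarrow> \<exists>L. \<forall>l\<in>{L..}. card (code l ` (A \<inter> B)) = n"
            using L by auto
          assume "\<exists>L. \<forall>l\<in>{L..}. card (code l ` (A \<inter> B)) = n"
          then obtain L' where "\<forall>l\<in>{L'..}. card (code l ` (A \<inter> B)) = n" by blast
          then have "card (code (max L L') ` (A \<inter> B)) = n" by simp
          then show "card (A \<inter> B) = n" using L[of "max L L'"] by simp
        qed
      qed
      then show ?thesis by (auto simp: space_V)
    qed
    also have "\<dots> \<in> sets V" by measurable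
    finally show ?thesis .
  qed
  have "sigma_sets (space V)
      {{A. locally_finite_set A \<and> card (A \<inter> B) = n} | B n. B \<in> sets borel \<and> bounded B} \<subseteq> sets V"
    by (rule sets.sigma_sets_subset) (use count in auto)
  then show "sets configs \<subseteq> sigma_sets ?\<Omega> ?V"
    by (simp only: sets_configs sets_V space_V)
qed

section \<open>Generating function of the Poisson law and its derivative\<close>

lemma poisson_pgf:
  assumes "0 \<le> l" "q \<le> 1"
  shows "(\<Sum>n. ennreal (l ^ n / fact n * exp (- l)) * q ^ n) = exp_neg (ennreal l * (1 - q))"
proof -
  obtain p where p: "q = ennreal p" "0 \<le> p" "p \<le> 1" using assms(2) by (cases q) (auto simp: top_unique)
  have "(\<lambda>n. inverse (fact n) * (l * p) ^ n * exp (- l)) sums (exp (l * p) * exp (- l))"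
    using exp_converges[of "l * p"] by (intro sums_mult2) simp
  then have "(\<lambda>n. l ^ n / fact n * exp (- l) * p ^ n) sums (exp (- (l * (1 - p))))"
    by (simp add: power_mult_distrib divide_inverse mult_ac algebra_simps exp_diff exp_minus)
  then have "(\<Sum>n. ennreal (l ^ n / fact n * exp (- l) * p ^ n)) = ennreal (exp (- (l * (1 - p))))"
    using assms p by (intro suminf_ennreal_eq) auto
  moreover have 1: "ennreal (l ^ n / fact n * exp (- l)) * q ^ n = ennreal (l ^ n / fact n * exp (- l) * p ^ n)" for n
    using assms p by (simp add: ennreal_power flip: ennreal_mult)
  moreover have 2: "ennreal l * (1 - q) = ennreal (l * (1 - p))"
    using assms p by (simp add: ennreal_mult' ennreal_minus flip: ennreal_1)
  moreover have "exp_neg (ennreal (l * (1 - p))) = ennreal (exp (- (l * (1 - p))))"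
    using assms p by (intro exp_neg_ennreal) simp
  ultimately show ?thesis by simp
qed

text \<open>From \<open>n * l ^ n / fact n = l * (l ^ (n - 1) / fact (n - 1))\<close> for positive
  \<open>n\<close>, the series is \<open>l\<close> times the shifted series of
  \<open>poisson_pgf\<close>: a size-biased Poisson number minus one is again Poisson. At
  \<open>n = 0\<close> the truncated exponent does no harm, since its weight is 0.\<close>

lemma poisson_pgf_deriv:
  assumes "0 \<le> l" "q \<le> 1"
  shows "(\<Sum>n. ennreal (l ^ n / fact n * exp (- l)) * (of_nat n * q ^ (n - 1))) =
    ennreal l * exp_neg (ennreal l * (1 - q))"
proof -
  have step: "ennreal (l ^ Suc n / fact (Suc n) * exp (- l)) * (of_nat (Suc n) * q ^ n) =
      ennreal l * (ennreal (l ^ n / fact n * exp (- l)) * q ^ n)" for n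
  proof -
    have "ennreal (l ^ Suc n / fact (Suc n) * exp (- l)) * ennreal (real (Suc n)) =
        ennreal l * ennreal (l ^ n / fact n * exp (- l))"
      using assms(1) by (simp add: field_simps del: of_nat_Suc flip: ennreal_mult)
    then show ?thesis
      by (simp only: ennreal_of_nat_eq_real_of_nat mult.assoc[symmetric])
  qed
  have "(\<Sum>n. ennreal (l ^ n / fact n * exp (- l)) * (of_nat n * q ^ (n - 1))) =
      (\<Sum>n. ennreal (l ^ Suc n / fact (Suc n) * exp (- l)) * (of_nat (Suc n) * q ^ n))"
    by (subst suminf_offset[of _ 1]) (simp_all add: summableI del: of_nat_Suc fact_Suc power_Suc)
  also have "\<dots> = ennreal l * exp_neg (ennreal l * (1 - q))"
    unfolding step using poisson_pgf[OF assms] by simp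
  finally show ?thesis .
qed

section \<open>Poisson processes\<close>

text \<open>The enumeration \<open>X\<close> turns sums over the random set \<Psi> into countable
  sums of random variables. It yields the reduced Campbell measure in \<open>mecke\<close> and later
  ties each parent to its cluster.\<close>

locale enumerated_poisson_process =
  fixes M :: "'w measure" and r :: real and \<Psi> :: "'w \<Rightarrow> plane set" and X :: "nat \<Rightarrow> 'w \<Rightarrow> plane"
  assumes rate_nonneg: "0 \<le> r" and poisson: "poisson_process M r \<Psi>"
    and X_measurable [measurable]: "\<And>n. X n \<in> M \<rightarrow>\<^sub>M borel"
    and X_bij: "AE \<omega> in M. bij_betw (\<lambda>n. X n \<omega>) UNIV (\<Psi> \<omega>)"
begin

sublocale prob_space M
  using poisson by (simp add: poisson_process_def point_process_def)

lemma measurable_process [measurable]: "\<Psi> \<in> M \<rightarrow>\<^sub>M configs"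
  using poisson by (simp add: poisson_process_def point_process_def)

lemma locally_finite_process: "\<omega> \<in> space M \<Longrightarrow> locally_finite_set (\<Psi> \<omega>)"
  using measurable_space[OF measurable_process] by (simp add: space_configs)

lemma measurable_count:
  "B \<in> sets borel \<Longrightarrow> bounded B \<Longrightarrow> (\<lambda>\<omega>. card (\<Psi> \<omega> \<inter> B)) \<in> M \<rightarrow>\<^sub>M count_space UNIV"
  using measurable_compose[OF measurable_process measurable_card_configs] .

lemma prob_count:
  "B \<in> sets borel \<Longrightarrow> bounded B \<Longrightarrow> prob {\<omega> \<in> space M. card (\<Psi> \<omega> \<inter> B) = n}
    = (r * measure lborel B) ^ n / fact n * exp (- (r * measure lborel B))"
  using poisson by (simp add: poisson_process_def)

lemma nn_integral_count:
  fixes F :: "nat \<Rightarrow> ennreal"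
  assumes B: "B \<in> sets borel" "bounded B"
  shows "(\<integral>\<^sup>+\<omega>. F (card (\<Psi> \<omega> \<inter> B)) \<partial>M) =
    (\<Sum>n. ennreal ((r * measure lborel B) ^ n / fact n * exp (- (r * measure lborel B))) * F n)"
proof -
  note [measurable] = measurable_count[OF B]
  have single: "F k = (\<Sum>n. F n * indicator {k} n)" for k
  proof -
    have "(\<Sum>n. F n * indicator {k} n) = (\<Sum>n\<in>{k}. F n * indicator {k} n)"
      by (rule suminf_finite) auto
    then show ?thesis by simp
  qed
  have "(\<integral>\<^sup>+\<omega>. F (card (\<Psi> \<omega> \<inter> B)) \<partial>M) =
      (\<integral>\<^sup>+\<omega>. (\<Sum>n. F n * indicator {\<omega> \<in> space M. card (\<Psi> \<omega> \<inter> B) = n} \<omega>) \<partial>M)"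
    by (intro nn_integral_cong, subst single) (auto intro!: suminf_cong split: split_indicator)
  also have "\<dots> = (\<Sum>n. F n * emeasure M {\<omega> \<in> space M. card (\<Psi> \<omega> \<inter> B) = n})"
    by (subst nn_integral_suminf) (simp_all add: nn_integral_cmult)
  finally show ?thesis
    by (simp add: emeasure_eq_measure prob_count[OF B] mult.commute)
qed

lemma emeasure_lborel_bounded:
  assumes "bounded (B :: plane set)"
  shows "ennreal r * emeasure lborel B = ennreal (r * measure lborel B)"
  using emeasure_bounded_finite[OF assms] rate_nonneg
  by (simp add: emeasure_eq_ennreal_measure ennreal_mult)

lemma nn_integral_power_count:
  assumes "B \<in> sets borel" "bounded B" "q \<le> 1"
  shows "(\<integral>\<^sup>+\<omega>. q ^ card (\<Psi> \<omega> \<inter> B) \<partial>M) = exp_neg (ennreal r * emeasure lborel B * (1 - q))"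
  using assms rate_nonneg poisson_pgf[of "r * measure lborel B" q]
  by (simp add: nn_integral_count[of B "\<lambda>n. q ^ n"] emeasure_lborel_bounded)

lemma nn_integral_power_count_deriv:
  assumes "B \<in> sets borel" "bounded B" "q \<le> 1"
  shows "(\<integral>\<^sup>+\<omega>. of_nat (card (\<Psi> \<omega> \<inter> B)) * q ^ (card (\<Psi> \<omega> \<inter> B) - 1) \<partial>M) =
    ennreal r * emeasure lborel B * exp_neg (ennreal r * emeasure lborel B * (1 - q))"
  using assms rate_nonneg poisson_pgf_deriv[of "r * measure lborel B" q]
    nn_integral_count[of B "\<lambda>n. of_nat n * q ^ (n - 1)"]
  by (simp add: emeasure_lborel_bounded)

section \<open>Independent counts and the Laplace functional\<close>

lemma nn_integral_prod_count:
  fixes F :: "'i \<Rightarrow> nat \<Rightarrow> ennreal"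
  assumes I: "finite I" and B: "\<And>i. i \<in> I \<Longrightarrow> B i \<in> sets borel" "\<And>i. i \<in> I \<Longrightarrow> bounded (B i)"
    and disj: "disjoint_family_on B I"
  shows "(\<integral>\<^sup>+\<omega>. (\<Prod>i\<in>I. F i (card (\<Psi> \<omega> \<inter> B i))) \<partial>M) = (\<Prod>i\<in>I. \<integral>\<^sup>+\<omega>. F i (card (\<Psi> \<omega> \<inter> B i)) \<partial>M)"
proof -
  obtain h where h: "bij_betw h {..<card I} I"
    using I by (metis atLeast0LessThan ex_bij_betw_nat_finite)
  then have h_in: "k < card I \<Longrightarrow> h k \<in> I" for k by (auto dest: bij_betwE)
  \<comment> \<open>Independence is postulated for families indexed by all natural numbers, so the
    finite family is continued by empty sets.\<close>
  define B' where "B' k = (if k < card I then B (h k) else {})" for k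
  have "disjoint_family B'"
  proof (unfold disjoint_family_on_def, intro ballI impI)
    fix m n :: nat assume "m \<noteq> n"
    show "B' m \<inter> B' n = {}"
    proof (cases "m < card I \<and> n < card I")
      case True
      then have "h m \<noteq> h n" using h \<open>m \<noteq> n\<close> by (auto simp: bij_betw_def inj_on_def)
      with True h_in disj show ?thesis unfolding disjoint_family_on_def B'_def by simp
    qed (auto simp: B'_def)
  qed
  then have "indep_vars (\<lambda>_. count_space UNIV) (\<lambda>i \<omega>. card (\<Psi> \<omega> \<inter> B' i)) UNIV"
    using poisson B h_in unfolding poisson_process_def B'_def by (auto split: if_splits)
  then have "indep_vars (\<lambda>_. borel) (\<lambda>i \<omega>. F (h i) (card (\<Psi> \<omega> \<inter> B' i))) UNIV"
    by (rule indep_vars_compose2) simp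
  then have "indep_vars (\<lambda>_. borel) (\<lambda>i \<omega>. F (h i) (card (\<Psi> \<omega> \<inter> B' i))) {..<card I}"
    by (rule indep_vars_subset) simp
  then have "(\<integral>\<^sup>+\<omega>. (\<Prod>i<card I. F (h i) (card (\<Psi> \<omega> \<inter> B' i))) \<partial>M) =
      (\<Prod>i<card I. \<integral>\<^sup>+\<omega>. F (h i) (card (\<Psi> \<omega> \<inter> B' i)) \<partial>M)"
    by (intro indep_vars_nn_integral) auto
  then show ?thesis
    unfolding prod.reindex_bij_betw[OF h, symmetric] by (simp add: B'_def)
qed

text \<open>The exponent is a weighted sum of the counts in the level sets of \<open>u\<close>,
  which are independent Poisson variables. An infinite weight is allowed: \<open>exp_neg\<close>
  turns it into \<open>0 ^ N\<close>, the indicator that the level set holds no point.\<close>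

lemma laplace_functional_simple:
  fixes u :: "plane \<Rightarrow> ennreal"
  assumes u: "simple_function borel u" and bdd: "bounded {y. u y \<noteq> 0}"
  shows "(\<integral>\<^sup>+\<omega>. exp_neg (\<integral>\<^sup>+y. u y \<partial>count_space (\<Psi> \<omega>)) \<partial>M) =
    exp_neg (ennreal r * (\<integral>\<^sup>+y. (1 - exp_neg (u y)) \<partial>lborel))"
proof -
  have [measurable]: "u \<in> borel_measurable borel" using u by (rule borel_measurable_simple_function)
  \<comment> \<open>The level set of 0 may be unbounded and contributes nothing; the others are
    bounded by \<open>bdd\<close>, hence within reach of \<open>poisson_process\<close>.\<close>
  define R where "R = range u - {0}"
  have R: "finite R" using u by (simp add: R_def simple_function_def)
  define B where "B t = {y. u y = t}" for t
  have B[measurable]: "B t \<in> sets borel" for t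
    unfolding B_def by measurable
  have B_bdd: "bounded (B t)" if "t \<in> R" for t
    using that by (intro bounded_subset[OF bdd]) (auto simp: B_def R_def)
  have level: "(\<Sum>t\<in>R. G t * indicator (B t) y) = (if u y = 0 then 0 else G (u y))" for G :: "ennreal \<Rightarrow> ennreal" and y
  proof -
    have "(\<Sum>t\<in>R. G t * indicator (B t) y) = (\<Sum>t\<in>R. if t = u y then G t else 0)"
      by (intro sum.cong) (auto simp: B_def split: split_indicator)
    then show ?thesis using R by (auto simp: R_def)
  qed
  have "(\<integral>\<^sup>+y. u y \<partial>count_space (\<Psi> \<omega>)) = (\<Sum>t\<in>R. of_nat (card (\<Psi> \<omega> \<inter> B t)) * t)" if "\<omega> \<in> space M" for \<omega>
  proof -
    have "(\<integral>\<^sup>+y. u y \<partial>count_space (\<Psi> \<omega>)) = (\<integral>\<^sup>+y. (\<Sum>t\<in>R. t * indicator (B t) y) \<partial>count_space (\<Psi> \<omega>))"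
      by (intro nn_integral_cong) (simp add: level[of "\<lambda>t. t"])
    also have "\<dots> = (\<Sum>t\<in>R. t * (\<integral>\<^sup>+y. indicator (B t) y \<partial>count_space (\<Psi> \<omega>)))"
      by (subst nn_integral_sum) (simp_all add: nn_integral_cmult)
    also have "\<dots> = (\<Sum>t\<in>R. of_nat (card (\<Psi> \<omega> \<inter> B t)) * t)"
      by (intro sum.cong refl)
        (simp add: nn_integral_count_space_card[OF locally_finite_process[OF that] B_bdd] mult.commute del: nn_integral_indicator)
    finally show ?thesis .
  qed
  then have "(\<integral>\<^sup>+\<omega>. exp_neg (\<integral>\<^sup>+y. u y \<partial>count_space (\<Psi> \<omega>)) \<partial>M) =
      (\<integral>\<^sup>+\<omega>. (\<Prod>t\<in>R. exp_neg t ^ card (\<Psi> \<omega> \<inter> B t)) \<partial>M)"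
    by (intro nn_integral_cong) (simp add: exp_neg_sum R exp_neg_of_nat_mult)
  also have "\<dots> = (\<Prod>t\<in>R. \<integral>\<^sup>+\<omega>. exp_neg t ^ card (\<Psi> \<omega> \<inter> B t) \<partial>M)"
    using R B_bdd by (intro nn_integral_prod_count) (auto simp: disjoint_family_on_def B_def[symmetric], auto simp: B_def)
  also have "\<dots> = exp_neg (\<Sum>t\<in>R. ennreal r * emeasure lborel (B t) * (1 - exp_neg t))"
    unfolding exp_neg_sum[OF R]
    by (intro prod.cong refl nn_integral_power_count B B_bdd exp_neg_le_1)
  also have "(\<Sum>t\<in>R. ennreal r * emeasure lborel (B t) * (1 - exp_neg t)) =
      ennreal r * (\<Sum>t\<in>R. (1 - exp_neg t) * emeasure lborel (B t))"
    by (simp add: sum_distrib_left mult_ac)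
  also have "(\<Sum>t\<in>R. (1 - exp_neg t) * emeasure lborel (B t)) =
      (\<integral>\<^sup>+y. (\<Sum>t\<in>R. (1 - exp_neg t) * indicator (B t) y) \<partial>lborel)"
    by (subst nn_integral_sum) (simp_all add: nn_integral_cmult)
  also have "\<dots> = (\<integral>\<^sup>+y. (1 - exp_neg (u y)) \<partial>lborel)"
    by (intro nn_integral_cong) (simp add: level)
  finally show ?thesis .
qed

text \<open>Along an increasing approximation of \<open>u\<close> the integrand on the left
  decreases and stays below 1, while \<open>1 - exp_neg\<close> on the right increases, so monotone
  convergence applies to each side.\<close>

lemma laplace_functional:
  fixes u :: "plane \<Rightarrow> ennreal"
  assumes [measurable]: "u \<in> borel_measurable borel"
  shows "(\<integral>\<^sup>+\<omega>. exp_neg (\<integral>\<^sup>+y. u y \<partial>count_space (\<Psi> \<omega>)) \<partial>M) =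
    exp_neg (ennreal r * (\<integral>\<^sup>+y. (1 - exp_neg (u y)) \<partial>lborel))"
proof -
  obtain s where s: "\<And>i. simple_function borel (s i)" "incseq s" "\<And>y. (SUP i. s i y) = u y"
    using borel_measurable_implies_simple_function_sequence'[OF assms] by metis
  \<comment> \<open>The approximating simple functions may have unbounded support; cutting them at
    growing balls bounds it and keeps the sequence increasing.\<close>
  define U where "U i y = s i y * indicator (ball 0 (real i)) y" for i y
  have U_simple: "simple_function borel (U i)" for i
    unfolding U_def using s(1) by (intro simple_function_mult simple_function_indicator) auto
  have U_bdd: "bounded {y. U i y \<noteq> 0}" for i
    by (rule bounded_subset[OF bounded_ball[of 0 "real i"]]) (auto simp: U_def split: split_indicator_asm)
  have U_inc: "incseq U"
    unfolding incseq_def le_fun_def U_def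
  proof (intro allI impI mult_mono)
    fix m n :: nat and y assume "m \<le> n"
    then show "s m y \<le> s n y" using s(2) by (auto simp: incseq_def le_fun_def)
    show "indicator (ball 0 (real m)) y \<le> (indicator (ball 0 (real n)) y :: ennreal)"
      using \<open>m \<le> n\<close> by (auto split: split_indicator)
  qed auto
  have U_SUP: "(SUP i. U i y) = u y" for y
  proof (rule antisym)
    show "(SUP i. U i y) \<le> u y"
      unfolding s(3)[symmetric] by (intro SUP_mono) (auto simp: U_def split: split_indicator)
    obtain N :: nat where N: "norm y < real N" using reals_Archimedean2 by blast
    show "u y \<le> (SUP i. U i y)"
      unfolding s(3)[symmetric]
    proof (intro SUP_mono)
      fix i :: nat
      have "s i y \<le> s (max i N) y" using s(2) by (auto simp: incseq_def le_fun_def)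
      also have "\<dots> = U (max i N) y" using N by (auto simp: U_def split: split_indicator)
      finally show "\<exists>j\<in>UNIV. s i y \<le> U j y" by blast
    qed
  qed
  note [measurable] = borel_measurable_simple_function[OF U_simple]
  have sum_inc: "incseq (\<lambda>i. \<integral>\<^sup>+y. U i y \<partial>N)" for N
    using U_inc by (auto simp: incseq_def le_fun_def intro!: nn_integral_mono)
  have minus_inc: "incseq (\<lambda>i. \<integral>\<^sup>+y. (1 - exp_neg (U i y)) \<partial>lborel)"
    using U_inc by (auto simp: incseq_def le_fun_def intro!: nn_integral_mono ennreal_minus_mono exp_neg_antimono)
  have "(\<integral>\<^sup>+\<omega>. exp_neg (\<integral>\<^sup>+y. u y \<partial>count_space (\<Psi> \<omega>)) \<partial>M) =
      (\<integral>\<^sup>+\<omega>. (INF i. exp_neg (\<integral>\<^sup>+y. U i y \<partial>count_space (\<Psi> \<omega>))) \<partial>M)"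
    unfolding U_SUP[symmetric] by (simp add: nn_integral_monotone_convergence_SUP U_inc exp_neg_SUP sum_inc)
  also have "\<dots> = (INF i. \<integral>\<^sup>+\<omega>. exp_neg (\<integral>\<^sup>+y. U i y \<partial>count_space (\<Psi> \<omega>)) \<partial>M)"
  proof (rule nn_integral_monotone_convergence_INF_decseq)
    show "decseq (\<lambda>i \<omega>. exp_neg (\<integral>\<^sup>+y. U i y \<partial>count_space (\<Psi> \<omega>)))"
      by (intro decseq_SucI le_funI exp_neg_antimono incseq_SucD[OF sum_inc])
    have "(\<integral>\<^sup>+\<omega>. exp_neg (\<integral>\<^sup>+y. U 0 y \<partial>count_space (\<Psi> \<omega>)) \<partial>M) \<le> (\<integral>\<^sup>+\<omega>. 1 \<partial>M)"
      by (intro nn_integral_mono exp_neg_le_1)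
    then show "(\<integral>\<^sup>+\<omega>. exp_neg (\<integral>\<^sup>+y. U 0 y \<partial>count_space (\<Psi> \<omega>)) \<partial>M) < \<infinity>"
      by (simp add: emeasure_space_1 order_le_less_trans[OF _ ennreal_one_less_top])
  qed simp
  also have "\<dots> = (INF i. exp_neg (ennreal r * (\<integral>\<^sup>+y. (1 - exp_neg (U i y)) \<partial>lborel)))"
    by (simp add: laplace_functional_simple[OF U_simple U_bdd])
  also have "\<dots> = exp_neg (SUP i. ennreal r * (\<integral>\<^sup>+y. (1 - exp_neg (U i y)) \<partial>lborel))"
    using minus_inc by (intro exp_neg_SUP[symmetric]) (auto simp: incseq_def intro!: mult_left_mono)
  also have "(SUP i. ennreal r * (\<integral>\<^sup>+y. (1 - exp_neg (U i y)) \<partial>lborel)) =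
      ennreal r * (\<integral>\<^sup>+y. (SUP i. 1 - exp_neg (U i y)) \<partial>lborel)"
    using U_inc by (subst nn_integral_monotone_convergence_SUP)
      (auto simp: SUP_mult_left_ennreal incseq_def le_fun_def intro!: ennreal_minus_mono exp_neg_antimono)
  also have "(\<lambda>y. SUP i. 1 - exp_neg (U i y)) = (\<lambda>y. 1 - exp_neg (u y))"
  proof
    fix y
    have "exp_neg (u y) = (INF i. exp_neg (U i y))"
      unfolding U_SUP[symmetric] using U_inc by (intro exp_neg_SUP) (auto simp: incseq_def le_fun_def)
    then show "(SUP i. 1 - exp_neg (U i y)) = 1 - exp_neg (u y)"
      by (simp add: SUP_const_minus_ennreal)
  qed
  finally show ?thesis .
qed

text \<open>A point \<open>x\<close> of \<open>A\<close> in \<open>B\<close> counts if no other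
  point of \<open>A\<close> lies in \<open>C\<close>. For \<open>x\<close> outside \<open>C\<close>
  this means that \<open>C\<close> holds no point at all, for \<open>x\<close> inside
  \<open>C\<close> that \<open>x\<close> is the only one there. Powers of 0 express this through
  counts in disjoint sets, ready for independence: \<open>0 ^ k\<close> is the indicator of
  \<open>k = 0\<close>, and \<open>k * 0 ^ (k - 1)\<close> that of \<open>k = 1\<close>.\<close>

lemma count_space_void_delete:
  assumes A: "locally_finite_set A" and B: "bounded B" and C: "bounded C"
  shows "(\<integral>\<^sup>+x. indicator B x * indicator (void_event C) (A - {x}) \<partial>count_space A) =
    of_nat (card (A \<inter> (B - C))) * 0 ^ card (A \<inter> C) +
    of_nat (card (A \<inter> (B \<inter> C))) * 0 ^ (card (A \<inter> (B \<inter> C)) - 1) * 0 ^ card (A \<inter> (C - B))"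
proof -
  have fin: "finite (A \<inter> C)" "finite (A \<inter> (B \<inter> C))" "finite (A \<inter> (C - B))"
    using locally_finite_setD[OF A] B C by (auto simp: bounded_Int bounded_diff)
  have del: "indicator (void_event C) (A - {x}) = (if A \<inter> C \<subseteq> {x} then 1 else 0 :: ennreal)" for x
    using locally_finite_set_subset[OF A] by (auto simp: void_event_def split: split_indicator)
  have "(\<integral>\<^sup>+x. indicator B x * indicator (void_event C) (A - {x}) \<partial>count_space A) =
      (\<integral>\<^sup>+x. indicator (B - C) x * 0 ^ card (A \<inter> C) \<partial>count_space A) +
      (\<integral>\<^sup>+x. indicator (B \<inter> C) x * (if A \<inter> C \<subseteq> {x} then 1 else 0) \<partial>count_space A)"
    unfolding del
  proof (subst nn_integral_add[symmetric])
    have "A \<inter> C \<subseteq> {x} \<longleftrightarrow> card (A \<inter> C) = 0" if "x \<notin> C" for x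
      using fin(1) that by auto
    then show "(\<integral>\<^sup>+x. indicator B x * (if A \<inter> C \<subseteq> {x} then 1 else 0) \<partial>count_space A) =
        (\<integral>\<^sup>+x. indicator (B - C) x * 0 ^ card (A \<inter> C) +
          indicator (B \<inter> C) x * (if A \<inter> C \<subseteq> {x} then 1 else 0) \<partial>count_space A)"
      by (intro nn_integral_cong) (simp add: power_0_left indicator_def)
  qed auto
  also have "(\<integral>\<^sup>+x. indicator (B - C) x * 0 ^ card (A \<inter> C) \<partial>count_space A) =
      of_nat (card (A \<inter> (B - C))) * 0 ^ card (A \<inter> C)"
    using A B by (simp add: nn_integral_multc nn_integral_count_space_card bounded_diff del: nn_integral_indicator)
  also have "(\<integral>\<^sup>+x. indicator (B \<inter> C) x * (if A \<inter> C \<subseteq> {x} then 1 else 0) \<partial>count_space A) =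
      of_nat (card (A \<inter> (B \<inter> C))) * 0 ^ (card (A \<inter> (B \<inter> C)) - 1) * 0 ^ card (A \<inter> (C - B))"
  proof (cases "\<exists>x\<in>B. A \<inter> C = {x}")
    case True
    then obtain x where x: "x \<in> B" "A \<inter> C = {x}" by blast
    then have "A \<inter> (B \<inter> C) = {x}" "A \<inter> (C - B) = {}" by auto
    moreover have "(\<integral>\<^sup>+y. indicator (B \<inter> C) y * (if A \<inter> C \<subseteq> {y} then 1 else 0) \<partial>count_space A) =
        (\<integral>\<^sup>+y. indicator {x} y \<partial>count_space A)"
      using x by (intro nn_integral_cong) (auto split: split_indicator)
    moreover have "x \<in> A" using x by blast
    then have "(\<integral>\<^sup>+y. indicator {x} y \<partial>count_space A) = 1"
      by (simp add: emeasure_count_space_finite)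
    ultimately show ?thesis using x by auto
  next
    case False
    have "card (A \<inter> (B \<inter> C)) = 0 \<or> card (A \<inter> (B \<inter> C)) - 1 \<noteq> 0 \<or> card (A \<inter> (C - B)) \<noteq> 0"
    proof (rule ccontr)
      assume not: "\<not> ?thesis"
      then have "card (A \<inter> (B \<inter> C)) = 1" by linarith
      moreover have "A \<inter> (C - B) = {}" using not fin by auto
      ultimately obtain x where "A \<inter> (B \<inter> C) = {x}" by (auto simp: card_1_singleton_iff)
      with \<open>A \<inter> (C - B) = {}\<close> have "A \<inter> C = {x}" "x \<in> B" by auto
      with False show False by blast
    qed
    then have "of_nat (card (A \<inter> (B \<inter> C))) * 0 ^ (card (A \<inter> (B \<inter> C)) - 1) * 0 ^ card (A \<inter> (C - B)) = (0 :: ennreal)"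
      by (auto simp: power_0_left)
    moreover have "(\<integral>\<^sup>+x. indicator (B \<inter> C) x * (if A \<inter> C \<subseteq> {x} then 1 else 0) \<partial>count_space A) =
        (\<integral>\<^sup>+x. 0 \<partial>count_space A)"
      using False by (intro nn_integral_cong) (auto split: split_indicator)
    ultimately show ?thesis by simp
  qed
  finally show ?thesis .
qed

lemma emeasure_void_event:
  assumes C: "C \<in> sets borel" "bounded C"
  shows "emeasure (distr M configs \<Psi>) (void_event C) = exp_neg (ennreal r * emeasure lborel C)"
proof -
  have "emeasure (distr M configs \<Psi>) (void_event C) =
      (\<integral>\<^sup>+\<omega>. indicator (\<Psi> -` void_event C \<inter> space M) \<omega> \<partial>M)"
    using measurable_sets[OF measurable_process void_event_in_sets_configs[OF C]]
    by (simp add: emeasure_distr void_event_in_sets_configs[OF C])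
  also have "\<dots> = (\<integral>\<^sup>+\<omega>. 0 ^ card (\<Psi> \<omega> \<inter> C) \<partial>M)"
    using locally_finite_setD[OF locally_finite_process C(2)] locally_finite_process
    by (intro nn_integral_cong) (auto simp: void_event_def power_0_left split: split_indicator)
  also have "\<dots> = exp_neg (ennreal r * emeasure lborel C)"
    by (simp add: nn_integral_power_count[OF C])
  finally show ?thesis .
qed

text \<open>By independence the two terms have means \<open>r |B - C| exp (- r |C|)\<close> and
  \<open>r |B \<inter> C| exp (- r |B \<inter> C|) exp (- r |C - B|)\<close>. The exponents of the
  second add up to that of the first, and the areas add up to that of \<open>B\<close>.\<close>

lemma mecke_void:
  assumes B[measurable]: "B \<in> sets borel" "bounded B" and C[measurable]: "C \<in> sets borel" "bounded C"
  shows "(\<integral>\<^sup>+\<omega>. \<integral>\<^sup>+x. indicator B x * indicator (void_event C) (\<Psi> \<omega> - {x}) \<partial>count_space (\<Psi> \<omega>) \<partial>M) =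
    ennreal r * emeasure lborel B * exp_neg (ennreal r * emeasure lborel C)"
proof -
  let ?K = "\<lambda>D \<omega>. card (\<Psi> \<omega> \<inter> D)"
  have bdd: "bounded (B - C)" "bounded (B \<inter> C)" "bounded (C - B)"
    using B C by (auto simp: bounded_Int bounded_diff)
  have [measurable]: "?K D \<in> M \<rightarrow>\<^sub>M count_space UNIV" if "D \<in> {B - C, B \<inter> C, C - B, C}" for D
    using that bdd C by (intro measurable_count) auto
  have indep: "(\<integral>\<^sup>+\<omega>. F (?K D \<omega>) * G (?K E \<omega>) \<partial>M) = (\<integral>\<^sup>+\<omega>. F (?K D \<omega>) \<partial>M) * (\<integral>\<^sup>+\<omega>. G (?K E \<omega>) \<partial>M)"
    if "D \<in> sets borel" "E \<in> sets borel" "bounded D" "bounded E" "D \<inter> E = {}" for F G D E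
  proof -
    have "(\<integral>\<^sup>+\<omega>. (\<Prod>b\<in>UNIV. (if b then F else G) (?K (if b then D else E) \<omega>)) \<partial>M) =
        (\<Prod>b\<in>UNIV. \<integral>\<^sup>+\<omega>. (if b then F else G) (?K (if b then D else E) \<omega>) \<partial>M)"
      by (rule nn_integral_prod_count) (use that in \<open>auto simp: disjoint_family_on_def\<close>)
    then show ?thesis by (simp add: UNIV_bool mult.commute)
  qed
  have "(\<integral>\<^sup>+\<omega>. \<integral>\<^sup>+x. indicator B x * indicator (void_event C) (\<Psi> \<omega> - {x}) \<partial>count_space (\<Psi> \<omega>) \<partial>M) =
      (\<integral>\<^sup>+\<omega>. of_nat (?K (B - C) \<omega>) * 0 ^ ?K C \<omega> +
        of_nat (?K (B \<inter> C) \<omega>) * 0 ^ (?K (B \<inter> C) \<omega> - 1) * 0 ^ ?K (C - B) \<omega> \<partial>M)"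
    by (intro nn_integral_cong count_space_void_delete locally_finite_process B C)
  also have "\<dots> = (\<integral>\<^sup>+\<omega>. of_nat (?K (B - C) \<omega>) * 0 ^ ?K C \<omega> \<partial>M) +
      (\<integral>\<^sup>+\<omega>. of_nat (?K (B \<inter> C) \<omega>) * 0 ^ (?K (B \<inter> C) \<omega> - 1) * 0 ^ ?K (C - B) \<omega> \<partial>M)"
    by (rule nn_integral_add) measurable
  \<comment> \<open>At \<open>q = 1\<close> the derivative formula is the mean count; at
    \<open>q = 0\<close> the generating function is the void probability.\<close>
  also have "(\<integral>\<^sup>+\<omega>. of_nat (?K (B - C) \<omega>) * 0 ^ ?K C \<omega> \<partial>M) =
      ennreal r * emeasure lborel (B - C) * exp_neg (ennreal r * emeasure lborel C)"
    using nn_integral_power_count_deriv[of "B - C" 1] nn_integral_power_count[of C 0] bdd C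
    by (subst indep[of _ _ of_nat "\<lambda>n. 0 ^ n"]) auto
  also have "(\<integral>\<^sup>+\<omega>. of_nat (?K (B \<inter> C) \<omega>) * 0 ^ (?K (B \<inter> C) \<omega> - 1) * 0 ^ ?K (C - B) \<omega> \<partial>M) =
      ennreal r * emeasure lborel (B \<inter> C) * exp_neg (ennreal r * emeasure lborel (B \<inter> C)) *
        exp_neg (ennreal r * emeasure lborel (C - B))"
    using nn_integral_power_count_deriv[of "B \<inter> C" 0] nn_integral_power_count[of "C - B" 0] bdd B C
    by (subst indep[of _ _ "\<lambda>n. of_nat n * 0 ^ (n - 1)" "\<lambda>n. 0 ^ n"]) auto
  finally have "?thesis \<longleftrightarrow>
      ennreal r * emeasure lborel (B - C) * exp_neg (ennreal r * emeasure lborel C) +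
      ennreal r * emeasure lborel (B \<inter> C) *
        (exp_neg (ennreal r * emeasure lborel (B \<inter> C)) * exp_neg (ennreal r * emeasure lborel (C - B))) =
      ennreal r * emeasure lborel B * exp_neg (ennreal r * emeasure lborel C)"
    by (simp add: mult.assoc)
  moreover have "emeasure lborel (B \<inter> C) + emeasure lborel (C - B) = emeasure lborel C"
    by (subst plus_emeasure) (auto intro!: arg_cong[where f="emeasure lborel"])
  then have "exp_neg (ennreal r * emeasure lborel (B \<inter> C)) * exp_neg (ennreal r * emeasure lborel (C - B)) =
      exp_neg (ennreal r * emeasure lborel C)"
    by (metis distrib_left exp_neg_add)
  moreover have "emeasure lborel B = emeasure lborel (B - C) + emeasure lborel (B \<inter> C)"
    by (subst plus_emeasure) (auto intro!: arg_cong[where f="emeasure lborel"])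
  ultimately show ?thesis by (simp add: distrib_left distrib_right)
qed

text \<open>The quantifier over \<open>u\<close> stands inside the almost sure statement, so that
  one null set serves all integrands, including those that depend on \<omega>.\<close>

lemma nn_integral_enumeration:
  "AE \<omega> in M. \<forall>u :: plane \<Rightarrow> ennreal. (\<integral>\<^sup>+x. u x \<partial>count_space (\<Psi> \<omega>)) = (\<integral>\<^sup>+n. u (X n \<omega>) \<partial>count_space UNIV)"
  using X_bij by eventually_elim (auto intro!: nn_integral_bij_count_space[symmetric])

text \<open>Both sides integrate \<open>F\<close> against a measure on pairs of a point and a
  configuration: the reduced Campbell measure of \<Psi>, and \<open>r\<close> times Lebesgue measure
  times the law of \<Psi>. They agree on the boxes \<open>B \<times> void_event C\<close> by
  \<open>mecke_void\<close>, and these boxes form a generator stable under intersection.\<close>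

lemma mecke:
  fixes F :: "plane \<Rightarrow> plane set \<Rightarrow> ennreal"
  assumes [measurable]: "(\<lambda>w. F (fst w) (snd w)) \<in> borel_measurable (borel \<Otimes>\<^sub>M configs)"
  shows "(\<integral>\<^sup>+\<omega>. \<integral>\<^sup>+x. F x (\<Psi> \<omega> - {x}) \<partial>count_space (\<Psi> \<omega>) \<partial>M) =
    ennreal r * (\<integral>\<^sup>+x. \<integral>\<^sup>+\<omega>. F x (\<Psi> \<omega>) \<partial>M \<partial>lborel)"
proof -
  let ?V = "{void_event C | C. C \<in> sets borel \<and> bounded C}"
  let ?B = "{B :: plane set. B \<in> sets borel \<and> bounded B}"
  let ?E = "{B \<times> V | B V. B \<in> ?B \<and> V \<in> ?V}"
  define P where "P = distr M configs \<Psi>"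
  interpret P: prob_space P
    unfolding P_def by (rule prob_space_distr) measurable
  have sets_P [measurable_cong]: "sets P = sets configs" and space_P: "space P = Collect locally_finite_set"
    by (simp_all add: P_def space_configs)
  \<comment> \<open>Written as an image of counting measure times \<open>M\<close>, the reduced
    Campbell measure is a measure by construction.\<close>
  define C1 where "C1 = distr (count_space UNIV \<Otimes>\<^sub>M M) (borel \<Otimes>\<^sub>M configs) (\<lambda>(n, \<omega>). (X n \<omega>, \<Psi> \<omega> - {X n \<omega>}))"
  define C2 where "C2 = scale_measure (ennreal r) ((lborel :: plane measure) \<Otimes>\<^sub>M P)"
  have X_pair [measurable]: "(\<lambda>(n, \<omega>). (X n \<omega>, \<Psi> \<omega> - {X n \<omega>})) \<in> count_space UNIV \<Otimes>\<^sub>M M \<rightarrow>\<^sub>M borel \<Otimes>\<^sub>M configs"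
    by (rule measurable_pair_measure_countable1) auto
  have C1: "(\<integral>\<^sup>+w. G (fst w) (snd w) \<partial>C1) = (\<integral>\<^sup>+\<omega>. \<integral>\<^sup>+x. G x (\<Psi> \<omega> - {x}) \<partial>count_space (\<Psi> \<omega>) \<partial>M)"
    if [measurable]: "(\<lambda>w. G (fst w) (snd w)) \<in> borel_measurable (borel \<Otimes>\<^sub>M configs)"
    for G :: "plane \<Rightarrow> plane set \<Rightarrow> ennreal"
  proof -
    have [measurable]: "(\<lambda>\<omega>. G (X n \<omega>) (\<Psi> \<omega> - {X n \<omega>})) \<in> borel_measurable M" for n
      using measurable_compose[OF measurable_Pair that, of "X n" M "\<lambda>\<omega>. \<Psi> \<omega> - {X n \<omega>}"] by simp
    have "(\<integral>\<^sup>+w. G (fst w) (snd w) \<partial>C1) =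
        (\<integral>\<^sup>+p. G (X (fst p) (snd p)) (\<Psi> (snd p) - {X (fst p) (snd p)}) \<partial>(count_space UNIV \<Otimes>\<^sub>M M))"
      unfolding C1_def by (subst nn_integral_distr) (simp_all add: split_beta')
    also have "\<dots> = (\<integral>\<^sup>+n. \<integral>\<^sup>+\<omega>. G (X n \<omega>) (\<Psi> \<omega> - {X n \<omega>}) \<partial>M \<partial>count_space UNIV)"
    proof (subst nn_integral_fst[symmetric])
      show "(\<lambda>p. G (X (fst p) (snd p)) (\<Psi> (snd p) - {X (fst p) (snd p)})) \<in> borel_measurable (count_space UNIV \<Otimes>\<^sub>M M)"
        using measurable_compose[OF X_pair that] by (simp add: split_beta')
    qed simp
    also have "\<dots> = (\<integral>\<^sup>+\<omega>. \<integral>\<^sup>+n. G (X n \<omega>) (\<Psi> \<omega> - {X n \<omega>}) \<partial>count_space UNIV \<partial>M)"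
      by (rule nn_integral_count_space_nn_integral[symmetric]) auto
    also have "\<dots> = (\<integral>\<^sup>+\<omega>. \<integral>\<^sup>+x. G x (\<Psi> \<omega> - {x}) \<partial>count_space (\<Psi> \<omega>) \<partial>M)"
    proof (rule nn_integral_cong_AE)
      show "AE \<omega> in M. (\<integral>\<^sup>+n. G (X n \<omega>) (\<Psi> \<omega> - {X n \<omega>}) \<partial>count_space UNIV) =
          (\<integral>\<^sup>+x. G x (\<Psi> \<omega> - {x}) \<partial>count_space (\<Psi> \<omega>))"
        using nn_integral_enumeration by eventually_elim simp
    qed
    finally show ?thesis .
  qed
  have C2: "(\<integral>\<^sup>+w. G (fst w) (snd w) \<partial>C2) = ennreal r * (\<integral>\<^sup>+x. \<integral>\<^sup>+\<omega>. G x (\<Psi> \<omega>) \<partial>M \<partial>lborel)"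
    if [measurable]: "(\<lambda>w. G (fst w) (snd w)) \<in> borel_measurable (borel \<Otimes>\<^sub>M configs)"
    for G :: "plane \<Rightarrow> plane set \<Rightarrow> ennreal"
  proof -
    have [measurable]: "G x \<in> borel_measurable configs" for x
      using measurable_compose[OF measurable_Pair1' that, of x] by simp
    show ?thesis
      unfolding C2_def
      by (simp add: nn_integral_scale_measure P.nn_integral_fst[symmetric])
        (simp add: P_def nn_integral_distr)
  qed
  have sets_E: "sets (borel \<Otimes>\<^sub>M configs) = sigma_sets (UNIV \<times> Collect locally_finite_set) ?E"
  proof -
    have "sets (borel :: plane measure) = sigma_sets (space borel) ?B"
    proof
      show "sets borel \<subseteq> sigma_sets (space borel) ?B"
      proof
        fix B :: "plane set" assume B: "B \<in> sets borel"
        have "(\<Union>n::nat. B \<inter> ball 0 (real n)) \<in> sigma_sets (space borel) ?B"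
          using B by (intro sigma_sets.Union sigma_sets.Basic) (auto simp: bounded_Int)
        also have "(\<Union>n::nat. B \<inter> ball 0 (real n)) = B"
          by (auto simp: reals_Archimedean2)
        finally show "B \<in> sigma_sets (space borel) ?B" .
      qed
      show "sigma_sets (space borel) ?B \<subseteq> sets borel"
        by (rule sets.sigma_sets_subset) auto
    qed
    then have "sets (borel \<Otimes>\<^sub>M configs) = sets (sigma (space borel \<times> space configs) ?E)"
    proof (rule sets_pair_eq[rotated 1, where Ca="range (\<lambda>n::nat. ball 0 (real n))" and Cb="{void_event {}}"])
      show "\<Union> (range (\<lambda>n::nat. ball (0 :: plane) (real n))) = space borel"
        by (auto simp: reals_Archimedean2)
      show "sets configs = sigma_sets (space configs) ?V"
        by (simp add: sets_configs_void space_configs)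
      show "{void_event {}} \<subseteq> ?V" by auto
    qed (auto simp: void_event_def space_configs)
    also have "\<dots> = sigma_sets (space borel \<times> space configs) ?E"
      by (rule sets_measure_of) (auto simp: void_event_def space_configs)
    finally show ?thesis by (simp add: space_configs)
  qed
  \<comment> \<open>\<open>void_event {}\<close> consists of all configurations, so balls times it
    exhaust the space by sets of finite mass.\<close>
  have "C1 = C2"
  proof (rule measure_eqI_generator_eq[where A="\<lambda>n. ball 0 (real n) \<times> void_event {}"])
    show "Int_stable ?E"
      unfolding Int_stable_def
    proof safe
      fix B C B' C' :: "plane set"
      assume "B \<in> sets borel" "bounded B" "C \<in> sets borel" "bounded C"
        "B' \<in> sets borel" "bounded B'" "C' \<in> sets borel" "bounded C'"
      then show "\<exists>D V. B \<times> void_event C \<inter> B' \<times> void_event C' = D \<times> V \<and> D \<in> ?B \<and> V \<in> ?V"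
        by (intro exI[of _ "B \<inter> B'"] exI[of _ "void_event (C \<union> C')"])
          (auto simp: void_event_Int[symmetric] bounded_Int intro!: exI[of _ "C \<union> C'"])
    qed
    show "sets C1 = sigma_sets (UNIV \<times> Collect locally_finite_set) ?E"
      unfolding sets_E[symmetric] by (simp add: C1_def)
    show "sets C2 = sigma_sets (UNIV \<times> Collect locally_finite_set) ?E"
      unfolding sets_E[symmetric] C2_def by (simp add: sets_P cong: sets_pair_measure_cong)
    show "?E \<subseteq> Pow (UNIV \<times> Collect locally_finite_set)"
      by (auto simp: void_event_def)
    have E: "emeasure C1 (B \<times> void_event C) = ennreal r * emeasure lborel B * exp_neg (ennreal r * emeasure lborel C)"
        "emeasure C2 (B \<times> void_event C) = ennreal r * emeasure lborel B * exp_neg (ennreal r * emeasure lborel C)"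
      if B[measurable]: "B \<in> sets borel" and bdd: "bounded B" and C[measurable]: "C \<in> sets borel" "bounded C" for B C
    proof -
      have [measurable]: "void_event C \<in> sets configs" using C by (rule void_event_in_sets_configs)
      have BC: "B \<times> void_event C \<in> sets (borel \<Otimes>\<^sub>M configs)" by measurable
      have "emeasure C1 (B \<times> void_event C) = (\<integral>\<^sup>+w. indicator B (fst w) * indicator (void_event C) (snd w) \<partial>C1)"
      proof -
        have "indicator B (fst w) * indicator (void_event C) (snd w) = (indicator (B \<times> void_event C) w :: ennreal)" for w
          by (cases w) (auto split: split_indicator)
        then show ?thesis using BC by (simp add: C1_def)
      qed
      also have "\<dots> = ennreal r * emeasure lborel B * exp_neg (ennreal r * emeasure lborel C)"
        using B bdd C by (subst C1) (simp_all add: mecke_void)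
      finally show "emeasure C1 (B \<times> void_event C) = ennreal r * emeasure lborel B * exp_neg (ennreal r * emeasure lborel C)" .
      show "emeasure C2 (B \<times> void_event C) = ennreal r * emeasure lborel B * exp_neg (ennreal r * emeasure lborel C)"
        using emeasure_void_event[OF C]
        by (simp add: C2_def P.emeasure_pair_measure_Times sets_P P_def[symmetric] mult.assoc)
    qed
    show "emeasure C1 Y = emeasure C2 Y" if "Y \<in> ?E" for Y
      using that E by auto
    show "range (\<lambda>n. ball 0 (real n) \<times> void_event {}) \<subseteq> ?E"
    proof (rule image_subsetI)
      fix n :: nat
      have "void_event {} \<in> ?V" by blast
      moreover have "ball 0 (real n) \<in> ?B" by auto
      ultimately show "ball 0 (real n) \<times> void_event {} \<in> ?E" by blast
    qed
    show "(\<Union>n. ball 0 (real n) \<times> void_event {}) = (UNIV :: plane set) \<times> Collect locally_finite_set"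
      by (auto simp: void_event_def reals_Archimedean2)
    show "emeasure C1 (ball 0 (real n) \<times> void_event {}) \<noteq> \<infinity>" for n
      by (simp add: E emeasure_lborel_bounded)
  qed
  then show ?thesis using C1[of F] C2[of F] by simp
qed

end

section \<open>Poisson clusters\<close>

lemma borel_measurable_sum_lessThan [measurable (raw)]:
  fixes g :: "nat \<Rightarrow> 'a \<Rightarrow> ennreal"
  assumes [measurable]: "N \<in> M \<rightarrow>\<^sub>M count_space UNIV" "\<And>j. g j \<in> borel_measurable M"
  shows "(\<lambda>x. \<Sum>j<N x. g j x) \<in> borel_measurable M"
proof -
  have "(\<Sum>j<N x. g j x) = (\<Sum>j. if j < N x then g j x else 0)" for x
    by (subst suminf_finite[of "{..<N x}"]) auto
  then show ?thesis by simp
qed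

lemma borel_measurable_curried:
  assumes u: "(\<lambda>w. u (fst w) (snd w)) \<in> M \<Otimes>\<^sub>M N \<rightarrow>\<^sub>M L"
    and [measurable]: "a \<in> K \<rightarrow>\<^sub>M M" "b \<in> K \<rightarrow>\<^sub>M N"
  shows "(\<lambda>w. u (a w) (b w)) \<in> K \<rightarrow>\<^sub>M L"
  using measurable_compose[OF measurable_Pair u, of a K b] by simp

lemma nn_integral_lborel_reflect:
  fixes g :: "'a::euclidean_space \<Rightarrow> ennreal"
  assumes [measurable]: "g \<in> borel_measurable borel"
  shows "(\<integral>\<^sup>+y. g (a - y) \<partial>lborel) = (\<integral>\<^sup>+y. g y \<partial>lborel)"
proof -
  have "(lborel :: 'a measure) = density (distr lborel borel (\<lambda>x. a + (-1) *\<^sub>R x)) (\<lambda>_. ennreal (\<bar>-1 :: real\<bar>^DIM('a)))"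
    by (rule lborel_affine) simp
  also have "\<dots> = distr lborel borel (\<lambda>x. a - x)"
    by (simp add: density_1)
  finally have "(\<integral>\<^sup>+y. g y \<partial>lborel) = (\<integral>\<^sup>+y. g y \<partial>distr lborel borel (\<lambda>x. a - x))"
    by (rule arg_cong[where f="\<lambda>M. nn_integral M g"])
  also have "\<dots> = (\<integral>\<^sup>+y. g (a - y) \<partial>lborel)"
    by (simp add: nn_integral_distr)
  finally show ?thesis ..
qed

lemma nn_integral_lborel_translate:
  fixes g :: "'a::euclidean_space \<Rightarrow> ennreal"
  assumes [measurable]: "g \<in> borel_measurable borel"
  shows "(\<integral>\<^sup>+y. g (y + a) \<partial>lborel) = (\<integral>\<^sup>+y. g y \<partial>lborel)"
proof -
  have "(\<integral>\<^sup>+y. g (y + a) \<partial>lborel) = (\<integral>\<^sup>+y. g (a + y) \<partial>lborel)"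
    by (subst add.commute) (rule refl)
  also have "\<dots> = (\<integral>\<^sup>+y. g y \<partial>distr lborel borel ((+) a))"
    by (rule nn_integral_distr[symmetric]) simp_all
  finally show ?thesis unfolding lborel_distr_plus .
qed

locale cluster_model =
  fixes c :: real and f :: "plane \<Rightarrow> real"
  assumes c_pos: "0 < c" and density: "isotropic_density f"
begin

definition displacement :: "plane measure" where
  "displacement = density lborel (\<lambda>x. ennreal (f x))"

lemma measurable_f [measurable]: "f \<in> borel_measurable borel"
  and f_nonneg: "0 \<le> f x"
  and f_mass: "(\<integral>\<^sup>+x. ennreal (f x) \<partial>lborel) = 1"
  using density unfolding isotropic_density_def by blast+

lemma sets_displacement [simp, measurable_cong]: "sets displacement = sets borel"
  and space_displacement [simp]: "space displacement = UNIV"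
  by (simp_all add: displacement_def)

sublocale displacement: prob_space displacement
  by (intro prob_spaceI) (simp add: displacement_def emeasure_density f_mass)

sublocale displacements: prob_space "\<Pi>\<^sub>M k\<in>(UNIV :: nat set). displacement"
  by (intro prob_space_PiM displacement.prob_space_axioms)

lemma cluster_law_eq: "cluster_law c f = measure_pmf (poisson_pmf c) \<Otimes>\<^sub>M (\<Pi>\<^sub>M k\<in>UNIV. displacement)"
  by (simp add: cluster_law_def displacement_def)

sublocale cluster: prob_space "cluster_law c f"
  unfolding cluster_law_eq
  by (intro prob_space_pair measure_pmf.prob_space_axioms displacements.prob_space_axioms)

lemma sets_displacements [measurable_cong]:
  "sets (\<Pi>\<^sub>M k\<in>(UNIV :: nat set). displacement) = sets (\<Pi>\<^sub>M k\<in>UNIV. borel)"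
  by (intro sets_PiM_cong) auto

lemma sets_cluster_law [measurable_cong]:
  "sets (cluster_law c f) = sets (count_space UNIV \<Otimes>\<^sub>M (\<Pi>\<^sub>M k\<in>UNIV. borel))"
  unfolding cluster_law_eq by (intro sets_pair_measure_cong sets_displacements) auto

lemma sets_clusters [measurable_cong]:
  "sets (\<Pi>\<^sub>M n\<in>(UNIV :: nat set). cluster_law c f) = sets (\<Pi>\<^sub>M n\<in>UNIV. count_space UNIV \<Otimes>\<^sub>M (\<Pi>\<^sub>M k\<in>UNIV. borel))"
  by (intro sets_PiM_cong sets_cluster_law) auto

lemma nn_integral_cluster:
  assumes [measurable]: "F \<in> borel_measurable (cluster_law c f)"
  shows "(\<integral>\<^sup>+p. F p \<partial>cluster_law c f) =
    (\<Sum>N. ennreal (c ^ N / fact N * exp (- c)) * (\<integral>\<^sup>+D. F (N, D) \<partial>(\<Pi>\<^sub>M k\<in>UNIV. displacement)))"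
  using assms c_pos unfolding cluster_law_eq
  by (subst displacements.nn_integral_fst[symmetric])
    (simp_all add: nn_integral_measure_pmf nn_integral_count_space_nat)

text \<open>Given the number of points, the displacements are i.i.d. and the mean is a power; the
  Poisson generating function sums these powers.\<close>

lemma nn_integral_cluster_exp_neg:
  assumes [measurable]: "u \<in> borel_measurable borel"
  shows "(\<integral>\<^sup>+p. exp_neg (\<Sum>j<fst p. u (snd p j)) \<partial>cluster_law c f) =
    exp_neg (ennreal c * (1 - (\<integral>\<^sup>+d. exp_neg (u d) \<partial>displacement)))"
proof -
  let ?q = "\<integral>\<^sup>+d. exp_neg (u d) \<partial>displacement"
  have "?q \<le> (\<integral>\<^sup>+d. 1 \<partial>displacement)"
    by (intro nn_integral_mono exp_neg_le_1)
  then have "?q \<le> 1" using displacement.emeasure_space_1 by simp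
  have "(\<integral>\<^sup>+D. exp_neg (\<Sum>j<N. u (D j)) \<partial>(\<Pi>\<^sub>M k\<in>UNIV. displacement)) = ?q ^ N" for N
    using nn_integral_PiM_prod[of UNIV "\<lambda>_. displacement" "{..<N}" "\<lambda>_ d. exp_neg (u d)"]
    by (simp add: exp_neg_sum displacement.prob_space_axioms)
  then have "(\<integral>\<^sup>+p. exp_neg (\<Sum>j<fst p. u (snd p j)) \<partial>cluster_law c f) =
      (\<Sum>N. ennreal (c ^ N / fact N * exp (- c)) * ?q ^ N)"
    by (subst nn_integral_cluster, measurable)
  also have "\<dots> = exp_neg (ennreal c * (1 - ?q))"
    by (rule poisson_pgf[OF less_imp_le[OF c_pos] \<open>?q \<le> 1\<close>])
  finally show ?thesis .
qed

text \<open>The cluster seen from each of its own points. Fixing the displacement \<open>d\<close>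
  of point \<open>k\<close> leaves \<open>N - 1\<close> i.i.d. displacements, hence the power
  \<open>q d ^ (N - 1)\<close>, the same for all \<open>k < N\<close>. The resulting factor
  \<open>N\<close> size-biases the Poisson number, and \<open>poisson_pgf_deriv\<close> restores a
  full cluster.\<close>

lemma nn_integral_cluster_palm:
  assumes G [measurable]: "G \<in> borel_measurable borel"
    and u [measurable]: "(\<lambda>w. u (fst w) (snd w)) \<in> borel_measurable (borel \<Otimes>\<^sub>M borel)"
  shows "(\<integral>\<^sup>+p. (\<Sum>k<fst p. G (snd p k) *
      exp_neg (\<Sum>j<fst p. if j = k then 0 else u (snd p k) (snd p j))) \<partial>cluster_law c f) =
    ennreal c * (\<integral>\<^sup>+d. G d * exp_neg (ennreal c * (1 - (\<integral>\<^sup>+d'. exp_neg (u d d') \<partial>displacement))) \<partial>displacement)"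
proof -
  define q where "q d = (\<integral>\<^sup>+d'. exp_neg (u d d') \<partial>displacement)" for d
  have [measurable]: "q \<in> borel_measurable borel"
    unfolding q_def by measurable
  note [measurable] = borel_measurable_curried[OF u]
  have q_le: "q d \<le> 1" for d
  proof -
    have "q d \<le> (\<integral>\<^sup>+d'. 1 \<partial>displacement)"
      unfolding q_def by (intro nn_integral_mono exp_neg_le_1)
    then show ?thesis using displacement.emeasure_space_1 by simp
  qed
  let ?P = "\<Pi>\<^sub>M k\<in>(UNIV :: nat set). displacement"
  have inner: "(\<integral>\<^sup>+D. G (D k) * exp_neg (\<Sum>j<N. if j = k then 0 else u (D k) (D j)) \<partial>?P) =
      (\<integral>\<^sup>+d. G d * q d ^ (N - 1) \<partial>displacement)" if "k < N" for k N
  proof -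
    have "(\<integral>\<^sup>+D. G (D k) * exp_neg (\<Sum>j<N. if j = k then 0 else u (D k) (D j)) \<partial>?P) =
        (\<integral>\<^sup>+d. \<integral>\<^sup>+D. G d * (\<Prod>j\<in>{..<N} - {k}. exp_neg (u d (D j))) \<partial>?P \<partial>displacement)"
    proof (subst nn_integral_PiM_update[where k=k])
      show "(\<lambda>D. G (D k) * exp_neg (\<Sum>j<N. if j = k then 0 else u (D k) (D j))) \<in> borel_measurable ?P"
        by measurable
      have "exp_neg (\<Sum>j<N. if j = k then 0 else u d ((D(k := d)) j)) =
          (\<Prod>j\<in>{..<N} - {k}. exp_neg (u d (D j)))" for d D
        unfolding exp_neg_sum[OF finite_lessThan] using that
        by (subst prod.remove[of _ k]) (auto intro!: prod.cong)
      then show "(\<integral>\<^sup>+d. \<integral>\<^sup>+D. G ((D(k := d)) k) * exp_neg (\<Sum>j<N. if j = k then 0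
            else u ((D(k := d)) k) ((D(k := d)) j)) \<partial>?P \<partial>displacement) =
          (\<integral>\<^sup>+d. \<integral>\<^sup>+D. G d * (\<Prod>j\<in>{..<N} - {k}. exp_neg (u d (D j))) \<partial>?P \<partial>displacement)"
        by (simp only: fun_upd_same)
    qed (auto simp: displacement.prob_space_axioms)
    also have "\<dots> = (\<integral>\<^sup>+d. G d * q d ^ (N - 1) \<partial>displacement)"
    proof (intro nn_integral_cong)
      fix d
      have "(\<integral>\<^sup>+D. (\<Prod>j\<in>{..<N} - {k}. exp_neg (u d (D j))) \<partial>?P) = q d ^ (N - 1)"
        using nn_integral_PiM_prod[of UNIV "\<lambda>_. displacement" "{..<N} - {k}" "\<lambda>_ d'. exp_neg (u d d')"] that
        by (simp add: displacement.prob_space_axioms q_def)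
      then show "(\<integral>\<^sup>+D. G d * (\<Prod>j\<in>{..<N} - {k}. exp_neg (u d (D j))) \<partial>?P) = G d * q d ^ (N - 1)"
        by (subst nn_integral_cmult) simp_all
    qed
    finally show ?thesis .
  qed
  have "(\<integral>\<^sup>+p. (\<Sum>k<fst p. G (snd p k) *
      exp_neg (\<Sum>j<fst p. if j = k then 0 else u (snd p k) (snd p j))) \<partial>cluster_law c f) =
      (\<Sum>N. ennreal (c ^ N / fact N * exp (- c)) * (of_nat N * (\<integral>\<^sup>+d. G d * q d ^ (N - 1) \<partial>displacement)))"
    (is "?L = _")
  proof -
    have "(\<integral>\<^sup>+D. (\<Sum>k<N. G (D k) * exp_neg (\<Sum>j<N. if j = k then 0 else u (D k) (D j))) \<partial>?P) =
        of_nat N * (\<integral>\<^sup>+d. G d * q d ^ (N - 1) \<partial>displacement)" for N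
      by (subst nn_integral_sum) (simp_all add: inner)
    then show ?thesis
      by (subst nn_integral_cluster, measurable) (simp only: fst_conv snd_conv)
  qed
  also have "\<dots> = (\<Sum>N. \<integral>\<^sup>+d. G d * (ennreal (c ^ N / fact N * exp (- c)) * (of_nat N * q d ^ (N - 1))) \<partial>displacement)"
    by (intro suminf_cong) (simp add: nn_integral_cmult[symmetric] mult_ac)
  also have "\<dots> = (\<integral>\<^sup>+d. (\<Sum>N. G d * (ennreal (c ^ N / fact N * exp (- c)) * (of_nat N * q d ^ (N - 1)))) \<partial>displacement)"
    by (rule nn_integral_suminf[symmetric]) measurable
  also have "\<dots> = (\<integral>\<^sup>+d. ennreal c * (G d * exp_neg (ennreal c * (1 - q d))) \<partial>displacement)"
  proof (intro nn_integral_cong)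
    fix d
    show "(\<Sum>N. G d * (ennreal (c ^ N / fact N * exp (- c)) * (of_nat N * q d ^ (N - 1)))) =
        ennreal c * (G d * exp_neg (ennreal c * (1 - q d)))"
      unfolding ennreal_suminf_cmult poisson_pgf_deriv[OF less_imp_le[OF c_pos] q_le]
      by (rule mult.left_commute)
  qed
  also have "\<dots> = ennreal c * (\<integral>\<^sup>+d. G d * exp_neg (ennreal c * (1 - q d)) \<partial>displacement)"
    by (rule nn_integral_cmult) measurable
  finally show ?thesis unfolding q_def .
qed

text \<open>The negative logarithm of the Laplace functional of a cluster with parent at the origin,
  observed from \<open>v\<close>. With the exponents of Rayleigh fading it becomes
  \<open>c * beta g f T z v\<close>.\<close>

definition cluster_exponent :: "(plane \<Rightarrow> ennreal) \<Rightarrow> plane \<Rightarrow> ennreal" where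
  "cluster_exponent \<nu> v = ennreal c * (1 - (\<integral>\<^sup>+d. exp_neg (\<nu> (d - v)) \<partial>displacement))"

lemma measurable_cluster_exponent [measurable (raw)]:
  assumes [measurable]: "\<nu> \<in> borel_measurable borel" "v \<in> N \<rightarrow>\<^sub>M borel"
  shows "(\<lambda>w. cluster_exponent \<nu> (v w)) \<in> borel_measurable N"
  unfolding cluster_exponent_def by measurable

text \<open>The contribution of the \<open>n\<close>-th cluster to the sum of \<open>exp_neg (\<Sum> \<nu> (y - x))\<close> over the points
  \<open>x \<in> W\<close>, where \<open>y\<close> runs through all other points.\<close>

definition cluster_contribution ::
    "plane set \<Rightarrow> (plane \<Rightarrow> ennreal) \<Rightarrow> nat \<Rightarrow> (nat \<Rightarrow> plane) \<Rightarrow> (nat \<Rightarrow> nat \<times> (nat \<Rightarrow> plane)) \<Rightarrow> ennreal" where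
  "cluster_contribution W \<nu> n x C = (\<Sum>k<fst (C n). indicator W (x n + snd (C n) k) * exp_neg
     ((\<Sum>j<fst (C n). if j = k then 0 else \<nu> (snd (C n) j - snd (C n) k)) +
      (\<Sum>m. if m = n then 0 else \<Sum>j<fst (C m). \<nu> (x m + snd (C m) j - (x n + snd (C n) k)))))"

text \<open>With the parents fixed, resampling cluster \<open>n\<close> separates it from the
  others. These are independent and contribute the exponential of the sum of their exponents; within
  cluster \<open>n\<close>, \<open>nn_integral_cluster_palm\<close> contributes the exponent of one
  more full cluster, observed from the displacement \<open>d\<close>.\<close>

lemma nn_integral_cluster_contribution:
  assumes [measurable]: "W \<in> sets borel" "\<nu> \<in> borel_measurable borel"
  shows "(\<integral>\<^sup>+C. cluster_contribution W \<nu> n x C \<partial>(\<Pi>\<^sub>M n\<in>UNIV. cluster_law c f)) =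
    ennreal c * (\<integral>\<^sup>+d. exp_neg (cluster_exponent \<nu> d) * (indicator W (x n + d) *
      exp_neg (\<Sum>m. if m = n then 0 else cluster_exponent \<nu> (x n + d - x m))) \<partial>displacement)"
proof -
  let ?P = "\<Pi>\<^sub>M n\<in>(UNIV :: nat set). cluster_law c f"
  \<comment> \<open>The mean effect of all other clusters on an observer at \<open>w\<close>.
    Relative to the parent \<open>x m\<close> the observer sits at \<open>w - x m\<close>, the
    argument of \<open>cluster_exponent\<close>.\<close>
  define R where "R w = exp_neg (\<Sum>m. if m = n then 0 else cluster_exponent \<nu> (w - x m))" for w
  have [measurable]: "R \<in> borel_measurable borel"
    unfolding R_def by measurable
  define own where "own p k = (\<Sum>j<fst p. if j = k then 0 else \<nu> (snd p j - snd p k))" for p :: "nat \<times> (nat \<Rightarrow> plane)" and k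
  define other where "other C w = (\<Sum>m. if m = n then 0 else \<Sum>j<fst (C m). \<nu> (x m + snd (C m) j - w))"
    for C :: "nat \<Rightarrow> nat \<times> (nat \<Rightarrow> plane)" and w
  have [measurable]: "(\<lambda>C. other C w) \<in> borel_measurable ?P" for w
    unfolding other_def by measurable
  have other: "(\<integral>\<^sup>+C. exp_neg (other C w) \<partial>?P) = R w" for w
  proof -
    have "(\<integral>\<^sup>+C. exp_neg (\<integral>\<^sup>+m. (if m = n then 0 else \<Sum>j<fst (C m). \<nu> (x m + snd (C m) j - w)) \<partial>count_space UNIV) \<partial>?P) =
        exp_neg (\<integral>\<^sup>+m. (if m = n then 0 else cluster_exponent \<nu> (w - x m)) \<partial>count_space UNIV)"
    proof (rule nn_integral_PiM_exp_neg)
      fix m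
      show "(\<integral>\<^sup>+p. exp_neg (if m = n then 0 else \<Sum>j<fst p. \<nu> (x m + snd p j - w)) \<partial>cluster_law c f) =
          exp_neg (if m = n then 0 else cluster_exponent \<nu> (w - x m))"
        using nn_integral_cluster_exp_neg[of "\<lambda>d. \<nu> (x m + d - w)"] cluster.emeasure_space_1
        by (simp add: cluster_exponent_def algebra_simps)
    qed (auto simp: cluster.prob_space_axioms)
    then show ?thesis by (simp add: other_def R_def nn_integral_count_space_nat)
  qed
  have "(\<integral>\<^sup>+C. cluster_contribution W \<nu> n x C \<partial>?P) =
      (\<integral>\<^sup>+p. \<integral>\<^sup>+C. (\<Sum>k<fst p. indicator W (x n + snd p k) * exp_neg (own p k) *
        exp_neg (other C (x n + snd p k))) \<partial>?P \<partial>cluster_law c f)"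
  proof (subst nn_integral_PiM_update[where k=n])
    show "cluster_contribution W \<nu> n x \<in> borel_measurable ?P"
      unfolding cluster_contribution_def by measurable
    have "other (C(n := p)) w = other C w" for C p w
      unfolding other_def by (intro suminf_cong) auto
    then have "cluster_contribution W \<nu> n x (C(n := p)) = (\<Sum>k<fst p. indicator W (x n + snd p k) * exp_neg (own p k) *
        exp_neg (other C (x n + snd p k)))" for C p
      unfolding cluster_contribution_def own_def other_def[symmetric] fun_upd_same
      by (simp only: exp_neg_add mult.assoc)
    then show "(\<integral>\<^sup>+p. \<integral>\<^sup>+C. cluster_contribution W \<nu> n x (C(n := p)) \<partial>?P \<partial>cluster_law c f) =
        (\<integral>\<^sup>+p. \<integral>\<^sup>+C. (\<Sum>k<fst p. indicator W (x n + snd p k) * exp_neg (own p k) *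
        exp_neg (other C (x n + snd p k))) \<partial>?P \<partial>cluster_law c f)"
      by simp
  qed (auto simp: cluster.prob_space_axioms)
  also have "\<dots> = (\<integral>\<^sup>+p. (\<Sum>k<fst p. indicator W (x n + snd p k) * exp_neg (own p k) * R (x n + snd p k)) \<partial>cluster_law c f)"
    by (simp add: nn_integral_sum nn_integral_cmult other)
  also have "\<dots> = (\<integral>\<^sup>+p. (\<Sum>k<fst p. (indicator W (x n + snd p k) * R (x n + snd p k)) * exp_neg (own p k)) \<partial>cluster_law c f)"
    by (simp add: mult_ac)
  also have "\<dots> = ennreal c * (\<integral>\<^sup>+d. (indicator W (x n + d) * R (x n + d)) * exp_neg (cluster_exponent \<nu> d) \<partial>displacement)"
    unfolding own_def cluster_exponent_def
    using nn_integral_cluster_palm[of "\<lambda>d. indicator W (x n + d) * R (x n + d)" "\<lambda>d d'. \<nu> (d' - d)"] by simp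
  finally show ?thesis unfolding R_def by (simp add: mult_ac)
qed

end

section \<open>Reduced Palm distributions\<close>

lemma point_process_locally_finite:
  "point_process M \<phi> \<Longrightarrow> \<omega> \<in> space M \<Longrightarrow> locally_finite_set (\<phi> \<omega>)"
  using measurable_space[of \<phi> M configs \<omega>] by (simp add: point_process_def space_configs)

lemma bounded_unit_square: "bounded unit_square"
  and unit_square_borel [measurable]: "unit_square \<in> sets borel"
  and emeasure_unit_square: "emeasure lborel unit_square = 1"
proof -
  have eq: "unit_square = cbox 0 1"
    by (auto simp: unit_square_def cbox_def Basis_vec_def inner_axis)
  show "bounded unit_square" "unit_square \<in> sets borel" by (simp_all add: eq)
  have "(\<Prod>b\<in>(Basis :: plane set). (1 - 0) \<bullet> b) = 1"
    by (intro prod.neutral) (auto simp: Basis_vec_def inner_axis)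
  moreover have "emeasure lborel (cbox 0 (1 :: plane)) = ennreal (\<Prod>b\<in>(Basis :: plane set). (1 - 0) \<bullet> b)"
    by (intro emeasure_lborel_cbox) (auto simp: Basis_vec_def inner_axis)
  ultimately show "emeasure lborel unit_square = 1" by (simp add: eq)
qed

lemma card_reduced_shift:
  assumes "locally_finite_set A"
  shows "of_nat (card {x \<in> A \<inter> unit_square. (\<lambda>y. y - x) ` A - {0} \<in> Y}) =
    (\<integral>\<^sup>+x. indicator unit_square x * indicator Y (reduced_shift x A) \<partial>count_space A)"
proof -
  have "(\<integral>\<^sup>+x. indicator unit_square x * indicator Y (reduced_shift x A) \<partial>count_space A) =
      (\<integral>\<^sup>+x. indicator (unit_square \<inter> {x. reduced_shift x A \<in> Y}) x \<partial>count_space A)"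
    by (intro nn_integral_cong) (auto split: split_indicator)
  also have "\<dots> = of_nat (card (A \<inter> (unit_square \<inter> {x. reduced_shift x A \<in> Y})))"
    by (rule nn_integral_count_space_card[OF assms]) (auto intro: bounded_Int bounded_unit_square)
  also have "A \<inter> (unit_square \<inter> {x. reduced_shift x A \<in> Y}) = {x \<in> A \<inter> unit_square. (\<lambda>y. y - x) ` A - {0} \<in> Y}"
    by (auto simp: reduced_shift_def)
  finally show ?thesis ..
qed

lemma space_reduced_palm [simp]: "space (reduced_palm M \<phi>) = space configs"
  and sets_reduced_palm [simp, measurable_cong]: "sets (reduced_palm M \<phi>) = sets configs"
  unfolding reduced_palm_def by (simp_all add: sets.space_closed)

text \<open>\<open>measure_of\<close> falls back to the zero measure unless its set function is
  countably additive, so additivity must be established before the defining quotient can be read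
  off.\<close>

lemma emeasure_reduced_palm:
  assumes \<phi>: "point_process M \<phi>" and Y: "Y \<in> sets configs"
  shows "emeasure (reduced_palm M \<phi>) Y =
    (\<integral>\<^sup>+\<omega>. \<integral>\<^sup>+x. indicator unit_square x * indicator Y (reduced_shift x (\<phi> \<omega>)) \<partial>count_space (\<phi> \<omega>) \<partial>M) /
    (\<integral>\<^sup>+\<omega>. of_nat (card (\<phi> \<omega> \<inter> unit_square)) \<partial>M)" (is "_ = ?N Y / ?D")
proof -
  have [measurable]: "\<phi> \<in> M \<rightarrow>\<^sub>M configs" using \<phi> by (simp add: point_process_def)
  define \<mu> where "\<mu> Y = (\<integral>\<^sup>+\<omega>. of_nat (card {x \<in> \<phi> \<omega> \<inter> unit_square. (\<lambda>y. y - x) ` \<phi> \<omega> - {0} \<in> Y}) \<partial>M) / ?D" for Y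
  have \<mu>_eq: "\<mu> Y = ?N Y / ?D" for Y
    unfolding \<mu>_def
    by (intro arg_cong[where f="\<lambda>t. t / ?D"] nn_integral_cong card_reduced_shift point_process_locally_finite[OF \<phi>])
  have palm: "reduced_palm M \<phi> = measure_of (space configs) (sets configs) \<mu>"
    unfolding reduced_palm_def \<mu>_def ..
  have "countably_additive (sets configs) \<mu>"
  proof (rule countably_additiveI)
    fix Z :: "nat \<Rightarrow> plane set set"
    assume "range Z \<subseteq> sets configs" and disj: "disjoint_family Z"
    then have [measurable]: "\<And>i. Z i \<in> sets configs" by auto
    have "?N (\<Union>i. Z i) = (\<integral>\<^sup>+\<omega>. (\<Sum>i. \<integral>\<^sup>+x. indicator unit_square x * indicator (Z i) (reduced_shift x (\<phi> \<omega>)) \<partial>count_space (\<phi> \<omega>)) \<partial>M)"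
      using suminf_indicator[OF disj] by (simp add: nn_integral_suminf[symmetric])
    also have "\<dots> = (\<Sum>i. ?N (Z i))"
      by (rule nn_integral_suminf) measurable
    finally have "?N (\<Union>i. Z i) = (\<Sum>i. ?N (Z i))" .
    then show "(\<Sum>i. \<mu> (Z i)) = \<mu> (\<Union>i. Z i)"
      unfolding \<mu>_eq divide_ennreal_def by simp
  qed
  moreover have "positive (sets configs) \<mu>"
    unfolding positive_def \<mu>_eq by simp
  ultimately have "emeasure (reduced_palm M \<phi>) Y = \<mu> Y"
    using Y by (intro emeasure_measure_of[OF palm]) (auto simp: sets.space_closed dest: sets.sets_into_space)
  then show ?thesis by (simp add: \<mu>_eq)
qed

text \<open>Both sides are additive, homogeneous and continuous along increasing sequences in
  \<open>F\<close>, so the formula extends from events to functions.\<close>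

lemma nn_integral_reduced_palm:
  assumes \<phi>: "point_process M \<phi>" and F: "F \<in> borel_measurable configs"
  shows "(\<integral>\<^sup>+A. F A \<partial>reduced_palm M \<phi>) =
    (\<integral>\<^sup>+\<omega>. \<integral>\<^sup>+x. indicator unit_square x * F (reduced_shift x (\<phi> \<omega>)) \<partial>count_space (\<phi> \<omega>) \<partial>M) /
    (\<integral>\<^sup>+\<omega>. of_nat (card (\<phi> \<omega> \<inter> unit_square)) \<partial>M)" (is "_ = _ / ?D")
proof -
  have [measurable]: "\<phi> \<in> M \<rightarrow>\<^sub>M configs" using \<phi> by (simp add: point_process_def)
  show ?thesis using F
  proof (induction rule: borel_measurable_induct)
    case (cong f g)
    have shift: "reduced_shift x (\<phi> \<omega>) \<in> space configs" if "\<omega> \<in> space M" for x \<omega>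
      using measurable_space[OF measurable_reduced_shift[of "\<lambda>_. x" M \<phi>] that] by simp
    have "(\<integral>\<^sup>+A. f A \<partial>reduced_palm M \<phi>) = (\<integral>\<^sup>+A. g A \<partial>reduced_palm M \<phi>)"
      using cong by (intro nn_integral_cong) simp
    moreover have "(\<integral>\<^sup>+\<omega>. \<integral>\<^sup>+x. indicator unit_square x * f (reduced_shift x (\<phi> \<omega>)) \<partial>count_space (\<phi> \<omega>) \<partial>M) =
        (\<integral>\<^sup>+\<omega>. \<integral>\<^sup>+x. indicator unit_square x * g (reduced_shift x (\<phi> \<omega>)) \<partial>count_space (\<phi> \<omega>) \<partial>M)"
      using cong shift by (intro nn_integral_cong) simp
    ultimately show ?case using cong by simp
  next
    case (set Y)
    then show ?case using emeasure_reduced_palm[OF \<phi>, of Y] by simp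
  next
    case (mult u a)
    note [measurable] = mult.hyps(2)
    have "u \<in> borel_measurable (reduced_palm M \<phi>)" by measurable
    moreover have "(\<integral>\<^sup>+\<omega>. \<integral>\<^sup>+x. indicator unit_square x * (a * u (reduced_shift x (\<phi> \<omega>))) \<partial>count_space (\<phi> \<omega>) \<partial>M) =
        a * (\<integral>\<^sup>+\<omega>. \<integral>\<^sup>+x. indicator unit_square x * u (reduced_shift x (\<phi> \<omega>)) \<partial>count_space (\<phi> \<omega>) \<partial>M)"
      by (simp add: mult.left_commute nn_integral_cmult)
    ultimately show ?case using mult by (simp add: nn_integral_cmult ennreal_times_divide)
  next
    case (add u v)
    note [measurable] = add.hyps(1) add.hyps(3)
    have "u \<in> borel_measurable (reduced_palm M \<phi>)" "v \<in> borel_measurable (reduced_palm M \<phi>)" by measurable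
    moreover have "(\<integral>\<^sup>+\<omega>. \<integral>\<^sup>+x. indicator unit_square x * (v (reduced_shift x (\<phi> \<omega>)) + u (reduced_shift x (\<phi> \<omega>))) \<partial>count_space (\<phi> \<omega>) \<partial>M) =
        (\<integral>\<^sup>+\<omega>. \<integral>\<^sup>+x. indicator unit_square x * v (reduced_shift x (\<phi> \<omega>)) \<partial>count_space (\<phi> \<omega>) \<partial>M) +
        (\<integral>\<^sup>+\<omega>. \<integral>\<^sup>+x. indicator unit_square x * u (reduced_shift x (\<phi> \<omega>)) \<partial>count_space (\<phi> \<omega>) \<partial>M)"
      by (simp add: distrib_left nn_integral_add)
    ultimately show ?case using add by (simp add: nn_integral_add divide_ennreal_def distrib_right)
  next
    case (seq U)
    note [measurable] = seq.hyps(1)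
    have [measurable]: "U i \<in> borel_measurable (reduced_palm M \<phi>)" for i by measurable
    let ?N = "\<lambda>i. \<integral>\<^sup>+\<omega>. \<integral>\<^sup>+x. indicator unit_square x * U i (reduced_shift x (\<phi> \<omega>)) \<partial>count_space (\<phi> \<omega>) \<partial>M"
    have inc: "incseq (\<lambda>i x. indicator unit_square x * U i (reduced_shift x A))" for A
      using seq.hyps by (auto simp: incseq_def le_fun_def intro!: mult_left_mono)
    have "(\<integral>\<^sup>+\<omega>. \<integral>\<^sup>+x. indicator unit_square x * (SUP i. U i (reduced_shift x (\<phi> \<omega>))) \<partial>count_space (\<phi> \<omega>) \<partial>M) =
        (\<integral>\<^sup>+\<omega>. (SUP i. \<integral>\<^sup>+x. indicator unit_square x * U i (reduced_shift x (\<phi> \<omega>)) \<partial>count_space (\<phi> \<omega>)) \<partial>M)"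
      by (simp add: SUP_mult_left_ennreal nn_integral_monotone_convergence_SUP[OF inc])
    also have "\<dots> = (SUP i. ?N i)"
      using inc by (intro nn_integral_monotone_convergence_SUP) (auto simp: incseq_def le_fun_def intro!: nn_integral_mono)
    finally have "(\<integral>\<^sup>+\<omega>. \<integral>\<^sup>+x. indicator unit_square x * (SUP i. U i (reduced_shift x (\<phi> \<omega>))) \<partial>count_space (\<phi> \<omega>) \<partial>M) / ?D =
        (SUP i. ?N i / ?D)"
      by (simp add: divide_ennreal_def SUP_mult_right_ennreal)
    moreover have "(\<integral>\<^sup>+A. (SUP i. U i A) \<partial>reduced_palm M \<phi>) = (SUP i. \<integral>\<^sup>+A. U i A \<partial>reduced_palm M \<phi>)"
      using seq.hyps by (intro nn_integral_monotone_convergence_SUP) auto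
    ultimately show ?case using seq.IH by (simp add: image_comp)
  qed
qed

section \<open>Sums over parent and point indices\<close>

lemma nn_integral_count_space_Sigma:
  fixes u :: "nat \<times> nat \<Rightarrow> ennreal"
  shows "(\<integral>\<^sup>+p. u p \<partial>count_space (SIGMA n:UNIV. {..<N n})) = (\<Sum>n. \<Sum>k<N n. u (n, k))"
proof -
  have "(\<integral>\<^sup>+p. u p \<partial>count_space (SIGMA n:UNIV. {..<N n})) =
      (\<integral>\<^sup>+p. u p * indicator (SIGMA n:UNIV. {..<N n}) p \<partial>count_space UNIV)"
    by (rule nn_integral_count_space_indicator) simp
  also have "\<dots> = (\<integral>\<^sup>+n. \<integral>\<^sup>+k. u (n, k) * indicator {..<N n} k \<partial>count_space UNIV \<partial>count_space UNIV)"
    by (subst nn_integral_fst_count_space[symmetric]) (auto intro!: nn_integral_cong split: split_indicator)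
  also have "\<dots> = (\<integral>\<^sup>+n. (\<Sum>k<N n. u (n, k)) \<partial>count_space UNIV)"
    by (intro nn_integral_cong) (simp add: nn_integral_count_space_indicator[symmetric] nn_integral_count_space_finite)
  finally show ?thesis by (simp add: nn_integral_count_space_nat)
qed

lemma suminf_remove:
  fixes a :: "nat \<Rightarrow> ennreal"
  shows "(\<Sum>m. a m) = a n + (\<Sum>m. if m = n then 0 else a m)"
proof -
  have "(\<Sum>m. a m) = (\<Sum>m. (if m = n then a m else 0) + (if m = n then 0 else a m))"
    by (intro suminf_cong) auto
  also have "\<dots> = (\<Sum>m. if m = n then a m else 0) + (\<Sum>m. if m = n then 0 else a m)"
    by (rule suminf_add[symmetric]) (auto intro: summableI)
  also have "(\<Sum>m. if m = n then a m else 0) = a n"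
    by (subst suminf_finite[of "{n}"]) auto
  finally show ?thesis .
qed

text \<open>The difference has integral 0, where finiteness makes the subtraction legitimate. Both
  \<open>M\<close> and the counting measure on indices are instances in the argument against
  coincidences.\<close>

lemma AE_eq_of_nn_integral_eq:
  assumes [measurable]: "f \<in> borel_measurable M" "g \<in> borel_measurable M"
    and le: "\<And>x. f x \<le> (g x :: ennreal)" and eq: "(\<integral>\<^sup>+x. f x \<partial>M) = (\<integral>\<^sup>+x. g x \<partial>M)"
    and fin: "(\<integral>\<^sup>+x. g x \<partial>M) \<noteq> \<infinity>"
  shows "AE x in M. f x = g x"
proof -
  have "(\<integral>\<^sup>+x. g x - f x \<partial>M) = (\<integral>\<^sup>+x. g x \<partial>M) - (\<integral>\<^sup>+x. f x \<partial>M)"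
    using fin eq le by (intro nn_integral_diff) auto
  also have "\<dots> = 0" using eq fin by simp
  finally have "AE x in M. g x - f x = 0" by (subst (asm) nn_integral_0_iff_AE) auto
  moreover have "AE x in M. g x \<noteq> \<infinity>"
    using fin by (intro nn_integral_PInf_AE) auto
  ultimately show ?thesis
  proof eventually_elim
    case (elim x)
    then show ?case using le[of x] by (simp add: diff_eq_0_iff_ennreal less_top antisym)
  qed
qed

locale neyman_scott_representation =
  enumerated_poisson_process M r \<Psi> X + cluster_model c f
  for M :: "'w measure" and r :: real and \<Psi> :: "'w \<Rightarrow> plane set" and X :: "nat \<Rightarrow> 'w \<Rightarrow> plane"
    and c :: real and f :: "plane \<Rightarrow> real" +
  fixes \<phi> :: "'w \<Rightarrow> plane set" and C :: "nat \<Rightarrow> 'w \<Rightarrow> nat \<times> (nat \<Rightarrow> plane)"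
  assumes rate_pos: "0 < r" and point_process: "point_process M \<phi>"
    and C_measurable [measurable]: "\<And>n. C n \<in> M \<rightarrow>\<^sub>M cluster_law c f"
    and joint_law: "distr M ((\<Pi>\<^sub>M n\<in>UNIV. borel) \<Otimes>\<^sub>M (\<Pi>\<^sub>M n\<in>UNIV. cluster_law c f))
            (\<lambda>\<omega>. (\<lambda>n. X n \<omega>, \<lambda>n. C n \<omega>))
          = distr M (\<Pi>\<^sub>M n\<in>UNIV. borel) (\<lambda>\<omega> n. X n \<omega>) \<Otimes>\<^sub>M (\<Pi>\<^sub>M n\<in>UNIV. cluster_law c f)"
    and union_of_clusters: "AE \<omega> in M. \<phi> \<omega> = (\<Union>n. cluster_points (X n \<omega>) (C n \<omega>))"
begin

text \<open>Summing over indices rather than over points of \<phi> gives a random variable whose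
  mean follows from \<open>joint_law\<close> before distinct indices are known to give distinct
  points.\<close>

definition palm_sum :: "plane set \<Rightarrow> (plane \<Rightarrow> ennreal) \<Rightarrow> 'w \<Rightarrow> ennreal" where
  "palm_sum W \<nu> \<omega> = (\<Sum>n. cluster_contribution W \<nu> n (\<lambda>i. X i \<omega>) (\<lambda>i. C i \<omega>))"

lemma measurable_cluster_contribution [measurable]:
  assumes [measurable]: "W \<in> sets borel" "\<nu> \<in> borel_measurable borel"
  shows "(\<lambda>w. cluster_contribution W \<nu> n (fst w) (snd w))
    \<in> borel_measurable ((\<Pi>\<^sub>M n\<in>UNIV. borel) \<Otimes>\<^sub>M (\<Pi>\<^sub>M n\<in>UNIV. cluster_law c f))"
  unfolding cluster_contribution_def by measurable

lemma measurable_parents_clusters [measurable]: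
  "(\<lambda>\<omega>. (\<lambda>n. X n \<omega>, \<lambda>n. C n \<omega>)) \<in> M \<rightarrow>\<^sub>M (\<Pi>\<^sub>M n\<in>UNIV. borel) \<Otimes>\<^sub>M (\<Pi>\<^sub>M n\<in>UNIV. cluster_law c f)"
  using measurable_space[OF C_measurable] by (intro measurable_Pair measurable_PiM_single') auto

lemma measurable_palm_sum [measurable]:
  assumes [measurable]: "W \<in> sets borel" "\<nu> \<in> borel_measurable borel"
  shows "palm_sum W \<nu> \<in> borel_measurable M"
  unfolding palm_sum_def
  using measurable_compose[OF measurable_parents_clusters measurable_cluster_contribution[OF assms]] by simp

text \<open>\<open>joint_law\<close> lets the clusters be integrated out with the parents fixed. For
  each displacement \<open>d\<close> of the observed point there remains a sum over its parent of a
  function of all other parents, the setting of \<open>mecke\<close>, and the Laplace functional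
  evaluates it. Reflection and translation invariance of Lebesgue measure remove \<open>x\<close>
  and \<open>d\<close> from the exponent and reduce \<open>W\<close> to its area.\<close>

lemma nn_integral_palm_sum:
  assumes [measurable]: "W \<in> sets borel" "\<nu> \<in> borel_measurable borel"
  shows "(\<integral>\<^sup>+\<omega>. palm_sum W \<nu> \<omega> \<partial>M) = ennreal c * (ennreal r * emeasure lborel W) *
    (exp_neg (ennreal r * (\<integral>\<^sup>+y. (1 - exp_neg (cluster_exponent \<nu> y)) \<partial>lborel)) *
     (\<integral>\<^sup>+d. exp_neg (cluster_exponent \<nu> d) \<partial>displacement))"
proof -
  let ?PC = "\<Pi>\<^sub>M n\<in>(UNIV :: nat set). cluster_law c f" and ?PX = "\<Pi>\<^sub>M n\<in>(UNIV :: nat set). (borel :: plane measure)"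
  let ?e = "\<lambda>d. exp_neg (cluster_exponent \<nu> d)"
  interpret PC: prob_space ?PC
    by (intro prob_space_PiM cluster.prob_space_axioms)
  have [measurable]: "(\<lambda>\<omega> n. X n \<omega>) \<in> M \<rightarrow>\<^sub>M ?PX"
    by (intro measurable_PiM_single') auto
  have [measurable]: "(\<lambda>w. \<Sum>n. cluster_contribution W \<nu> n (fst w) (snd w)) \<in> borel_measurable (?PX \<Otimes>\<^sub>M ?PC)"
    by measurable
  have meas_x [measurable]: "(\<lambda>C. cluster_contribution W \<nu> n x C) \<in> borel_measurable ?PC" for n x
    unfolding cluster_contribution_def by measurable
  define S where "S x = (\<integral>\<^sup>+C. (\<Sum>n. cluster_contribution W \<nu> n x C) \<partial>?PC)" for x
  \<comment> \<open>The part that involves the parents: \<open>x n\<close> is the parent of the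
    observed point, \<open>d\<close> the displacement of that point.\<close>
  define K where "K n d x = indicator W (x n + d) *
      exp_neg (\<Sum>m. if m = n then 0 else cluster_exponent \<nu> (x n + d - x m))" for n d and x :: "nat \<Rightarrow> plane"
  have [measurable]: "(\<lambda>w. K n (fst w) (snd w)) \<in> borel_measurable (borel \<Otimes>\<^sub>M ?PX)" for n
    unfolding K_def by measurable
  have [measurable]: "(\<lambda>w. K n (snd w) (\<lambda>n. X n (fst w))) \<in> borel_measurable (M \<Otimes>\<^sub>M borel)"
    "(\<lambda>w. K n (fst w) (\<lambda>n. X n (snd w))) \<in> borel_measurable (borel \<Otimes>\<^sub>M M)"
    "(\<lambda>\<omega>. K n d (\<lambda>n. X n \<omega>)) \<in> borel_measurable M" for n d
    unfolding K_def by measurable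
  have S: "S x = ennreal c * (\<integral>\<^sup>+d. ?e d * (\<Sum>n. K n d x) \<partial>displacement)" for x
  proof -
    have [measurable]: "(\<lambda>d. K n d x) \<in> borel_measurable borel" for n
      unfolding K_def by measurable
    have "S x = (\<Sum>n. ennreal c * (\<integral>\<^sup>+d. ?e d * K n d x \<partial>displacement))"
      unfolding S_def by (simp add: nn_integral_suminf nn_integral_cluster_contribution K_def)
    moreover have "(\<integral>\<^sup>+d. (\<Sum>n. ?e d * K n d x) \<partial>displacement) = (\<Sum>n. \<integral>\<^sup>+d. ?e d * K n d x \<partial>displacement)"
      by (rule nn_integral_suminf) measurable
    ultimately show ?thesis by simp
  qed
  have "(\<integral>\<^sup>+\<omega>. palm_sum W \<nu> \<omega> \<partial>M) =
      (\<integral>\<^sup>+w. (\<Sum>n. cluster_contribution W \<nu> n (fst w) (snd w)) \<partial>(distr M ?PX (\<lambda>\<omega> n. X n \<omega>) \<Otimes>\<^sub>M ?PC))"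
    unfolding joint_law[symmetric] palm_sum_def by (simp add: nn_integral_distr)
  also have "\<dots> = (\<integral>\<^sup>+x. S x \<partial>distr M ?PX (\<lambda>\<omega> n. X n \<omega>))"
    unfolding S_def by (subst PC.nn_integral_fst[symmetric]) simp_all
  also have "\<dots> = (\<integral>\<^sup>+\<omega>. S (\<lambda>n. X n \<omega>) \<partial>M)"
    unfolding S_def by (intro nn_integral_distr) measurable
  also have "\<dots> = ennreal c * (\<integral>\<^sup>+\<omega>. \<integral>\<^sup>+d. ?e d * (\<Sum>n. K n d (\<lambda>n. X n \<omega>)) \<partial>displacement \<partial>M)"
    unfolding S by (rule nn_integral_cmult) measurable
  \<comment> \<open>The displacement is fixed before the parents are integrated, because the kernel
    given to \<open>mecke\<close> depends on it.\<close>
  also have "(\<integral>\<^sup>+\<omega>. \<integral>\<^sup>+d. ?e d * (\<Sum>n. K n d (\<lambda>n. X n \<omega>)) \<partial>displacement \<partial>M) =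
      (\<integral>\<^sup>+d. \<integral>\<^sup>+\<omega>. ?e d * (\<Sum>n. K n d (\<lambda>n. X n \<omega>)) \<partial>M \<partial>displacement)"
  proof -
    interpret pair_sigma_finite displacement M
      by unfold_locales
    show ?thesis
      by (rule Fubini') measurable
  qed
  also have "\<dots> = (\<integral>\<^sup>+d. ?e d * (ennreal r * emeasure lborel W *
      exp_neg (ennreal r * (\<integral>\<^sup>+y. (1 - ?e y) \<partial>lborel))) \<partial>displacement)"
  proof (rule nn_integral_cong)
    fix d
    \<comment> \<open>\<open>A\<close> stands for all parents other than \<open>x\<close>, as
      Mecke's formula supplies them.\<close>
    define F where "F x A = indicator W (x + d) * exp_neg (\<integral>\<^sup>+y. cluster_exponent \<nu> (x + d - y) \<partial>count_space A)"
      for x and A :: "plane set"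
    have [measurable]: "(\<lambda>w. F (fst w) (snd w)) \<in> borel_measurable (borel \<Otimes>\<^sub>M configs)"
      unfolding F_def by measurable
    have "AE \<omega> in M. (\<Sum>n. K n d (\<lambda>n. X n \<omega>)) = (\<integral>\<^sup>+x. F x (\<Psi> \<omega> - {x}) \<partial>count_space (\<Psi> \<omega>))"
      using X_bij
    proof eventually_elim
      case (elim \<omega>)
      have "K n d (\<lambda>n. X n \<omega>) = F (X n \<omega>) (\<Psi> \<omega> - {X n \<omega>})" for n
      proof -
        have "bij_betw (\<lambda>n. X n \<omega>) (UNIV - {n}) (\<Psi> \<omega> - {X n \<omega>})"
          using elim by (auto simp: bij_betw_def inj_on_def)
        from nn_integral_bij_count_space[OF this, of "\<lambda>y. cluster_exponent \<nu> (X n \<omega> + d - y)", symmetric]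
        have "(\<integral>\<^sup>+y. cluster_exponent \<nu> (X n \<omega> + d - y) \<partial>count_space (\<Psi> \<omega> - {X n \<omega>})) =
            (\<integral>\<^sup>+m. cluster_exponent \<nu> (X n \<omega> + d - X m \<omega>) * indicator (UNIV - {n}) m \<partial>count_space UNIV)"
          by (simp add: nn_integral_count_space_indicator)
        also have "\<dots> = (\<Sum>m. if m = n then 0 else cluster_exponent \<nu> (X n \<omega> + d - X m \<omega>))"
          unfolding nn_integral_count_space_nat by (intro suminf_cong) auto
        finally show ?thesis by (simp add: K_def F_def)
      qed
      then show ?case
        using nn_integral_bij_count_space[OF elim, of "\<lambda>x. F x (\<Psi> \<omega> - {x})"]
        by (simp add: nn_integral_count_space_nat)
    qed
    then have "(\<integral>\<^sup>+\<omega>. (\<Sum>n. K n d (\<lambda>n. X n \<omega>)) \<partial>M) = ennreal r * (\<integral>\<^sup>+x. \<integral>\<^sup>+\<omega>. F x (\<Psi> \<omega>) \<partial>M \<partial>lborel)"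
      using mecke[of F] by (simp cong: nn_integral_cong_AE)
    also have "(\<integral>\<^sup>+x. \<integral>\<^sup>+\<omega>. F x (\<Psi> \<omega>) \<partial>M \<partial>lborel) =
        (\<integral>\<^sup>+x. indicator W (x + d) * exp_neg (ennreal r * (\<integral>\<^sup>+y. (1 - ?e y) \<partial>lborel)) \<partial>lborel)"
    proof (intro nn_integral_cong)
      fix x
      have "(\<integral>\<^sup>+\<omega>. F x (\<Psi> \<omega>) \<partial>M) = indicator W (x + d) *
          (\<integral>\<^sup>+\<omega>. exp_neg (\<integral>\<^sup>+y. cluster_exponent \<nu> (x + d - y) \<partial>count_space (\<Psi> \<omega>)) \<partial>M)"
        unfolding F_def by (rule nn_integral_cmult) measurable
      also have "\<dots> = indicator W (x + d) * exp_neg (ennreal r * (\<integral>\<^sup>+y. (1 - ?e (x + d - y)) \<partial>lborel))"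
        by (subst laplace_functional) simp_all
      also have "(\<integral>\<^sup>+y. (1 - ?e (x + d - y)) \<partial>lborel) = (\<integral>\<^sup>+y. (1 - ?e y) \<partial>lborel)"
        by (rule nn_integral_lborel_reflect) measurable
      finally show "(\<integral>\<^sup>+\<omega>. F x (\<Psi> \<omega>) \<partial>M) =
          indicator W (x + d) * exp_neg (ennreal r * (\<integral>\<^sup>+y. (1 - ?e y) \<partial>lborel))" .
    qed
    also have "\<dots> = emeasure lborel W * exp_neg (ennreal r * (\<integral>\<^sup>+y. (1 - ?e y) \<partial>lborel))"
      using nn_integral_lborel_translate[of "indicator W" d] by (simp add: nn_integral_multc)
    finally show "(\<integral>\<^sup>+\<omega>. ?e d * (\<Sum>n. K n d (\<lambda>n. X n \<omega>)) \<partial>M) =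
        ?e d * (ennreal r * emeasure lborel W * exp_neg (ennreal r * (\<integral>\<^sup>+y. (1 - ?e y) \<partial>lborel)))"
      by (subst nn_integral_cmult) (simp_all add: mult.assoc)
  qed
  also have "\<dots> = (\<integral>\<^sup>+d. ?e d \<partial>displacement) * (ennreal r * emeasure lborel W *
      exp_neg (ennreal r * (\<integral>\<^sup>+y. (1 - ?e y) \<partial>lborel)))"
    by (rule nn_integral_multc) measurable
  finally show ?thesis
    by (simp add: mult_ac)
qed

end

section \<open>Distinctness of the cluster points and transfer to \<phi>\<close>

context neyman_scott_representation
begin

definition indices :: "'w \<Rightarrow> (nat \<times> nat) set" where
  "indices \<omega> = (SIGMA n:UNIV. {..<fst (C n \<omega>)})"

definition pt :: "'w \<Rightarrow> nat \<times> nat \<Rightarrow> plane" where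
  "pt \<omega> p = X (fst p) \<omega> + snd (C (fst p) \<omega>) (snd p)"

text \<open>Undoes the split into own cluster and other clusters made in
  \<open>cluster_contribution\<close>: together they are all indices except that of the observed
  point.\<close>

lemma palm_sum_eq:
  "palm_sum W \<nu> \<omega> = (\<integral>\<^sup>+p. indicator W (pt \<omega> p) * exp_neg
     (\<integral>\<^sup>+q. (if q = p then 0 else \<nu> (pt \<omega> q - pt \<omega> p)) \<partial>count_space (indices \<omega>)) \<partial>count_space (indices \<omega>))"
proof -
  have "(\<Sum>j<fst (C n \<omega>). if j = k then 0 else \<nu> (snd (C n \<omega>) j - snd (C n \<omega>) k)) +
      (\<Sum>m. if m = n then 0 else \<Sum>j<fst (C m \<omega>). \<nu> (X m \<omega> + snd (C m \<omega>) j - (X n \<omega> + snd (C n \<omega>) k))) =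
      (\<integral>\<^sup>+q. (if q = (n, k) then 0 else \<nu> (pt \<omega> q - pt \<omega> (n, k))) \<partial>count_space (indices \<omega>))" for n k
    unfolding indices_def nn_integral_count_space_Sigma
    by (subst suminf_remove[of _ n])
      (auto simp: pt_def intro!: arg_cong2[where f="(+)"] suminf_cong sum.cong)
  then show ?thesis
    unfolding palm_sum_def cluster_contribution_def
    by (simp add: indices_def nn_integral_count_space_Sigma pt_def)
qed

text \<open>A displacement with a density hits the given point \<open>v\<close> with probability 0,
  and elsewhere the weight vanishes.\<close>

lemma cluster_exponent_infinite_at_0: "cluster_exponent (\<lambda>y. \<top> * indicator {0} y) v = 0"
proof -
  have "AE d in displacement. d \<noteq> v"
    unfolding displacement_def by (subst AE_density) (auto intro: AE_mp[OF AE_lborel_singleton[of v]])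
  then have "AE d in displacement. exp_neg (\<top> * indicator {0} (d - v)) = 1"
    by eventually_elim simp
  then have "(\<integral>\<^sup>+d. exp_neg (\<top> * indicator {0} (d - v)) \<partial>displacement) = (\<integral>\<^sup>+d. 1 \<partial>displacement)"
    by (rule nn_integral_cong_AE)
  then show ?thesis using displacement.emeasure_space_1 by (simp add: cluster_exponent_def)
qed

lemma cluster_exponent_zero: "cluster_exponent (\<lambda>_. 0) v = 0"
  using displacement.emeasure_space_1 by (simp add: cluster_exponent_def)

text \<open>Coincidences are excluded by computing the expected number of points of \<open>W\<close> that coincide
  with no other point: it is the mean of \<open>palm_sum W \<nu>\<close> for \<open>\<nu>\<close> infinite at the origin and zero elsewhere,
  and equals the expected number of all points of \<open>W\<close>.\<close>

lemma AE_points_distinct: "AE \<omega> in M. inj_on (pt \<omega>) (indices \<omega>)"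
proof -
  let ?\<nu> = "\<lambda>y :: plane. \<top> * indicator {0} y :: ennreal"
  have simple: "AE \<omega> in M. \<forall>p\<in>indices \<omega>. \<forall>q\<in>indices \<omega>. pt \<omega> p \<in> ball 0 (real R) \<longrightarrow> pt \<omega> q = pt \<omega> p \<longrightarrow> q = p" for R :: nat
  proof -
    \<comment> \<open>Within a ball the mean number of points is finite, so equal means of ordered
      variables force almost sure equality; countably many balls cover the plane.\<close>
    let ?W = "ball 0 (real R) :: plane set"
    have mass: "(\<integral>\<^sup>+\<omega>. palm_sum ?W \<nu> \<omega> \<partial>M) = ennreal c * (ennreal r * emeasure lborel ?W)"
      if "\<And>v. cluster_exponent \<nu> v = 0" and [measurable]: "\<nu> \<in> borel_measurable borel" for \<nu>
      using displacement.emeasure_space_1 by (subst nn_integral_palm_sum) (simp_all add: that)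
    have le: "palm_sum ?W ?\<nu> \<omega> \<le> palm_sum ?W (\<lambda>_. 0) \<omega>" for \<omega>
      unfolding palm_sum_eq by (intro nn_integral_mono mult_left_mono exp_neg_antimono) auto
    have eq: "(\<integral>\<^sup>+\<omega>. palm_sum ?W ?\<nu> \<omega> \<partial>M) = (\<integral>\<^sup>+\<omega>. palm_sum ?W (\<lambda>_. 0) \<omega> \<partial>M)"
      by (simp add: mass cluster_exponent_infinite_at_0 cluster_exponent_zero)
    have fin: "(\<integral>\<^sup>+\<omega>. palm_sum ?W (\<lambda>_. 0) \<omega> \<partial>M) \<noteq> \<infinity>"
      using emeasure_bounded_finite[OF bounded_ball[of "0 :: plane" "real R"]]
      by (simp add: mass cluster_exponent_zero ennreal_mult_eq_top_iff)
    have "AE \<omega> in M. palm_sum ?W ?\<nu> \<omega> = palm_sum ?W (\<lambda>_. 0) \<omega>"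
      using le eq fin by (intro AE_eq_of_nn_integral_eq) auto
    moreover have "AE \<omega> in M. palm_sum ?W (\<lambda>_. 0) \<omega> \<noteq> \<infinity>"
      using fin by (intro nn_integral_PInf_AE) auto
    ultimately show ?thesis
    proof eventually_elim
      case (elim \<omega>)
      let ?S = "\<lambda>p. \<integral>\<^sup>+q. (if q = p then 0 else ?\<nu> (pt \<omega> q - pt \<omega> p)) \<partial>count_space (indices \<omega>)"
      \<comment> \<open>The same comparison for a fixed outcome, index by index: under the counting
        measure, almost everywhere means at every index.\<close>
      have "AE p in count_space (indices \<omega>). indicator ?W (pt \<omega> p) * exp_neg (?S p) = indicator ?W (pt \<omega> p)"
      proof (rule AE_eq_of_nn_integral_eq)
        show "indicator ?W (pt \<omega> p) * exp_neg (?S p) \<le> indicator ?W (pt \<omega> p)" for p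
          using exp_neg_le_1[of "?S p"] by (simp split: split_indicator)
      qed (use elim in \<open>simp_all add: palm_sum_eq\<close>)
      then have one: "exp_neg (?S p) = 1" if "p \<in> indices \<omega>" "pt \<omega> p \<in> ?W" for p
        using that by (auto simp: AE_count_space)
      show ?case
      proof (intro ballI impI, rule ccontr)
        fix p q assume pq: "p \<in> indices \<omega>" "q \<in> indices \<omega>" "pt \<omega> p \<in> ?W" "pt \<omega> q = pt \<omega> p" "q \<noteq> p"
        \<comment> \<open>A coincidence contributes the infinite weight to
          \<open>?S p\<close>.\<close>
        have "\<top> = (\<integral>\<^sup>+q'. \<top> * indicator {q} q' \<partial>count_space (indices \<omega>))"
          using pq(2) by (subst nn_integral_cmult) (simp_all add: emeasure_count_space_finite)
        also have "\<dots> \<le> ?S p"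
          using pq by (intro nn_integral_mono) (auto split: split_indicator)
        finally have "exp_neg (?S p) = 0" by (simp add: top_unique)
        with one[OF pq(1,3)] show False by simp
      qed
    qed
  qed
  have "AE \<omega> in M. \<forall>R. \<forall>p\<in>indices \<omega>. \<forall>q\<in>indices \<omega>. pt \<omega> p \<in> ball 0 (real R) \<longrightarrow> pt \<omega> q = pt \<omega> p \<longrightarrow> q = p"
    unfolding AE_all_countable using simple by blast
  then show ?thesis
  proof eventually_elim
    case (elim \<omega>)
    show ?case
    proof (rule inj_onI)
      fix p q assume pq: "p \<in> indices \<omega>" "q \<in> indices \<omega>" "pt \<omega> p = pt \<omega> q"
      obtain R :: nat where "norm (pt \<omega> p) < real R" using reals_Archimedean2 by blast
      then have "pt \<omega> p \<in> ball 0 (real R)" by simp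
      with elim pq show "p = q" by metis
    qed
  qed
qed

lemma AE_bij_points: "AE \<omega> in M. bij_betw (pt \<omega>) (indices \<omega>) (\<phi> \<omega>)"
  using AE_points_distinct union_of_clusters
proof eventually_elim
  case (elim \<omega>)
  have "\<phi> \<omega> = pt \<omega> ` indices \<omega>"
    unfolding elim(2) by (force simp: cluster_points_def indices_def pt_def split_beta')
  with elim(1) show ?case by (simp add: bij_betw_def)
qed

text \<open>Almost surely \<open>pt\<close> is a bijection from indices to points, so removing the
  point \<open>x\<close> from \<phi> removes exactly one index and the sum over \<phi> is
  \<open>palm_sum\<close>.\<close>

lemma nn_integral_palm:
  assumes [measurable]: "W \<in> sets borel" "\<nu> \<in> borel_measurable borel"
  shows "(\<integral>\<^sup>+\<omega>. \<integral>\<^sup>+x. indicator W x * exp_neg (\<integral>\<^sup>+y. \<nu> y \<partial>count_space (reduced_shift x (\<phi> \<omega>)))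
      \<partial>count_space (\<phi> \<omega>) \<partial>M) = ennreal c * (ennreal r * emeasure lborel W) *
    (exp_neg (ennreal r * (\<integral>\<^sup>+y. (1 - exp_neg (cluster_exponent \<nu> y)) \<partial>lborel)) *
     (\<integral>\<^sup>+d. exp_neg (cluster_exponent \<nu> d) \<partial>displacement))"
proof -
  have "AE \<omega> in M. (\<integral>\<^sup>+x. indicator W x * exp_neg (\<integral>\<^sup>+y. \<nu> y \<partial>count_space (reduced_shift x (\<phi> \<omega>)))
      \<partial>count_space (\<phi> \<omega>)) = palm_sum W \<nu> \<omega>"
    using AE_bij_points
  proof eventually_elim
    case (elim \<omega>)
    have shift: "(\<integral>\<^sup>+y. \<nu> y \<partial>count_space (reduced_shift (pt \<omega> p) (\<phi> \<omega>))) =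
        (\<integral>\<^sup>+q. (if q = p then 0 else \<nu> (pt \<omega> q - pt \<omega> p)) \<partial>count_space (indices \<omega>))" if "p \<in> indices \<omega>" for p
      unfolding nn_integral_reduced_shift nn_integral_bij_count_space[OF elim, symmetric]
      using elim that by (intro nn_integral_cong) (auto simp: bij_betw_def inj_on_def)
    show ?case
      unfolding palm_sum_eq nn_integral_bij_count_space[OF elim, symmetric]
      by (intro nn_integral_cong) (simp add: shift)
  qed
  then have "(\<integral>\<^sup>+\<omega>. \<integral>\<^sup>+x. indicator W x * exp_neg (\<integral>\<^sup>+y. \<nu> y \<partial>count_space (reduced_shift x (\<phi> \<omega>)))
      \<partial>count_space (\<phi> \<omega>) \<partial>M) = (\<integral>\<^sup>+\<omega>. palm_sum W \<nu> \<omega> \<partial>M)"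
    by (rule nn_integral_cong_AE)
  then show ?thesis by (simp add: nn_integral_palm_sum)
qed

text \<open>The case \<open>\<nu> = 0\<close> of \<open>nn_integral_palm\<close>, where all
  exponents vanish.\<close>

lemma intensity: "(\<integral>\<^sup>+\<omega>. of_nat (card (\<phi> \<omega> \<inter> unit_square)) \<partial>M) = ennreal c * ennreal r"
proof -
  have "(\<integral>\<^sup>+\<omega>. of_nat (card (\<phi> \<omega> \<inter> unit_square)) \<partial>M) =
      (\<integral>\<^sup>+\<omega>. \<integral>\<^sup>+x. indicator unit_square x \<partial>count_space (\<phi> \<omega>) \<partial>M)"
    using point_process_locally_finite[OF point_process] bounded_unit_square
    by (intro nn_integral_cong) (simp add: nn_integral_count_space_card del: nn_integral_indicator)
  then show ?thesis
    using nn_integral_palm[of unit_square "\<lambda>_. 0"] displacement.emeasure_space_1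
    by (simp add: cluster_exponent_zero emeasure_unit_square)
qed

lemma nn_integral_reduced_palm_exp_neg:
  assumes [measurable]: "\<nu> \<in> borel_measurable borel"
  shows "(\<integral>\<^sup>+A. exp_neg (\<integral>\<^sup>+y. \<nu> y \<partial>count_space A) \<partial>reduced_palm M \<phi>) =
    exp_neg (ennreal r * (\<integral>\<^sup>+y. (1 - exp_neg (cluster_exponent \<nu> y)) \<partial>lborel)) *
    (\<integral>\<^sup>+d. exp_neg (cluster_exponent \<nu> d) \<partial>displacement)"
proof -
  \<comment> \<open>The intensity cancels in the Palm quotient because it is neither 0 nor
    infinite.\<close>
  have "ennreal c * ennreal r \<noteq> 0" "ennreal c * ennreal r \<noteq> \<top>"
    using c_pos rate_pos by (simp_all add: ennreal_mult_eq_top_iff)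
  then show ?thesis
    by (subst nn_integral_reduced_palm[OF point_process])
      (simp_all add: nn_integral_palm intensity emeasure_unit_square ennreal_mult_divide_eq mult.commute[of "ennreal c * ennreal r"])
qed

end

section \<open>Rayleigh fading\<close>

definition exponential_law :: "real \<Rightarrow> real measure" where
  "exponential_law \<mu> = density lborel (\<lambda>t. ennreal (exponential_density \<mu> t))"

lemma sets_exponential_law [simp, measurable_cong]: "sets (exponential_law \<mu>) = sets borel"
  and space_exponential_law [simp]: "space (exponential_law \<mu>) = UNIV"
  by (simp_all add: exponential_law_def)

lemma prob_space_exponential_law: "0 < \<mu> \<Longrightarrow> prob_space (exponential_law \<mu>)"
  unfolding exponential_law_def by (rule prob_space_exponential_density)

lemma AE_exponential_law_pos: "AE t in exponential_law \<mu>. 0 < t"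
  unfolding exponential_law_def
  using AE_lborel_singleton[of "0::real"]
  by (subst AE_density) (auto simp: exponential_density_def elim!: eventually_mono)

text \<open>Exponential tilting: the density of rate \<mu> times \<open>exp (- a * t)\<close> is
  \<open>\<mu> / (\<mu> + a)\<close> times the density of rate \<open>\<mu> + a\<close>. The
  logarithm puts the result into the form that \<open>nn_integral_PiM_exp_neg\<close> asks for;
  \<open>max 0 b\<close> arises because \<open>ennreal\<close> sends negative reals to 0.\<close>

lemma nn_integral_exponential_law_exp_neg:
  assumes \<mu>: "0 < \<mu>" and s: "0 \<le> s"
  shows "(\<integral>\<^sup>+t. exp_neg (ennreal s * ennreal (t * b)) \<partial>exponential_law \<mu>) =
    exp_neg (ennreal (ln (1 + s * max 0 b / \<mu>)))"
proof -
  define a where "a = s * max 0 b"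
  have a: "0 \<le> a" using s by (simp add: a_def)
  have "(\<integral>\<^sup>+t. exp_neg (ennreal s * ennreal (t * b)) \<partial>exponential_law \<mu>) =
      (\<integral>\<^sup>+t. ennreal (exponential_density \<mu> t) * exp_neg (ennreal s * ennreal (t * b)) \<partial>lborel)"
    unfolding exponential_law_def by (rule nn_integral_density) measurable
  also have "\<dots> = (\<integral>\<^sup>+t. ennreal (\<mu> / (\<mu> + a)) * ennreal (exponential_density (\<mu> + a) t) \<partial>lborel)"
  proof (rule nn_integral_cong)
    fix t :: real
    show "ennreal (exponential_density \<mu> t) * exp_neg (ennreal s * ennreal (t * b)) =
        ennreal (\<mu> / (\<mu> + a)) * ennreal (exponential_density (\<mu> + a) t)"
    proof (cases "0 \<le> t")
      case True
      have "ennreal (t * b) = ennreal (t * max 0 b)"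
        using True by (cases "b \<ge> 0") (auto simp: ennreal_neg mult_nonneg_nonpos)
      then have "ennreal s * ennreal (t * b) = ennreal (a * t)"
        using s True by (simp add: a_def mult_ac flip: ennreal_mult)
      moreover have "exp (- t * (\<mu> + a)) = exp (- t * \<mu>) * exp (- (a * t))"
        by (simp add: exp_add[symmetric] algebra_simps)
      ultimately show ?thesis
        using True \<mu> a by (simp add: exp_neg_ennreal exponential_density_def flip: ennreal_mult)
    qed (simp add: exponential_density_def)
  qed
  also have "\<dots> = ennreal (\<mu> / (\<mu> + a)) * emeasure (exponential_law (\<mu> + a)) (space (exponential_law (\<mu> + a)))"
    by (subst nn_integral_cmult) (simp_all add: exponential_law_def emeasure_density)
  also have "\<dots> = ennreal (\<mu> / (\<mu> + a))"
    using prob_space.emeasure_space_1[OF prob_space_exponential_law[of "\<mu> + a"]] \<mu> a by simp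
  also have "\<dots> = exp_neg (ennreal (ln (1 + s * max 0 b / \<mu>)))"
  proof -
    have "1 \<le> 1 + a / \<mu>" using \<mu> a by simp
    then have "exp_neg (ennreal (ln (1 + a / \<mu>))) = ennreal (exp (- ln (1 + a / \<mu>)))"
      by (intro exp_neg_ennreal ln_ge_zero)
    also have "exp (- ln (1 + a / \<mu>)) = \<mu> / (\<mu> + a)"
      using \<mu> a by (simp add: exp_minus add_pos_nonneg field_simps)
    finally show ?thesis by (simp add: a_def)
  qed
  finally show ?thesis .
qed

text \<open>For positive finite \<open>I\<close> the event is, up to a null set, the tail beyond
  \<open>T * I / b\<close>. An infinite \<open>I\<close> makes the ratio 0 and the event empty;
  \<open>I = 0\<close> makes the ratio infinite for \<open>t > 0\<close>, hence almost surely.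
  \<open>exp_neg\<close> fits all three cases.\<close>

lemma emeasure_exponential_law_ratio:
  assumes \<mu>: "0 < \<mu>" and T: "0 < T" and b: "0 < b"
  shows "emeasure (exponential_law \<mu>) {t. ennreal T \<le> ennreal (t * b) / I} = exp_neg (ennreal (\<mu> * T / b) * I)"
proof -
  interpret prob_space "exponential_law \<mu>" using \<mu> by (rule prob_space_exponential_law)
  have [measurable]: "{t. ennreal T \<le> ennreal (t * b) / I} \<in> sets borel" by measurable
  show ?thesis
  proof (cases I)
    case top
    then have "{t. ennreal T \<le> ennreal (t * b) / I} = {}" using T by auto
    with top show ?thesis using \<mu> T b by (simp add: ennreal_mult_top)
  next
    case (real i)
    show ?thesis
    proof (cases "i = 0")
      case True
      have "AE t in exponential_law \<mu>. t \<in> {t. ennreal T \<le> ennreal (t * b) / I}"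
        using AE_exponential_law_pos[of \<mu>] proof eventually_elim
        case (elim t)
        then show ?case using mult_pos_pos[OF elim b] by (simp add: real True ennreal_eq_0_iff)
      qed
      then have "emeasure (exponential_law \<mu>) {t. ennreal T \<le> ennreal (t * b) / I} = 1"
        by (subst emeasure_eq_1_AE) auto
      then show ?thesis by (simp add: real True)
    next
      case False
      with real have i: "0 < i" by simp
      define a where "a = T * i / b"
      have a: "0 < a" using T i b by (simp add: a_def)
      have iff: "ennreal T \<le> ennreal (t * b) / I \<longleftrightarrow> a \<le> t" if "0 < t" for t
        using that T i b by (simp add: real divide_ennreal a_def field_simps)
      \<comment> \<open>The distribution function measures \<open>{..a}\<close>, whose complement
        lacks the endpoint \<open>a\<close> of the event.\<close>
      have "AE t in exponential_law \<mu>. t \<noteq> a"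
        unfolding exponential_law_def by (subst AE_density) (auto intro: AE_mp[OF AE_lborel_singleton[of a]])
      with AE_exponential_law_pos[of \<mu>]
      have "AE t in exponential_law \<mu>. t \<in> {t. ennreal T \<le> ennreal (t * b) / I} \<longleftrightarrow> t \<in> space (exponential_law \<mu>) - {..a}"
        by eventually_elim (auto simp: iff)
      then have "emeasure (exponential_law \<mu>) {t. ennreal T \<le> ennreal (t * b) / I} =
          emeasure (exponential_law \<mu>) (space (exponential_law \<mu>) - {..a})"
        by (intro emeasure_eq_AE) auto
      also have "\<dots> = 1 - emeasure (exponential_law \<mu>) {..a}"
        by (subst emeasure_compl) (simp_all add: emeasure_space_1[simplified])
      also have "emeasure (exponential_law \<mu>) {..a} = ennreal (1 - exp (- a * \<mu>))"
        using \<mu> a unfolding exponential_law_def by (subst emeasure_erlang_density) (auto simp: erlang_CDF_0 mult.commute)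
      also have "1 - ennreal (1 - exp (- a * \<mu>)) = ennreal (exp (- a * \<mu>))"
        using \<mu> a by (simp flip: ennreal_1 add: ennreal_minus)
      also have "\<dots> = exp_neg (ennreal (a * \<mu>))"
        using \<mu> a by (simp add: exp_neg_ennreal)
      also have "ennreal (a * \<mu>) = ennreal (\<mu> * T / b) * I"
        using \<mu> T b i by (simp add: real a_def mult_ac flip: ennreal_mult)
      finally show ?thesis .
    qed
  qed
qed

text \<open>The truncation by \<open>max 0\<close> only matters at \<open>x = z\<close>, where \<open>g 0\<close> is arbitrary.\<close>

definition success_exponent :: "(plane \<Rightarrow> real) \<Rightarrow> real \<Rightarrow> plane \<Rightarrow> plane \<Rightarrow> ennreal" where
  "success_exponent g T z x = ennreal (ln (1 + T * max 0 (g (x - z)) / g z))"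

text \<open>Given the interference, the tail of \<open>h\<close> yields an exponential of it, and
  this factorises over the independent coefficients of the interferers.\<close>

lemma measure_success_event:
  assumes A: "countable A" and \<mu>: "0 < \<mu>" and T: "0 < T" and gz: "0 < g z"
  shows "measure (fading_law \<mu> A) (success_event \<mu> g T z A) =
    enn2real (exp_neg (\<integral>\<^sup>+x. success_exponent g T z x \<partial>count_space A))"
proof -
  let ?E = "exponential_law \<mu>"
  let ?P = "\<Pi>\<^sub>M x\<in>A. ?E"
  \<comment> \<open>The argument at which the Laplace transform of the interference is taken; in
    each factor \<open>1 + s * g (x - z) / \<mu>\<close> the rate \<mu> cancels.\<close>
  define s where "s = \<mu> * T / g z"
  have s: "0 \<le> s" using \<mu> T gz by (simp add: s_def)
  interpret E: prob_space ?E using \<mu> by (rule prob_space_exponential_law)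
  interpret P: prob_space ?P by (intro prob_space_PiM E.prob_space_axioms)
  interpret EP: pair_sigma_finite ?E ?P ..
  have meas: "(\<lambda>t. ennreal s * ennreal (t * b)) \<in> borel_measurable ?E" for b
    by measurable
  have law: "fading_law \<mu> A = ?E \<Otimes>\<^sub>M ?P"
    by (simp add: fading_law_def exponential_law_def)
  have interference: "interference g z A H = (\<integral>\<^sup>+x. ennreal (H x * g (x - z)) \<partial>count_space A)" for H
    unfolding interference_def by (rule infsum_eq_nn_integral_count_space[OF A])
  have [measurable]: "(\<lambda>H. H x) \<in> borel_measurable ?P" if "x \<in> A" for x
    using measurable_component_singleton[OF that, of "\<lambda>_. ?E"] by (simp cong: measurable_cong_sets)
  have [measurable]: "interference g z A \<in> borel_measurable ?P"
    unfolding interference nn_integral_count_space_SUP[OF A] by measurable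
  have [measurable]: "success_event \<mu> g T z A \<in> sets (?E \<Otimes>\<^sub>M ?P)"
  proof -
    have "success_event \<mu> g T z A =
        {w \<in> space (?E \<Otimes>\<^sub>M ?P). ennreal T \<le> ennreal (fst w * g z) / interference g z A (snd w)}"
      by (auto simp: success_event_def law)
    also have "\<dots> \<in> sets (?E \<Otimes>\<^sub>M ?P)" by measurable
    finally show ?thesis .
  qed
  have "emeasure (fading_law \<mu> A) (success_event \<mu> g T z A) =
      (\<integral>\<^sup>+H. emeasure ?E ((\<lambda>h. (h, H)) -` success_event \<mu> g T z A) \<partial>?P)"
    unfolding law by (rule EP.emeasure_pair_measure_alt2) measurable
  also have "\<dots> = (\<integral>\<^sup>+H. exp_neg (ennreal s * interference g z A H) \<partial>?P)"
  proof (rule nn_integral_cong)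
    fix H assume "H \<in> space ?P"
    then have "(\<lambda>h. (h, H)) -` success_event \<mu> g T z A = {t. ennreal T \<le> ennreal (t * g z) / interference g z A H}"
      by (auto simp: success_event_def law space_pair_measure)
    then show "emeasure ?E ((\<lambda>h. (h, H)) -` success_event \<mu> g T z A) = exp_neg (ennreal s * interference g z A H)"
      using emeasure_exponential_law_ratio[OF \<mu> T gz] by (simp add: s_def)
  qed
  also have "\<dots> = (\<integral>\<^sup>+H. exp_neg (\<integral>\<^sup>+x. ennreal s * ennreal (H x * g (x - z)) \<partial>count_space A) \<partial>?P)"
    by (simp add: interference nn_integral_cmult)
  also have "\<dots> = exp_neg (\<integral>\<^sup>+x. success_exponent g T z x \<partial>count_space A)"
  proof (rule nn_integral_PiM_exp_neg[OF E.prob_space_axioms A])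
    fix x assume "x \<in> A"
    have "1 + s * max 0 (g (x - z)) / \<mu> = 1 + T * max 0 (g (x - z)) / g z"
      using \<mu> gz by (simp add: s_def)
    then show "(\<integral>\<^sup>+t. exp_neg (ennreal s * ennreal (t * g (x - z))) \<partial>?E) = exp_neg (success_exponent g T z x)"
      using nn_integral_exponential_law_exp_neg[OF \<mu> s, of "g (x - z)"] by (simp add: success_exponent_def)
  qed (rule meas)
  finally show ?thesis by (simp add: measure_def)
qed

section \<open>Integrability of the path-loss kernel\<close>

lemma one_minus_exp_neg_le: "1 - exp_neg t \<le> t"
proof (cases t)
  case (real x)
  then have "1 - exp_neg t = ennreal (1 - exp (- x))"
    by (simp add: exp_neg_ennreal flip: ennreal_1 ennreal_minus)
  also have "\<dots> \<le> ennreal x"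
    using exp_ge_add_one_self[of "- x"] by (intro ennreal_leI) simp
  finally show ?thesis using real by simp
qed simp

locale path_loss_link =
  fixes g :: "plane \<Rightarrow> real" and T :: real and z :: plane
  assumes path_loss: "path_loss g" and T_pos: "0 < T" and z_nonzero: "z \<noteq> 0"
begin

lemma g_pos: "x \<noteq> 0 \<Longrightarrow> 0 < g x"
  using path_loss unfolding path_loss_def by blast

lemma g_measurable [measurable]: "g \<in> borel_measurable borel"
  using path_loss borel_measurable_continuous_countable_exceptions[of "{0}" g]
  unfolding path_loss_def by simp

lemma success_exponent_measurable [measurable]: "success_exponent g T z \<in> borel_measurable borel"
  unfolding success_exponent_def by measurable

text \<open>For \<open>u \<noteq> 0\<close> this is the probability that a lone interferer at
  position \<open>u\<close> relative to the receiver makes the transmission fail: with i.i.d.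
  exponential \<open>h\<close> and \<open>h'\<close>, the event
  \<open>h * g z < T * h' * g u\<close> has probability
  \<open>T * g u / (g z + T * g u)\<close>.\<close>

abbreviation "blocking u \<equiv> g u / (g z / T + g u)"

lemma blocking_bounds:
  assumes "u \<noteq> 0"
  shows "0 \<le> blocking u" "blocking u \<le> 1" "blocking u \<le> T / g z * g u"
proof -
  have pos: "0 < g z / T" "0 < g u" using g_pos z_nonzero assms T_pos by auto
  then show "0 \<le> blocking u" "blocking u \<le> 1" by (auto simp: divide_le_eq_1)
  have "g u / (g z / T + g u) \<le> g u / (g z / T)"
    using pos by (intro frac_le) auto
  then show "blocking u \<le> T / g z * g u" by (simp add: mult.commute)
qed

lemma one_minus_exp_neg_success_exponent:
  assumes "x \<noteq> z"
  shows "1 - exp_neg (success_exponent g T z x) = ennreal (blocking (x - z))"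
proof -
  have pos: "0 < g z" "0 < g (x - z)" using g_pos z_nonzero assms by auto
  then have ge: "0 < T * g (x - z) / g z" using T_pos by simp
  then have "exp_neg (success_exponent g T z x) = ennreal (exp (- ln (1 + T * g (x - z) / g z)))"
    using pos unfolding success_exponent_def by (subst exp_neg_ennreal) (auto intro!: ln_ge_zero)
  also have "exp (- ln (1 + T * g (x - z) / g z)) = 1 - blocking (x - z)"
  proof -
    have "g z + T * g (x - z) \<noteq> 0"
      using add_pos_pos[OF pos(1) mult_pos_pos[OF T_pos pos(2)]] by simp
    then show ?thesis
      using ge pos T_pos by (simp add: exp_minus add_pos_pos divide_simps) (simp add: algebra_simps)
  qed
  finally show ?thesis
    using blocking_bounds[of "x - z"] assms by (simp add: ennreal_minus flip: ennreal_1)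
qed

text \<open>\<open>g\<close> may have a non-integrable singularity at the origin, but there the
  kernel is bounded by 1; outside the unit ball it is at most \<open>T / g z\<close> times
  \<open>g\<close>, which is integrable there.\<close>

lemma nn_integral_one_minus_exp_neg_finite:
  "(\<integral>\<^sup>+x. (1 - exp_neg (success_exponent g T z x)) \<partial>lborel) < \<infinity>"
proof -
  have "set_integrable lborel (- ball 0 1) g"
    using path_loss unfolding path_loss_def by (metis zero_less_one)
  then have fin: "(\<integral>\<^sup>+u. ennreal (norm (indicator (- ball 0 1) u * g u)) \<partial>lborel) < \<infinity>"
    unfolding set_integrable_def integrable_iff_bounded by simp
  have "(\<integral>\<^sup>+x. (1 - exp_neg (success_exponent g T z x)) \<partial>lborel) =
      (\<integral>\<^sup>+u. (1 - exp_neg (success_exponent g T z (u + z))) \<partial>lborel)"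
    by (rule nn_integral_lborel_translate[symmetric]) measurable
  also have "\<dots> \<le> (\<integral>\<^sup>+u. indicator (ball 0 1) u +
      ennreal (T / g z) * ennreal (norm (indicator (- ball 0 1) u * g u)) \<partial>lborel)"
  proof (rule nn_integral_mono)
    fix u :: plane
    show "1 - exp_neg (success_exponent g T z (u + z)) \<le> indicator (ball 0 1) u +
        ennreal (T / g z) * ennreal (norm (indicator (- ball 0 1) u * g u))"
    proof (cases "u \<in> ball 0 1")
      case True
      have "1 - exp_neg (success_exponent g T z (u + z)) \<le> (1 :: ennreal)"
        by (rule diff_le_self_ennreal)
      then show ?thesis using True by simp
    next
      case False
      then have "u \<noteq> 0" by auto
      then have "1 - exp_neg (success_exponent g T z (u + z)) \<le> ennreal (T / g z * g u)"
        using blocking_bounds(3)[of u] by (subst one_minus_exp_neg_success_exponent) (auto intro!: ennreal_leI)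
      also have "\<dots> = ennreal (T / g z) * ennreal (g u)"
        using T_pos g_pos[OF z_nonzero] by (intro ennreal_mult) (auto simp: less_imp_le g_pos \<open>u \<noteq> 0\<close>)
      finally show ?thesis using False g_pos[OF \<open>u \<noteq> 0\<close>] by simp
    qed
  qed
  also have "\<dots> = emeasure lborel (ball (0 :: plane) 1) +
      ennreal (T / g z) * (\<integral>\<^sup>+u. ennreal (norm (indicator (- ball 0 1) u * g u)) \<partial>lborel)"
    by (subst nn_integral_add) (simp_all add: nn_integral_cmult borel_measurable_indicator)
  also have "\<dots> < \<infinity>"
    using fin emeasure_bounded_finite[OF bounded_ball[of "0 :: plane" 1]]
    by (simp add: ennreal_mult_less_top)
  finally show ?thesis .
qed

end

section \<open>The parent factor and the cluster factor as real integrals\<close>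

lemma integral_eq_of_nn_integral_finite:
  assumes [measurable]: "F \<in> borel_measurable M" and nonneg: "AE x in M. 0 \<le> F x"
    and fin: "(\<integral>\<^sup>+x. ennreal (F x) \<partial>M) < \<infinity>"
  shows "ennreal (\<integral>x. F x \<partial>M) = (\<integral>\<^sup>+x. ennreal (F x) \<partial>M)"
  using integral_eq_nn_integral[OF assms(1) nonneg] fin by simp

locale success_model = cluster_model c f + path_loss_link g T z
  for c :: real and f g :: "plane \<Rightarrow> real" and T :: real and z :: plane
begin

lemma ennreal_beta:
  "ennreal (beta g f T z y) = (\<integral>\<^sup>+d. (1 - exp_neg (success_exponent g T z (d - y))) \<partial>displacement)"
  and beta_nonneg: "0 \<le> beta g f T z y"
proof -
  let ?F = "\<lambda>x. g (x - y - z) / (g z / T + g (x - y - z)) * f x"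
  \<comment> \<open>At \<open>x = y + z\<close> the integrand involves the arbitrary value
    \<open>g 0\<close>, which may be negative; a single point is a null set.\<close>
  have AE: "AE x in lborel. x - y \<noteq> z"
    using AE_lborel_singleton[of "y + z"] by eventually_elim (auto simp: algebra_simps)
  have F: "AE x in lborel. ennreal (?F x) = ennreal (f x) * (1 - exp_neg (success_exponent g T z (x - y)))"
    using AE
  proof eventually_elim
    case (elim x)
    show ?case
      unfolding one_minus_exp_neg_success_exponent[OF elim] ennreal_mult''[OF f_nonneg] by (rule mult.commute)
  qed
  have nonneg: "AE x in lborel. 0 \<le> ?F x"
    using AE
  proof eventually_elim
    case (elim x)
    then show ?case
      using mult_nonneg_nonneg[OF blocking_bounds(1)[of "x - y - z"] f_nonneg[of x]] by simp
  qed
  have eq: "(\<integral>\<^sup>+x. ennreal (?F x) \<partial>lborel) = (\<integral>\<^sup>+d. (1 - exp_neg (success_exponent g T z (d - y))) \<partial>displacement)"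
    unfolding displacement_def using F by (subst nn_integral_density) (auto intro!: nn_integral_cong_AE)
  have "(\<integral>\<^sup>+d. (1 - exp_neg (success_exponent g T z (d - y))) \<partial>displacement) \<le> (\<integral>\<^sup>+d. 1 \<partial>displacement)"
    by (intro nn_integral_mono diff_le_self_ennreal)
  also have "\<dots> < \<infinity>" using displacement.emeasure_space_1 by simp
  finally show "ennreal (beta g f T z y) = (\<integral>\<^sup>+d. (1 - exp_neg (success_exponent g T z (d - y))) \<partial>displacement)"
    unfolding beta_def eq[symmetric] using nonneg by (intro integral_eq_of_nn_integral_finite) auto
  show "0 \<le> beta g f T z y"
    unfolding beta_def using nonneg by (rule integral_nonneg_AE)
qed

text \<open>The displacement law has mass 1, so one minus the mean of \<open>exp_neg\<close> is the
  mean of \<open>1 - exp_neg\<close>, the integral in \<open>beta\<close>.\<close>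

lemma cluster_exponent_success: "cluster_exponent (success_exponent g T z) y = ennreal (c * beta g f T z y)"
proof -
  have "(\<integral>\<^sup>+d. (1 - exp_neg (success_exponent g T z (d - y))) \<partial>displacement) =
      (\<integral>\<^sup>+d. 1 \<partial>displacement) - (\<integral>\<^sup>+d. exp_neg (success_exponent g T z (d - y)) \<partial>displacement)"
  proof (rule nn_integral_diff)
    have "(\<integral>\<^sup>+d. exp_neg (success_exponent g T z (d - y)) \<partial>displacement) \<le> (\<integral>\<^sup>+d. 1 \<partial>displacement)"
      by (intro nn_integral_mono exp_neg_le_1)
    then show "(\<integral>\<^sup>+d. exp_neg (success_exponent g T z (d - y)) \<partial>displacement) \<noteq> \<infinity>"
      using displacement.emeasure_space_1 by (auto simp: top_unique)
  qed (auto simp: exp_neg_le_1)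
  then show ?thesis
    using ennreal_beta[of y] beta_nonneg[of y] c_pos displacement.emeasure_space_1
    by (simp add: cluster_exponent_def ennreal_mult)
qed

lemma beta_measurable [measurable]: "beta g f T z \<in> borel_measurable borel"
  unfolding beta_def by measurable

lemma exp_neg_cluster_exponent: "exp_neg (cluster_exponent (success_exponent g T z) y) = ennreal (exp (- c * beta g f T z y))"
  using c_pos beta_nonneg[of y] by (simp add: cluster_exponent_success exp_neg_ennreal)

text \<open>The real integral can replace the extended one only once the latter is finite. Since
  \<open>1 - exp (- t) \<le> t\<close>, it is at most \<open>c\<close> times a double integral over
  displacements and parents; exchanging the order and reflecting in \<open>y\<close> reduces this to
  \<open>nn_integral_one_minus_exp_neg_finite\<close>.\<close>

lemma parent_factor:
  assumes "0 < r"
  shows "exp_neg (ennreal r * (\<integral>\<^sup>+y. (1 - exp_neg (cluster_exponent (success_exponent g T z) y)) \<partial>lborel)) =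
    ennreal (exp (- r * (\<integral>y. (1 - exp (- c * beta g f T z y)) \<partial>lborel)))"
proof -
  let ?\<nu> = "success_exponent g T z"
  let ?F = "\<lambda>y. 1 - exp (- c * beta g f T z y)"
  have F_nonneg: "0 \<le> ?F y" for y
    using c_pos beta_nonneg[of y] by simp
  have F: "1 - exp_neg (cluster_exponent ?\<nu> y) = ennreal (?F y)" for y
    unfolding exp_neg_cluster_exponent by (simp add: ennreal_minus flip: ennreal_1)
  interpret pair_sigma_finite displacement lborel ..
  have "(\<integral>\<^sup>+y. ennreal (?F y) \<partial>lborel) \<le> (\<integral>\<^sup>+y. cluster_exponent ?\<nu> y \<partial>lborel)"
    unfolding F[symmetric] by (intro nn_integral_mono one_minus_exp_neg_le)
  also have "\<dots> = (\<integral>\<^sup>+y. ennreal c * (\<integral>\<^sup>+d. (1 - exp_neg (?\<nu> (d - y))) \<partial>displacement) \<partial>lborel)"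
    using c_pos beta_nonneg by (simp add: cluster_exponent_success ennreal_mult ennreal_beta)
  also have "\<dots> = ennreal c * (\<integral>\<^sup>+y. \<integral>\<^sup>+d. (1 - exp_neg (?\<nu> (d - y))) \<partial>displacement \<partial>lborel)"
    by (rule nn_integral_cmult) measurable
  also have "(\<integral>\<^sup>+y. \<integral>\<^sup>+d. (1 - exp_neg (?\<nu> (d - y))) \<partial>displacement \<partial>lborel) =
      (\<integral>\<^sup>+d. \<integral>\<^sup>+y. (1 - exp_neg (?\<nu> (d - y))) \<partial>lborel \<partial>displacement)"
    by (rule Fubini') measurable
  also have "\<dots> = (\<integral>\<^sup>+d. \<integral>\<^sup>+u. (1 - exp_neg (?\<nu> u)) \<partial>lborel \<partial>displacement)"
    by (intro nn_integral_cong nn_integral_lborel_reflect) measurable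
  also have "\<dots> = (\<integral>\<^sup>+u. (1 - exp_neg (?\<nu> u)) \<partial>lborel)"
    using displacement.emeasure_space_1 by simp
  also have "ennreal c * \<dots> < \<infinity>"
    using nn_integral_one_minus_exp_neg_finite by (simp add: ennreal_mult_less_top)
  finally have eq: "ennreal (\<integral>y. ?F y \<partial>lborel) = (\<integral>\<^sup>+y. ennreal (?F y) \<partial>lborel)"
    using F_nonneg by (intro integral_eq_of_nn_integral_finite) auto
  have "0 \<le> (\<integral>y. ?F y \<partial>lborel)"
    using F_nonneg by (intro integral_nonneg_AE) simp
  then show ?thesis
    using assms unfolding F eq[symmetric] by (simp add: exp_neg_ennreal flip: ennreal_mult)
qed

lemma cluster_factor:
  "(\<integral>\<^sup>+d. exp_neg (cluster_exponent (success_exponent g T z) d) \<partial>displacement) =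
    ennreal (\<integral>y. exp (- c * beta g f T z y) * f y \<partial>lborel)"
proof -
  have "(\<integral>\<^sup>+d. exp_neg (cluster_exponent (success_exponent g T z) d) \<partial>displacement) =
      (\<integral>\<^sup>+y. ennreal (f y) * ennreal (exp (- c * beta g f T z y)) \<partial>lborel)"
    unfolding displacement_def exp_neg_cluster_exponent by (rule nn_integral_density) measurable
  also have "\<dots> = (\<integral>\<^sup>+y. ennreal (exp (- c * beta g f T z y) * f y) \<partial>lborel)"
    by (intro nn_integral_cong) (simp add: ennreal_mult f_nonneg mult.commute)
  finally have eq: "(\<integral>\<^sup>+d. exp_neg (cluster_exponent (success_exponent g T z) d) \<partial>displacement) =
      (\<integral>\<^sup>+y. ennreal (exp (- c * beta g f T z y) * f y) \<partial>lborel)" .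
  have "(\<integral>\<^sup>+d. exp_neg (cluster_exponent (success_exponent g T z) d) \<partial>displacement) \<le> (\<integral>\<^sup>+d. 1 \<partial>displacement)"
    by (intro nn_integral_mono exp_neg_le_1)
  also have "\<dots> < \<infinity>" using displacement.emeasure_space_1 by simp
  finally show ?thesis
    unfolding eq by (intro integral_eq_of_nn_integral_finite[symmetric]) (auto simp: f_nonneg)
qed

end

theorem lemma4:
  fixes M :: "'w measure" and \<phi> :: "'w \<Rightarrow> plane set"
    and lp c \<mu> T :: real and f g :: "plane \<Rightarrow> real" and z :: plane
  assumes "0 < lp" and "0 < c" and "isotropic_density f"
    and "neyman_scott_process M lp c f \<phi>"
    and "0 < \<mu>" and "path_loss g" and "0 < T" and "z \<noteq> 0"
  shows "success_probability \<mu> g T z (reduced_palm M \<phi>) =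
     exp (- lp * (\<integral>y. (1 - exp (- c * beta g f T z y)) \<partial>lborel)) *
     (\<integral>y. exp (- c * beta g f T z y) * f y \<partial>lborel)"
proof -
  interpret success_model c f g T z
    by unfold_locales (fact assms)+
  obtain \<Psi> and X :: "nat \<Rightarrow> 'w \<Rightarrow> plane" and C :: "nat \<Rightarrow> 'w \<Rightarrow> nat \<times> (nat \<Rightarrow> plane)"
    where "point_process M \<phi>" "poisson_process M lp \<Psi>"
    "\<And>n. X n \<in> M \<rightarrow>\<^sub>M borel" "\<And>n. C n \<in> M \<rightarrow>\<^sub>M cluster_law c f"
    "AE \<omega> in M. bij_betw (\<lambda>n. X n \<omega>) UNIV (\<Psi> \<omega>)"
    "distr M ((\<Pi>\<^sub>M n\<in>UNIV. borel) \<Otimes>\<^sub>M (\<Pi>\<^sub>M n\<in>UNIV. cluster_law c f)) (\<lambda>\<omega>. (\<lambda>n. X n \<omega>, \<lambda>n. C n \<omega>))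
      = distr M (\<Pi>\<^sub>M n\<in>UNIV. borel) (\<lambda>\<omega> n. X n \<omega>) \<Otimes>\<^sub>M (\<Pi>\<^sub>M n\<in>UNIV. cluster_law c f)"
    "AE \<omega> in M. \<phi> \<omega> = (\<Union>n. cluster_points (X n \<omega>) (C n \<omega>))"
    using assms(4) unfolding neyman_scott_process_def by blast
  then interpret neyman_scott_representation M lp \<Psi> X c f \<phi> C
    by unfold_locales (use assms(1) in auto)
  let ?P = "reduced_palm M \<phi>"
  let ?\<nu> = "success_exponent g T z"
  let ?L = "\<lambda>A. exp_neg (\<integral>\<^sup>+x. ?\<nu> x \<partial>count_space A)"
  have [measurable]: "?L \<in> borel_measurable configs"
    by measurable
  have "success_probability \<mu> g T z ?P = (\<integral>A. enn2real (?L A) \<partial>?P)"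
    unfolding success_probability_def
  proof (rule Bochner_Integration.integral_cong[OF refl])
    fix A assume "A \<in> space ?P"
    then have "countable A" by (simp add: space_configs locally_finite_set_countable)
    then show "measure (fading_law \<mu> A) (success_event \<mu> g T z A) = enn2real (?L A)"
      using assms g_pos by (intro measure_success_event) auto
  qed
  also have "\<dots> = enn2real (\<integral>\<^sup>+A. ennreal (enn2real (?L A)) \<partial>?P)"
    by (intro integral_eq_nn_integral) (auto intro!: measurable_compose[OF _ borel_measurable_enn2real])
  \<comment> \<open>\<open>?L\<close> is at most 1, so no infinite value is lost under
    \<open>enn2real\<close>.\<close>
  also have "(\<integral>\<^sup>+A. ennreal (enn2real (?L A)) \<partial>?P) = (\<integral>\<^sup>+A. ?L A \<partial>?P)"
    using exp_neg_le_1 by (intro nn_integral_cong ennreal_enn2real) (simp add: order_le_less_trans[OF _ ennreal_one_less_top])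
  also have "\<dots> = ennreal (exp (- lp * (\<integral>y. (1 - exp (- c * beta g f T z y)) \<partial>lborel))) *
      ennreal (\<integral>y. exp (- c * beta g f T z y) * f y \<partial>lborel)"
    by (simp add: nn_integral_reduced_palm_exp_neg parent_factor[OF assms(1)] cluster_factor)
  finally show ?thesis
    using f_nonneg by (simp add: enn2real_mult integral_nonneg_AE)
qed

end
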